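(* Let $\mathcal F=\{C_k : k\ge 4\}\cup\{K_4-e\}$, where $C_k$ is the cycle on $k$ vertices and $K_4-e$ is the diamond graph ($K_4$ with one edge removed). A graph $H$ is $\mathcal G$-Hall-colorable if and only if either $|V(H)\setminus V(F)|\le 2$ for every induced subgraph $F$ of $H$ that is isomorphic to a member of $\mathcal F$, or $H\cong K_8-K_{s,t}$ for some integers $s,t\ge 1$ with $s+t\le 6$.
   Context: All graphs are finite and simple. For a finite set $V$, $\mathcal G(V)$ denotes the set of all finite simple undirected graphs with vertex set $V$, and $N_G(v)$ is the (open) neighborhood of $v$ in $G$. List coloring: for a graph $H$, a set of colors $S$ and $L:V(H)\to 2^S$, $H$ is $L$-colorable if there is a map $\varphi:V(H)\to S$ with $\varphi(v)\in L(v)$ for all $v$ and $\varphi(u)\ne\varphi(v)$ for every edge $uv\in E(H)$. For a subgraph $F$ of $H$ and $\sigma\in S$, $\alpha(F,L,\sigma)$ is the maximum size of an independent set $X\subseteq V(F)$ of $F$ with $\sigma\in L(v)$ for all $v\in X$. The pair $(H,L)$ satisfies Hall's condition if $|V(F)|\le\sum_{\sigma\in S}\alpha(F,L,\sigma)$ for every subgraph $F$ of $H$. Graphic lists: for $G,H\in\mathcal G(V)$, let $L(v)=N_G(v)$ for all $v\in V$ (with color set $S=V$). $H$ is $G$-colorable if $H$ is $L$-colorable, and $(H,G)$ satisfies Hall's condition if $(H,L)$ does. A graph $H\in\mathcal G(V)$ is $\mathcal G$-Hall-colorable if, for every $G\in\mathcal G(V)$ such that $(H,G)$ satisfies Hall's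 condition, $H$ is $G$-colorable. $K_8-K_{s,t}$ denotes the graph on $8$ vertices obtained from $K_8$ by deleting the edges of a subgraph isomorphic to the complete bipartite graph $K_{s,t}$. *)

theory Defs imports Main begin

record 'a ugraph =
  verts :: "'a set"
  edges :: "'a set set"

definition simple_graph :: "'a ugraph \<Rightarrow> bool" where
  "simple_graph G \<longleftrightarrow> finite (verts G) \<and> (\<forall>e\<in>edges G. e \<subseteq> verts G \<and> card e = 2)"

definition graphs_on :: "'a set \<Rightarrow> 'a ugraph set" where
  "graphs_on V = {G. simple_graph G \<and> verts G = V}"

definition neighborhood :: "'a ugraph \<Rightarrow> 'a \<Rightarrow> 'a set" where
  "neighborhood G v = {u. {u, v} \<in> edges G}"

definition subgraph :: "'a ugraph \<Rightarrow> 'a ugraph \<Rightarrow> bool" where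
  "subgraph F H \<longleftrightarrow> simple_graph F \<and> verts F \<subseteq> verts H \<and> edges F \<subseteq> edges H"

definition induced_subgraph :: "'a ugraph \<Rightarrow> 'a ugraph \<Rightarrow> bool" where
  "induced_subgraph F H \<longleftrightarrow> subgraph F H \<and> edges F = {e \<in> edges H. e \<subseteq> verts F}"

definition isomorphic :: "'a ugraph \<Rightarrow> 'b ugraph \<Rightarrow> bool" where
  "isomorphic G H \<longleftrightarrow>
    (\<exists>f. bij_betw f (verts G) (verts H) \<and>
      (\<forall>u\<in>verts G. \<forall>v\<in>verts G. {u, v} \<in> edges G \<longleftrightarrow> {f u, f v} \<in> edges H))"

definition independent_in :: "'a ugraph \<Rightarrow> 'a set \<Rightarrow> bool" where
  "independent_in F X \<longleftrightarrow> X \<subseteq> verts F \<and> (\<forall>u\<in>X. \<forall>v\<in>X. {u, v} \<notin> edges F)"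

definition list_colorable :: "'c set \<Rightarrow> 'a ugraph \<Rightarrow> ('a \<Rightarrow> 'c set) \<Rightarrow> bool" where
  "list_colorable S H L \<longleftrightarrow>
    (\<exists>\<phi>. (\<forall>v\<in>verts H. \<phi> v \<in> S \<and> \<phi> v \<in> L v) \<and>
      (\<forall>u\<in>verts H. \<forall>v\<in>verts H. {u, v} \<in> edges H \<longrightarrow> \<phi> u \<noteq> \<phi> v))"

definition color_alpha :: "'a ugraph \<Rightarrow> ('a \<Rightarrow> 'c set) \<Rightarrow> 'c \<Rightarrow> nat" where
  "color_alpha F L \<sigma> = Max {card X | X. independent_in F X \<and> (\<forall>v\<in>X. \<sigma> \<in> L v)}"

definition hall_condition :: "'c set \<Rightarrow> 'a ugraph \<Rightarrow> ('a \<Rightarrow> 'c set) \<Rightarrow> bool" where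
  "hall_condition S H L \<longleftrightarrow>
    (\<forall>F. subgraph F H \<longrightarrow> card (verts F) \<le> (\<Sum>\<sigma>\<in>S. color_alpha F L \<sigma>))"

definition graph_colorable :: "'a ugraph \<Rightarrow> 'a ugraph \<Rightarrow> bool" where
  "graph_colorable H G \<longleftrightarrow> list_colorable (verts G) H (neighborhood G)"

definition graph_hall_condition :: "'a ugraph \<Rightarrow> 'a ugraph \<Rightarrow> bool" where
  "graph_hall_condition H G \<longleftrightarrow> hall_condition (verts G) H (neighborhood G)"

definition graphic_hall_colorable :: "'a ugraph \<Rightarrow> bool" where
  "graphic_hall_colorable H \<longleftrightarrow>
    (\<forall>G\<in>graphs_on (verts H). graph_hall_condition H G \<longrightarrow> graph_colorable H G)"

definition complete_graph :: "nat \<Rightarrow> nat ugraph" where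
  "complete_graph n = \<lparr>verts = {..<n}, edges = {{i, j} | i j. i < n \<and> j < n \<and> i \<noteq> j}\<rparr>"

text \<open>Meant for \<open>k \<ge> 3\<close> only; smaller values do not give a simple cycle.\<close>

definition cycle_graph :: "nat \<Rightarrow> nat ugraph" where
  "cycle_graph k = \<lparr>verts = {..<k}, edges = {{i, (i + 1) mod k} | i. i < k}\<rparr>"

definition complete_bipartite :: "nat \<Rightarrow> nat \<Rightarrow> nat ugraph" where
  "complete_bipartite s t =
    \<lparr>verts = {..<s + t}, edges = {{i, j} | i j. i < s \<and> s \<le> j \<and> j < s + t}\<rparr>"

definition delete_edges :: "'a ugraph \<Rightarrow> 'a set set \<Rightarrow> 'a ugraph" where
  "delete_edges G D = \<lparr>verts = verts G, edges = edges G - D\<rparr>"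

definition diamond :: "nat ugraph" where
  "diamond = delete_edges (complete_graph 4) {{0, 1}}"

definition cycles_and_diamond :: "nat ugraph set" where
  "cycles_and_diamond = {cycle_graph k | k. k \<ge> 4} \<union> {diamond}"

text \<open>For \<open>s + t \<le> 8\<close> the graph \<^term>\<open>complete_bipartite s t\<close> is literally a subgraph of
  \<^term>\<open>complete_graph 8\<close>. Any two copies of it there differ by a permutation of the vertices, so
  up to isomorphism the choice of the copy to delete is immaterial.\<close>

definition K8_minus_K :: "nat \<Rightarrow> nat \<Rightarrow> nat ugraph" where
  "K8_minus_K s t = delete_edges (complete_graph 8) (edges (complete_bipartite s t))"

end

theory Submission imports Defs begin

text \<open>
  Take a minimal set \<open>U\<close> of vertices of \<open>H\<close> that is not colourable from the lists \<open>N\<^sub>G(v)\<close>. Fewer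
  than \<open>|U|\<close> colours occur on \<open>U\<close>, so some vertices of \<open>U\<close> have no \<open>G\<close>-neighbour in \<open>U\<close> and take
  their colours from outside \<open>U\<close>. The other vertices of \<open>U\<close> form a set \<open>T\<close> on which \<open>G\<close> has minimum
  degree at least 2 and which is not colourable from its own \<open>G\<close>-neighbours; by Hall's marriage
  theorem \<open>T\<close> is empty or \<open>|U| \<ge> 7\<close>. Since Hall's condition suffices for graphs all of whose blocks
  are cliques, \<open>U\<close> contains an induced cycle or diamond, and the few vertices outside it leave too
  little room for \<open>U\<close>.

  Conversely, an induced cycle or diamond has lists in three colours, or in four for a cycle of
  length at least 5, that satisfy Hall's condition and admit no colouring. Outside vertices serve
  as these colours. Only when four vertices are outside a 4-cycle or diamond does one vertex
  remain that has to be given a list from the three colours. This fails for every choice exactly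
  when \<open>H\<close> is one of the graphs \<open>K\<^sub>8 - K\<^sub>s\<^sub>,\<^sub>t\<close>.
\<close>

text \<open>The lists are coupled: \<open>u\<close> is a colour of \<open>v\<close> exactly when
  \<open>v\<close> is a colour of \<open>u\<close>, so lists cannot be prescribed freely on all of
  \<open>V\<close>. They can be prescribed on a set \<open>U\<close> whose colours lie outside
  \<open>U\<close>, at the price that the colour vertices and all remaining vertices must also
  satisfy Hall's condition; a single remaining vertex would have an empty list. This is where eight
  vertices come from. The bad lists {a}, {a,b}, {b,c}, {c,a} round a 4-cycle or diamond return to
  the first colour after three steps, so they use three colours, and four outside vertices leave one
  over: 4 + 4 = 8. On a longer cycle there is one more step, hence room for a fourth colour that
  absorbs the leftover vertex. In the other direction the coupling is what makes counting effective:
  the vertices of \<open>U\<close> with a \<open>G\<close>-neighbour in \<open>U\<close> are the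
  same as the colours on \<open>U\<close> that lie in \<open>U\<close>. They cancel when the colours
  are compared with \<open>U\<close>, so the remaining vertices of \<open>U\<close> outnumber the
  colours outside.\<close>

section \<open>Hall's marriage theorem and Hall's condition\<close>

text \<open>The Halmos-Vaughan induction. A proper nonempty set with exactly as many colours as
  vertices is matched first and its colours are withdrawn from the rest; if there is no such set,
  every proper nonempty set has a colour to spare, so one vertex may take any colour of its
  list.\<close>

lemma hall_marriage:
  fixes L :: "'a \<Rightarrow> 'c set"
  assumes "finite A" "\<And>v. v \<in> A \<Longrightarrow> finite (L v)"
    and "\<And>X. X \<subseteq> A \<Longrightarrow> card X \<le> card (\<Union>(L ` X))"
  shows "\<exists>f. inj_on f A \<and> (\<forall>v\<in>A. f v \<in> L v)"
  using assms
proof (induction "card A" arbitrary: A L rule: less_induct)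
  case less
  show ?case
  proof (cases "A = {}")
    case False
    then obtain a where a: "a \<in> A" by blast
    show ?thesis
    proof (cases "\<exists>X. X \<subset> A \<and> X \<noteq> {} \<and> card (\<Union>(L ` X)) = card X")
      case True
      then obtain X where X: "X \<subset> A" "X \<noteq> {}" "card (\<Union>(L ` X)) = card X" by blast
      have finX: "finite X" using X less.prems finite_subset by blast
      have "card X < card A" using X less.prems(1) psubset_card_mono by blast
      then obtain f where f: "inj_on f X" "\<forall>v\<in>X. f v \<in> L v"
        using less.hyps[of X L] X less.prems finX by (metis psubsetE subset_trans subsetD)
      let ?M = "\<lambda>v. L v - \<Union>(L ` X)"
      have "card (A - X) < card A"
        using X less.prems(1) finX by (metis card_Diff_subset card_gt_0_iff diff_less psubset_imp_subset
            finite_subset less_le_trans card_mono)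
      moreover have "card Y \<le> card (\<Union>(?M ` Y))" if Y: "Y \<subseteq> A - X" for Y
      proof -
        have fY: "finite Y" using Y less.prems(1) finite_subset by blast
        have "card (X \<union> Y) = card X + card Y" using Y finX fY by (intro card_Un_disjoint) auto
        moreover have "card (X \<union> Y) \<le> card (\<Union>(L ` (X \<union> Y)))" by (rule less.prems(3)) (use X(1) Y in auto)
        moreover have "\<Union>(L ` (X \<union> Y)) = \<Union>(L ` X) \<union> \<Union>(?M ` Y)" by auto
        moreover have "card (\<Union>(L ` X) \<union> \<Union>(?M ` Y)) \<le> card (\<Union>(L ` X)) + card (\<Union>(?M ` Y))"
          by (rule card_Un_le)
        ultimately show ?thesis using X(3) by simp
      qed
      ultimately obtain h where h: "inj_on h (A - X)" "\<forall>v\<in>A-X. h v \<in> ?M v"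
        using less.hyps[of "A - X" ?M] less.prems by (metis DiffD1 finite_Diff)
      let ?f = "\<lambda>v. if v \<in> X then f v else h v"
      have ne: "f x \<noteq> h y" if "x \<in> X" "y \<in> A - X" for x y using f h that by force
      have "inj_on ?f A"
      proof (rule inj_onI)
        fix x y assume "x \<in> A" "y \<in> A" "?f x = ?f y"
        then show "x = y" using f(1) h(1) ne[of x y] ne[of y x]
          by (cases "x \<in> X"; cases "y \<in> X") (auto dest: inj_onD)
      qed
      moreover have "\<forall>v\<in>A. ?f v \<in> L v" using f h by auto
      ultimately show ?thesis by blast
    next
      case noX: False
      have "card {a} \<le> card (\<Union>(L ` {a}))" by (rule less.prems(3)) (use a in auto)
      then obtain c where c: "c \<in> L a" by fastforce
      let ?M = "\<lambda>v. L v - {c}"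
      have "card (A - {a}) < card A" using a less.prems(1) by (metis card_Diff1_less)
      moreover have "card Y \<le> card (\<Union>(?M ` Y))" if Y: "Y \<subseteq> A - {a}" for Y
      proof (cases "Y = {}")
        case False
        have "Y \<subset> A" using Y a by blast
        then have "card Y < card (\<Union>(L ` Y))"
          using noX False less.prems(3)[of Y] by (metis le_neq_implies_less psubset_imp_subset)
        moreover have "\<Union>(?M ` Y) = \<Union>(L ` Y) - {c}" by auto
        moreover have "finite (\<Union>(L ` Y))" 
          by (rule finite_UN_I) (use Y less.prems(1,2) in \<open>auto intro: rev_finite_subset\<close>)
        ultimately show ?thesis by (auto simp: card_Diff_singleton_if)
      qed simp
      ultimately obtain h where h: "inj_on h (A - {a})" "\<forall>v\<in>A-{a}. h v \<in> ?M v"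
        using less.hyps[of "A - {a}" ?M] less.prems by (metis DiffD1 finite_Diff)
      let ?f = "h(a := c)"
      have "inj_on ?f A" using h by (auto simp: inj_on_def)
      moreover have "\<forall>v\<in>A. ?f v \<in> L v" using h c by auto
      ultimately show ?thesis by blast
    qed
  qed simp
qed

section \<open>List colourings and Hall's condition relative to an adjacency relation\<close>

definition colouring :: "('a \<Rightarrow> 'a \<Rightarrow> bool) \<Rightarrow> ('a \<Rightarrow> 'c set) \<Rightarrow> 'a set \<Rightarrow> ('a \<Rightarrow> 'c) \<Rightarrow> bool" where
  "colouring E L U \<phi> \<longleftrightarrow> (\<forall>v\<in>U. \<phi> v \<in> L v) \<and> (\<forall>u\<in>U. \<forall>v\<in>U. E u v \<longrightarrow> \<phi> u \<noteq> \<phi> v)"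

definition colourable :: "('a \<Rightarrow> 'a \<Rightarrow> bool) \<Rightarrow> ('a \<Rightarrow> 'c set) \<Rightarrow> 'a set \<Rightarrow> bool" where
  "colourable E L U \<longleftrightarrow> (\<exists>\<phi>. colouring E L U \<phi>)"

definition indep :: "('a \<Rightarrow> 'a \<Rightarrow> bool) \<Rightarrow> 'a set \<Rightarrow> bool" where
  "indep E Y \<longleftrightarrow> (\<forall>u\<in>Y. \<forall>v\<in>Y. \<not> E u v)"

definition clique :: "('a \<Rightarrow> 'a \<Rightarrow> bool) \<Rightarrow> 'a set \<Rightarrow> bool" where
  "clique E Y \<longleftrightarrow> (\<forall>u\<in>Y. \<forall>v\<in>Y. u \<noteq> v \<longrightarrow> E u v)"

definition alpha :: "('a \<Rightarrow> 'a \<Rightarrow> bool) \<Rightarrow> ('a \<Rightarrow> 'c set) \<Rightarrow> 'a set \<Rightarrow> 'c \<Rightarrow> nat" where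
  "alpha E L X \<sigma> = Max {card Y | Y. Y \<subseteq> X \<and> indep E Y \<and> (\<forall>v\<in>Y. \<sigma> \<in> L v)}"

text \<open>Vertex sets stand for induced subgraphs. These give the strictest inequalities, since
  deleting edges only enlarges independent sets (\<open>alpha_antimono\<close>).\<close>

definition hall :: "('a \<Rightarrow> 'a \<Rightarrow> bool) \<Rightarrow> 'c set \<Rightarrow> ('a \<Rightarrow> 'c set) \<Rightarrow> 'a set \<Rightarrow> bool" where
  "hall E S L V \<longleftrightarrow> (\<forall>X\<subseteq>V. card X \<le> (\<Sum>\<sigma>\<in>S. alpha E L X \<sigma>))"

lemma colourable_subset: "colourable E L U \<Longrightarrow> W \<subseteq> U \<Longrightarrow> colourable E L W"
  unfolding colourable_def colouring_def by blast

lemma colourable_inj: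
  assumes "inj_on f U" "\<forall>v\<in>U. f v \<in> L v" "\<And>u. \<not> E u u"
  shows "colourable E L U"
  unfolding colourable_def colouring_def using assms by (metis inj_onD)

lemma alpha_set_finite:
  "finite X \<Longrightarrow> finite {card Y | Y. Y \<subseteq> X \<and> indep E Y \<and> (\<forall>v\<in>Y. \<sigma> \<in> L v)}"
  by (rule finite_subset[of _ "card ` Pow X"]) auto

lemma alpha_ge:
  assumes "finite X" "Y \<subseteq> X" "indep E Y" "\<And>v. v \<in> Y \<Longrightarrow> \<sigma> \<in> L v"
  shows "card Y \<le> alpha E L X \<sigma>"
  unfolding alpha_def using assms by (intro Max_ge alpha_set_finite) auto

lemma alpha_obtain:
  assumes "finite X"
  obtains Y where "Y \<subseteq> X" "indep E Y" "\<And>v. v \<in> Y \<Longrightarrow> \<sigma> \<in> L v" "card Y = alpha E L X \<sigma>"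
proof -
  have "alpha E L X \<sigma> \<in> {card Y | Y. Y \<subseteq> X \<and> indep E Y \<and> (\<forall>v\<in>Y. \<sigma> \<in> L v)}"
    unfolding alpha_def
  proof (rule Max_in[OF alpha_set_finite[OF assms]])
    have "card {} \<in> {card Y | Y. Y \<subseteq> X \<and> indep E Y \<and> (\<forall>v\<in>Y. \<sigma> \<in> L v)}"
      by (intro CollectI exI[of _ "{}"]) (auto simp: indep_def)
    then show "{card Y | Y. Y \<subseteq> X \<and> indep E Y \<and> (\<forall>v\<in>Y. \<sigma> \<in> L v)} \<noteq> {}" by blast
  qed
  then show ?thesis using that by force
qed

lemma alpha_mono:
  assumes "finite X'" "X \<subseteq> X'" "\<And>v. v \<in> X \<Longrightarrow> \<sigma> \<in> L v \<Longrightarrow> \<sigma> \<in> L' v"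
  shows "alpha E L X \<sigma> \<le> alpha E L' X' \<sigma>"
proof -
  have "finite X" using assms finite_subset by blast
  then obtain Y where "Y \<subseteq> X" "indep E Y" "\<And>v. v \<in> Y \<Longrightarrow> \<sigma> \<in> L v" "card Y = alpha E L X \<sigma>"
    using alpha_obtain by metis
  then show ?thesis using alpha_ge[of X' Y E \<sigma> L'] assms by (metis subsetD subset_trans)
qed

lemma alpha_clique:
  assumes "clique E X" "finite X"
  shows "alpha E L X \<sigma> \<le> 1"
proof -
  obtain Y where Y: "Y \<subseteq> X" "indep E Y" "card Y = alpha E L X \<sigma>"
    using alpha_obtain[OF assms(2)] by metis
  have "u = v" if "u \<in> Y" "v \<in> Y" for u v
    using that Y assms(1) unfolding indep_def clique_def by blast
  moreover have "finite Y" using Y(1) assms(2) finite_subset by blast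
  ultimately have "card Y \<le> Suc 0" using card_le_Suc0_iff_eq by blast
  then show ?thesis using Y by simp
qed

lemma alpha_zero:
  assumes "finite X" "\<And>v. v \<in> X \<Longrightarrow> \<sigma> \<notin> L v"
  shows "alpha E L X \<sigma> = 0"
proof -
  obtain Y where Y: "Y \<subseteq> X" "\<And>v. v \<in> Y \<Longrightarrow> \<sigma> \<in> L v" "card Y = alpha E L X \<sigma>"
    using alpha_obtain[OF assms(1)] by metis
  then have "Y = {}" using assms by blast
  then show ?thesis using Y by simp
qed

lemma hall_sum_pot:
  assumes "hall E S L V" "finite S" "finite V" "X \<subseteq> V" "\<And>v. v \<in> X \<Longrightarrow> L v \<inter> S \<subseteq> Q" "finite Q"
  shows "card X \<le> (\<Sum>\<sigma>\<in>Q. alpha E L X \<sigma>)"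
proof -
  have fX: "finite X" using assms finite_subset by blast
  have "card X \<le> (\<Sum>\<sigma>\<in>S. alpha E L X \<sigma>)" using assms unfolding hall_def by blast
  also have "\<dots> = (\<Sum>\<sigma>\<in>S \<inter> Q. alpha E L X \<sigma>)"
    using assms(2,5) by (intro sum.mono_neutral_right) (auto intro!: alpha_zero[OF fX])
  also have "\<dots> \<le> (\<Sum>\<sigma>\<in>Q. alpha E L X \<sigma>)"
    using assms by (intro sum_mono2) auto
  finally show ?thesis .
qed

text \<open>On a clique each colour counts at most once, so Hall's condition becomes the hypothesis
  of the marriage theorem.\<close>

lemma hall_clique_card:
  assumes "hall E S L V" "finite S" "finite V" "X \<subseteq> V" "\<And>v. v \<in> X \<Longrightarrow> L v \<inter> S \<subseteq> Q" "finite Q"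
    and "clique E X"
  shows "card X \<le> card Q"
proof -
  have fX: "finite X" using assms finite_subset by blast
  have "card X \<le> (\<Sum>\<sigma>\<in>Q. alpha E L X \<sigma>)" by (rule hall_sum_pot) (use assms in auto)
  also have "\<dots> \<le> (\<Sum>\<sigma>\<in>Q. 1)" by (intro sum_mono alpha_clique[OF assms(7) fX])
  finally show ?thesis by simp
qed

text \<open>A certificate for one inequality of Hall's condition, obtained by counting
  \<open>R\<close> colour by colour. \<open>R\<close> need not be a function: a vertex may carry
  several colours and another none, which is what happens on sets that satisfy the inequality
  without being colourable.\<close>

lemma card_le_sum_alpha:
  assumes "finite X" "finite S" "R \<subseteq> X \<times> S" "card X \<le> card R"
    and "\<And>v \<sigma>. (v, \<sigma>) \<in> R \<Longrightarrow> \<sigma> \<in> L v"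
    and "\<And>u v \<sigma>. (u, \<sigma>) \<in> R \<Longrightarrow> (v, \<sigma>) \<in> R \<Longrightarrow> \<not> E u v"
  shows "card X \<le> (\<Sum>\<sigma>\<in>S. alpha E L X \<sigma>)"
proof -
  have fR: "finite R" using assms finite_subset by blast
  have "card R = card ((\<lambda>(v, \<sigma>). (\<sigma>, v)) ` R)"
    by (rule card_image[symmetric]) (auto simp: inj_on_def)
  also have "(\<lambda>(v, \<sigma>). (\<sigma>, v)) ` R = (SIGMA \<sigma>:S. {v. (v, \<sigma>) \<in> R})"
    using assms(3) by (auto simp: image_iff)
  also have "card (SIGMA \<sigma>:S. {v. (v, \<sigma>) \<in> R}) = (\<Sum>\<sigma>\<in>S. card {v. (v, \<sigma>) \<in> R})"
    using assms(1-3) by (intro card_SigmaI) (auto intro: finite_subset[of _ X])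
  also have "\<dots> \<le> (\<Sum>\<sigma>\<in>S. alpha E L X \<sigma>)"
    using assms by (intro sum_mono alpha_ge) (auto simp: indep_def)
  finally show ?thesis using assms(4) by simp
qed

lemma colourable_card_le:
  assumes "finite X" "finite S" "colourable E L X" "\<And>v. v \<in> X \<Longrightarrow> L v \<subseteq> S"
  shows "card X \<le> (\<Sum>\<sigma>\<in>S. alpha E L X \<sigma>)"
proof -
  obtain \<phi> where \<phi>: "colouring E L X \<phi>" using assms colourable_def by metis
  show ?thesis
  proof (rule card_le_sum_alpha[where R = "(\<lambda>v. (v, \<phi> v)) ` X"])
    show "card X \<le> card ((\<lambda>v. (v, \<phi> v)) ` X)" by (simp add: card_image inj_on_def)
  qed (use assms \<phi> in \<open>auto simp: colouring_def\<close>)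
qed

section \<open>Graphs whose blocks are cliques\<close>

locale simple_adjacency =
  fixes E :: "'a \<Rightarrow> 'a \<Rightarrow> bool"
  assumes sym: "E u v \<Longrightarrow> E v u" and irrefl: "\<not> E u u"
begin

definition cycle :: "(nat \<Rightarrow> 'a) \<Rightarrow> nat \<Rightarrow> bool" where
  "cycle v k \<longleftrightarrow> inj_on v {..<k} \<and> (\<forall>i. Suc i < k \<longrightarrow> E (v i) (v (Suc i))) \<and> E (v (k - 1)) (v 0)"

definition hole :: "(nat \<Rightarrow> 'a) \<Rightarrow> nat \<Rightarrow> bool" where
  "hole v k \<longleftrightarrow> k \<ge> 4 \<and> cycle v k \<and>
    (\<forall>i j. i < j \<longrightarrow> j < k \<longrightarrow> E (v i) (v j) \<longrightarrow> j = Suc i \<or> (i = 0 \<and> j = k - 1))"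

text \<open>\<open>x\<close> and \<open>y\<close> are the ends of the edge shared by the two
  triangles.\<close>

definition is_diamond :: "'a \<Rightarrow> 'a \<Rightarrow> 'a \<Rightarrow> 'a \<Rightarrow> bool" where
  "is_diamond x y u v \<longleftrightarrow> u \<noteq> v \<and> E x y \<and> E x u \<and> E x v \<and> E y u \<and> E y v \<and> \<not> E u v"

definition obstruction :: "'a set \<Rightarrow> bool" where
  "obstruction F \<longleftrightarrow> (\<exists>v k. hole v k \<and> F = v ` {..<k}) \<or> (\<exists>x y u v. is_diamond x y u v \<and> F = {x, y, u, v})"

text \<open>Chordal and diamond-free, which characterises the graphs whose blocks are cliques; this
  form spares a formalisation of blocks.\<close>

definition block_graph :: "'a set \<Rightarrow> bool" where
  "block_graph W \<longleftrightarrow> (\<forall>F\<subseteq>W. \<not> obstruction F)"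

lemma block_graph_subset: "block_graph W \<Longrightarrow> X \<subseteq> W \<Longrightarrow> block_graph X"
  unfolding block_graph_def by blast

lemma block_graph_no_diamond:
  assumes "block_graph W" "{x, y, u, v} \<subseteq> W"
  shows "\<not> is_diamond x y u v"
proof
  assume "is_diamond x y u v"
  then have "obstruction {x, y, u, v}" unfolding obstruction_def by blast
  then show False using assms unfolding block_graph_def by blast
qed

text \<open>A cycle longer than a triangle has a chord, which cuts it into two shorter cycles. Both
  are cliques by induction, and they share the two ends of the chord; a nonadjacent pair from
  different sides would form a diamond with these ends.\<close>

lemma cycle_image_clique:
  assumes "block_graph W" "cycle v k" "k \<ge> 3" "v ` {..<k} \<subseteq> W"
  shows "clique E (v ` {..<k})"
  using assms
proof (induction k arbitrary: v rule: less_induct)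
  case (less k)
  have inj: "inj_on v {..<k}" and step: "\<And>i. Suc i < k \<Longrightarrow> E (v i) (v (Suc i))" and close: "E (v (k - 1)) (v 0)"
    using less.prems unfolding cycle_def by auto
  show ?case
  proof (cases "k = 3")
    case True
    have "E (v 0) (v 1)" "E (v 1) (v 2)" "E (v 2) (v 0)"
      using step[of 0] step[of 1] close True by (auto simp: numeral_2_eq_2)
    moreover have "{..<k} = {0, 1, 2}" using True by auto
    ultimately show ?thesis unfolding clique_def using sym by auto
  next
    case False
    then have k4: "k \<ge> 4" using less.prems by simp
    have "\<not> hole v k" using less.prems unfolding block_graph_def obstruction_def by blast
    then obtain i j where ij: "i < j" "j < k" "E (v i) (v j)" "j \<noteq> Suc i" "\<not> (i = 0 \<and> j = k - 1)"
      unfolding hole_def using less.prems k4 by blast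
    \<comment> \<open>\<open>a\<close> is the arc from \<open>i\<close> to \<open>j\<close>;
      \<open>b\<close> is the other arc, re-indexed so as to jump from \<open>i\<close> to
      \<open>j\<close>. The chord closes both.\<close>
    define m where "m = Suc (j - i)"
    define n where "n = Suc i + (k - j)"
    define a where "a t = v (i + t)" for t
    define b where "b t = (if t \<le> i then v t else v (t - Suc i + j))" for t
    have aim: "a ` {..<m} = v ` {i..j}"
    proof -
      have "{i..j} \<subseteq> (\<lambda>t. i + t) ` {..<m}"
      proof
        fix s assume "s \<in> {i..j}"
        then show "s \<in> (\<lambda>t. i + t) ` {..<m}" unfolding m_def by (intro image_eqI[of _ _ "s - i"]) auto
      qed
      then have "{i..j} = (\<lambda>t. i + t) ` {..<m}" using ij unfolding m_def by auto
      then show ?thesis unfolding a_def by (simp add: image_image)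
    qed
    have bim: "b ` {..<n} = v ` ({..i} \<union> {j..<k})"
    proof
      show "b ` {..<n} \<subseteq> v ` ({..i} \<union> {j..<k})"
      proof (rule image_subsetI)
        fix t assume "t \<in> {..<n}"
        then show "b t \<in> v ` ({..i} \<union> {j..<k})"
          by (cases "t \<le> i") (auto simp: b_def n_def intro!: imageI)
      qed
      show "v ` ({..i} \<union> {j..<k}) \<subseteq> b ` {..<n}"
      proof
        fix x assume "x \<in> v ` ({..i} \<union> {j..<k})"
        then consider s where "s \<le> i" "x = v s" | s where "j \<le> s" "s < k" "x = v s" by auto
        then show "x \<in> b ` {..<n}"
        proof cases
          case 1 then show ?thesis unfolding b_def n_def by (intro image_eqI[of _ _ s]) auto
        next
          case 2 then show ?thesis unfolding b_def n_def
            using ij by (intro image_eqI[of _ _ "s - j + Suc i"]) auto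
        qed
      qed
    qed
    have "cycle a m"
      unfolding cycle_def
    proof (intro conjI allI impI)
      show "inj_on a {..<m}" using ij unfolding a_def m_def by (intro inj_onI) (auto dest!: inj_onD[OF inj])
      show "E (a (m - 1)) (a 0)" using ij sym unfolding a_def m_def by simp
    qed (use ij step in \<open>auto simp: a_def m_def\<close>)
    moreover have "cycle b n"
      unfolding cycle_def
    proof (intro conjI allI impI)
      show "inj_on b {..<n}"
      proof (rule inj_onI)
        fix s t assume "s \<in> {..<n}" "t \<in> {..<n}" "b s = b t"
        then show "s = t" using ij unfolding b_def n_def
          by (auto dest!: inj_onD[OF inj] split: if_splits)
      qed
      show "E (b (n - 1)) (b 0)" using close ij unfolding b_def n_def by auto
      fix t assume t: "Suc t < n"
      consider "Suc t \<le> i" | "t = i" | "t > i" by linarith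
      then show "E (b t) (b (Suc t))"
      proof cases
        case 1 then show ?thesis unfolding b_def using step[of t] ij by auto
      next
        case 2 then show ?thesis unfolding b_def using ij by auto
      next
        case 3
        then have "Suc t - Suc i + j = Suc (t - Suc i + j)" by simp
        then show ?thesis unfolding b_def using step[of "t - Suc i + j"] ij t 3 unfolding n_def by auto
      qed
    qed
    moreover have "m < k" "n < k" "m \<ge> 3" "n \<ge> 3" using ij unfolding m_def n_def by auto
    moreover have "v ` {i..j} \<subseteq> W" "v ` ({..i} \<union> {j..<k}) \<subseteq> W" using less.prems ij by auto
    ultimately have ca: "clique E (v ` {i..j})" and cb: "clique E (v ` ({..i} \<union> {j..<k}))"
      using less.IH[of m a] less.IH[of n b] less.prems(1) unfolding aim bim by auto
    have ne: "v s \<noteq> v t" if "s < k" "t < k" "s \<noteq> t" for s t using inj that by (auto dest: inj_onD)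
    have ca': "E (v s) (v t)" if "s \<in> {i..j}" "t \<in> {i..j}" "s \<noteq> t" for s t
      using ca that ij ne[of s t] unfolding clique_def by auto
    have cb': "E (v s) (v t)" if "s \<in> {..i} \<union> {j..<k}" "t \<in> {..i} \<union> {j..<k}" "s \<noteq> t" for s t
    proof -
      have "v s \<noteq> v t" using that ij by (intro ne) auto
      then show ?thesis using cb that unfolding clique_def by blast
    qed
    \<comment> \<open>Both ends of the chord are adjacent to \<open>v p\<close> and to
      \<open>v q\<close>.\<close>
    have cross: "E (v p) (v q)" if p: "p \<in> {i..j}" and q: "q \<in> {..i} \<union> {j..<k}" and "p \<noteq> q" for p q
    proof (cases "p \<in> {i, j} \<or> q \<in> {i, j}")
      case True
      have "(p \<in> {..i} \<union> {j..<k}) \<or> q \<in> {i..j}" using True ij by auto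
      then show ?thesis using ca'[of p q] cb'[of p q] p q \<open>p \<noteq> q\<close> by blast
    next
      case False
      have *: "E (v i) (v p)" "E (v j) (v p)" "E (v i) (v q)" "E (v j) (v q)"
        using ca' cb' p q False ij by auto
      have "v p \<noteq> v q" using inj that ij by (auto dest: inj_onD)
      moreover have "{v i, v j, v p, v q} \<subseteq> W" using less.prems(4) ij p q by auto
      then have "\<not> is_diamond (v i) (v j) (v p) (v q)" by (rule block_graph_no_diamond[OF less.prems(1)])
      ultimately show ?thesis using * ij(3) unfolding is_diamond_def by blast
    qed
    show ?thesis unfolding clique_def
    proof (intro ballI impI)
      fix x y assume "x \<in> v ` {..<k}" "y \<in> v ` {..<k}" "x \<noteq> y"
      then obtain p q where pq: "p < k" "q < k" "p \<noteq> q" "x = v p" "y = v q" by auto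
      have "E (v p) (v q)"
      proof (cases "p \<in> {i..j}"; cases "q \<in> {i..j}")
        assume "p \<in> {i..j}" "q \<in> {i..j}"
        then show ?thesis using ca' pq by blast
      next
        assume "p \<in> {i..j}" "q \<notin> {i..j}"
        then show ?thesis using cross[of p q] pq by auto
      next
        assume "p \<notin> {i..j}" "q \<in> {i..j}"
        then show ?thesis using cross[of q p] pq sym by auto
      next
        assume "p \<notin> {i..j}" "q \<notin> {i..j}"
        then have "p \<in> {..i} \<union> {j..<k}" "q \<in> {..i} \<union> {j..<k}" using pq by auto
        then show ?thesis using cb' pq by blast
      qed
      then show "E x y" using pq by simp
    qed
  qed
qed

definition path_in :: "'a set \<Rightarrow> 'a list \<Rightarrow> bool" where
  "path_in U xs \<longleftrightarrow> distinct xs \<and> set xs \<subseteq> U \<and> successively E xs"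

text \<open>The chord closes the initial segment of the path to a cycle; only \<open>m = 1\<close>,
  a single edge, is too short for \<open>cycle_image_clique\<close>.\<close>

lemma path_in_chord_clique:
  assumes "block_graph U" "path_in U xs" "m < length xs" "E (xs ! 0) (xs ! m)"
  shows "clique E (set (take (Suc m) xs))"
proof -
  have "(!) xs ` {0..<Suc m} = set (take (Suc m) xs)"
    by (rule nth_image) (use assms(3) in simp)
  then have s: "set (take (Suc m) xs) = (!) xs ` {..<Suc m}" unfolding lessThan_atLeast0 ..
  have m0: "m \<noteq> 0" using assms(4) irrefl by metis
  show ?thesis
  proof (cases "m = 1")
    case True
    then show ?thesis using assms(4) sym unfolding s clique_def by (auto simp: less_Suc_eq)
  next
    case False
    have "cycle ((!) xs) (Suc m)"
      unfolding cycle_def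
    proof (intro conjI allI impI)
      show "inj_on ((!) xs) {..<Suc m}"
        using assms unfolding path_in_def by (auto intro!: inj_on_nth)
      show "E (xs ! (Suc m - 1)) (xs ! 0)" using assms(4) sym by simp
      fix i assume "Suc i < Suc m"
      then show "E (xs ! i) (xs ! Suc i)"
        using assms(2,3) unfolding path_in_def successively_conv_nth by auto
    qed
    moreover have "(!) xs ` {..<Suc m} \<subseteq> U" using assms(2,3) unfolding path_in_def by (force simp: set_conv_nth)
    ultimately show ?thesis using cycle_image_clique[OF assms(1)] False m0 unfolding s by auto
  qed
qed

text \<open>The end of a longest path lies in a leaf block.\<close>

lemma block_graph_leaf:
  assumes "finite U" "U \<noteq> {}" "block_graph U"
  obtains B v where "B \<subseteq> U" "B \<noteq> {}" "clique E B"
    "\<And>b y. b \<in> B \<Longrightarrow> y \<in> U - B \<Longrightarrow> E b y \<Longrightarrow> y = v"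
    "\<And>b. v \<in> U - B \<Longrightarrow> b \<in> B \<Longrightarrow> E b v"
proof -
  obtain u where u: "u \<in> U" using assms by blast
  have bound: "length ys \<le> card U" if "path_in U ys" for ys
    using that assms(1) unfolding path_in_def by (metis card_mono distinct_card)
  have "path_in U [u]" using u unfolding path_in_def by simp
  then have "\<exists>xs. path_in U xs \<and> (\<forall>ys. path_in U ys \<longrightarrow> length ys \<le> length xs)"
    using bound by (intro ex_has_greatest_nat[of _ "[u]" _ "Suc (card U)"]) (auto simp: less_Suc_eq_le)
  then obtain xs where xs: "path_in U xs" and longest: "\<And>ys. path_in U ys \<Longrightarrow> length ys \<le> length xs"
    by blast
  have "length [u] \<le> length xs" by (rule longest[OF \<open>path_in U [u]\<close>])
  then have len: "0 < length xs" unfolding list.size by linarith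
  \<comment> \<open>A neighbour off the path would prolong it. This is stated for every path of
    maximal length because it is applied again to a rearrangement of \<open>xs\<close>.\<close>
  have head: "y \<in> set ys" if "path_in U ys" "length ys = length xs" "y \<in> U" "E (ys ! 0) y" for ys y
  proof (rule ccontr)
    assume "y \<notin> set ys"
    moreover have "ys \<noteq> []" using that len by auto
    ultimately have "path_in U (y # ys)"
      using that sym unfolding path_in_def by (cases ys) auto
    then show False using longest[of "y # ys"] that by simp
  qed
  show thesis
  proof (cases "\<exists>y\<in>U. E (xs ! 0) y")
    case False
    have "xs ! 0 \<in> U" using xs len unfolding path_in_def by auto
    \<comment> \<open>For an isolated vertex the value of \<open>v\<close> is a dummy: it lies in
      \<open>B\<close>, and no edge leaves \<open>B\<close>.\<close>
    then show thesis using False by (intro that[of "{xs ! 0}" "xs ! 0"]) (auto simp: clique_def)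
  next
    case True
    \<comment> \<open>Up to the last neighbour \<open>xs ! j\<close> of the first vertex the path
      spans a clique. The vertices before \<open>xs ! j\<close> form \<open>B\<close>, and
      \<open>xs ! j\<close> is the attaching vertex.\<close>
    define J where "J = {j. j < length xs \<and> E (xs ! 0) (xs ! j)}"
    have "finite J" unfolding J_def by simp
    moreover have "J \<noteq> {}" using True head[OF xs refl] unfolding J_def by (auto simp: in_set_conv_nth)
    ultimately have "Max J \<in> J" and maxJ: "\<And>j. j \<in> J \<Longrightarrow> j \<le> Max J" by simp_all
    define j where "j = Max J"
    have j: "j < length xs" "E (xs ! 0) (xs ! j)" using \<open>Max J \<in> J\<close> unfolding J_def j_def by auto
    have j0: "j > 0" using j irrefl by (metis gr0I)
    have cl: "clique E (set (take (Suc j) xs))" by (rule path_in_chord_clique[OF assms(3) xs j])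
    have nth_in: "xs ! t \<in> set (take (Suc m) xs)" if "t \<le> m" "m < length xs" for t m
    proof -
      have "take (Suc m) xs ! t = xs ! t" using that by simp
      then show ?thesis using that by (metis length_take less_Suc_eq_le min.absorb2 nth_mem Suc_leI)
    qed
    have dist: "distinct xs" and subU: "set xs \<subseteq> U" using xs unfolding path_in_def by auto
    have "(!) xs ` {0..<j} = set (take j xs)" by (rule nth_image) (use j(1) in simp)
    then have B: "set (take j xs) = {xs ! i | i. i < j}" by force
    show thesis
    proof (rule that[of "set (take j xs)" "xs ! j"])
      show "set (take j xs) \<subseteq> U" using subU set_take_subset by fastforce
      show "set (take j xs) \<noteq> {}" using j0 len by auto
      show "clique E (set (take j xs))"
        using cl set_take_subset_set_take[of j "Suc j" xs] unfolding clique_def by auto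
    next
      fix b assume "b \<in> set (take j xs)"
      then obtain i where i: "i < j" "b = xs ! i" unfolding B by auto
      have "xs ! i \<noteq> xs ! j" using i j dist by (auto simp: nth_eq_iff_index_eq)
      then show "E b (xs ! j)" using cl nth_in[of i j] nth_in[of j j] i j unfolding clique_def by auto
    next
      fix b y assume "b \<in> set (take j xs)" and y: "y \<in> U - set (take j xs)" "E b y"
      then obtain i where i: "i < j" "b = xs ! i" unfolding B by auto
      \<comment> \<open>Reversing the first \<open>i + 1\<close> vertices gives another longest
        path, now starting at \<open>b\<close>, because \<open>xs ! 0\<close> and
        \<open>xs ! Suc i\<close> are adjacent. Hence all neighbours of \<open>b\<close> lie on the
        path.\<close>
      define ys where "ys = rev (take (Suc i) xs) @ drop (Suc i) xs"
      have "set xs = set (take (Suc i) xs @ drop (Suc i) xs)" by (simp only: append_take_drop_id)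
      then have "set ys = set xs" unfolding ys_def by (simp only: set_append set_rev)
      moreover have "distinct ys"
        unfolding ys_def using dist set_take_disj_set_drop_if_distinct[OF dist, of "Suc i" "Suc i"] by simp
      moreover have "successively E ys"
      proof -
        have "successively E (take (Suc i) xs @ drop (Suc i) xs)" using xs unfolding path_in_def by simp
        then have "successively E (take (Suc i) xs)" "successively E (drop (Suc i) xs)"
          unfolding successively_append_iff by auto
        moreover have "successively (\<lambda>x y. E y x) (take (Suc i) xs)"
          using calculation(1) by (rule successively_mono) (auto intro: sym)
        moreover have "E (xs ! 0) (xs ! Suc i)"
        proof -
          have "xs ! 0 \<noteq> xs ! Suc i" using nth_eq_iff_index_eq[OF dist, of 0 "Suc i"] i j len by auto
          then show ?thesis using cl nth_in[of 0 j] nth_in[of "Suc i" j] i j unfolding clique_def by auto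
        qed
        moreover have "last (rev (take (Suc i) xs)) = xs ! 0" using len by (simp add: last_rev hd_take hd_conv_nth)
        moreover have "hd (drop (Suc i) xs) = xs ! Suc i" using i j by (simp add: hd_drop_conv_nth)
        ultimately show ?thesis unfolding ys_def successively_append_iff by simp
      qed
      ultimately have ys: "path_in U ys" using subU unfolding path_in_def by auto
      have leny: "length ys = length xs" unfolding ys_def using i j by simp
      have ys0: "ys ! 0 = xs ! i" unfolding ys_def using i j by (auto simp: nth_append rev_nth)
      have "y \<in> set ys" using head[OF ys leny] y i ys0 by auto
      then obtain m where m: "m < length xs" "y = xs ! m" using \<open>set ys = set xs\<close> by (auto simp: in_set_conv_nth)
      have "m \<ge> j" using y(1) m unfolding B by force
      show "y = xs ! j"
      proof (rule ccontr)
        assume "y \<noteq> xs ! j"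
        then have mj: "m > j" using \<open>m \<ge> j\<close> m by (metis le_neq_implies_less)
        have "ys ! m = xs ! m" unfolding ys_def using mj i m j by (auto simp: nth_append min_def)
        \<comment> \<open>For \<open>m > j\<close> the first \<open>m + 1\<close> entries of
          \<open>ys\<close> and \<open>xs\<close> agree as sets. The edge from \<open>b\<close> to
          \<open>xs ! m\<close> turns them into a clique, so \<open>xs ! 0\<close> would have a
          neighbour beyond \<open>xs ! j\<close>.\<close>
        then have "clique E (set (take (Suc m) ys))"
          using path_in_chord_clique[OF assms(3) ys, of m] leny m ys0 y i by auto
        moreover have "set (take (Suc m) ys) = set (take (Suc m) xs)"
        proof -
          have "Suc m - Suc i = m - i" "min (Suc i) (length xs) = Suc i" using i j by auto
          then have "take (Suc m) ys = rev (take (Suc i) xs) @ take (m - i) (drop (Suc i) xs)"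
            unfolding ys_def using mj i by simp
          moreover have "take (Suc m) xs = take (Suc i) xs @ take (m - i) (drop (Suc i) xs)"
            using take_add[of "Suc i" "m - i" xs] mj i by simp
          ultimately show ?thesis by simp
        qed
        ultimately have "E (xs ! 0) (xs ! m)"
          using nth_in[of 0 m] nth_in[of m m] m dist mj unfolding clique_def
          by (metis le0 le_refl len nth_eq_iff_index_eq not_less0)
        then have "m \<in> J" unfolding J_def using m by simp
        then show False using maxJ mj unfolding j_def by fastforce
      qed
    qed
  qed
qed

end

text \<open>Tight sets are closed under union, since the number of colours is submodular. If
  deleting \<open>c\<close> broke the marriage condition at \<open>Y\<close>, then \<open>Y\<close>
  would be tight with \<open>c\<close> among its colours, and by maximality \<open>Y\<close> would
  lie inside the largest tight set. So only the colours of that set can be indispensable to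
  \<open>B\<close>.\<close>

lemma maximal_tight_set:
  fixes L :: "'a \<Rightarrow> 'c set"
  assumes "finite B" and fin: "\<And>v. v \<in> B \<Longrightarrow> finite (L v)"
    and marriage: "\<And>X. X \<subseteq> B \<Longrightarrow> card X \<le> card (\<Union>(L ` X))"
  obtains X where "X \<subseteq> B" "card (\<Union>(L ` X)) = card X"
    "\<And>c. c \<notin> \<Union>(L ` X) \<Longrightarrow> \<exists>f. inj_on f B \<and> (\<forall>v\<in>B. f v \<in> L v - {c})"
proof -
  define tight where "tight X \<longleftrightarrow> X \<subseteq> B \<and> card (\<Union>(L ` X)) = card X" for X
  have "tight {}" unfolding tight_def by simp
  moreover have "card X < Suc (card B)" if "tight X" for X
    using that assms(1) unfolding tight_def by (simp add: card_mono less_Suc_eq_le)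
  ultimately have "\<exists>X. tight X \<and> (\<forall>Y. tight Y \<longrightarrow> card Y \<le> card X)"
    by (intro ex_has_greatest_nat[of _ "{}" _ "Suc (card B)"]) auto
  then obtain X where X: "tight X" and max: "\<And>Y. tight Y \<Longrightarrow> card Y \<le> card X" by blast
  have finU: "finite (\<Union>(L ` Y))" if "Y \<subseteq> B" for Y
    by (rule finite_UN_I) (use that assms(1) fin in \<open>auto intro: rev_finite_subset\<close>)
  have "\<exists>f. inj_on f B \<and> (\<forall>v\<in>B. f v \<in> L v - {c})" if c: "c \<notin> \<Union>(L ` X)" for c
  proof (rule hall_marriage[OF assms(1)])
    show "finite (L v - {c})" if "v \<in> B" for v using fin that by simp
    fix Y assume Y: "Y \<subseteq> B"
    have UY: "(\<Union>v\<in>Y. L v - {c}) = \<Union>(L ` Y) - {c}" by auto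
    show "card Y \<le> card (\<Union>v\<in>Y. L v - {c})"
    proof (rule ccontr)
      assume "\<not> ?thesis"
      then have less: "card (\<Union>(L ` Y) - {c}) < card Y" unfolding UY by simp
      have cY: "c \<in> \<Union>(L ` Y)"
      proof (rule ccontr)
        assume "c \<notin> \<Union>(L ` Y)"
        then show False using less marriage[OF Y] by simp
      qed
      then have "card (\<Union>(L ` Y)) = card Y"
        using less marriage[OF Y] finU[OF Y] by (simp add: card_Diff_singleton)
      moreover have "X \<subseteq> B" "card (\<Union>(L ` X)) = card X" using X unfolding tight_def by auto
      moreover have "card (\<Union>(L ` (X \<union> Y))) + card (\<Union>(L ` X) \<inter> \<Union>(L ` Y)) = card (\<Union>(L ` X)) + card (\<Union>(L ` Y))"
        using card_Un_Int[OF finU[OF \<open>X \<subseteq> B\<close>] finU[OF Y]] by (simp add: image_Un)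
      moreover have "card (\<Union>(L ` (X \<inter> Y))) \<le> card (\<Union>(L ` X) \<inter> \<Union>(L ` Y))"
        by (rule card_mono) (use finU[OF Y] in auto)
      moreover have "card (X \<inter> Y) \<le> card (\<Union>(L ` (X \<inter> Y)))" by (rule marriage) (use Y in auto)
      moreover have "card (X \<union> Y) \<le> card (\<Union>(L ` (X \<union> Y)))"
        by (rule marriage) (use Y \<open>X \<subseteq> B\<close> in auto)
      moreover have fXY: "finite X" "finite Y" using Y \<open>X \<subseteq> B\<close> assms(1) finite_subset by auto
      moreover have "card (X \<union> Y) + card (X \<inter> Y) = card X + card Y" using card_Un_Int[OF fXY] by simp
      ultimately have "tight (X \<union> Y)" unfolding tight_def using Y by auto
      then have "card (X \<union> Y) \<le> card X" by (rule max)
      then have "X \<union> Y = X" using fXY by (metis card_seteq finite_Un Un_upper1)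
      then show False using c cY by auto
    qed
  qed
  then show thesis using that X unfolding tight_def by blast
qed

context simple_adjacency begin

lemma colouring_join:
  assumes "colouring E L A f" "colouring E L B g" "A \<inter> B = {}"
    and "\<And>a b. a \<in> A \<Longrightarrow> b \<in> B \<Longrightarrow> E a b \<Longrightarrow> f a \<noteq> g b"
  shows "colourable E L (A \<union> B)"
proof -
  define h where "h v = (if v \<in> A then f v else g v)" for v
  have "h u \<noteq> h v" if "u \<in> A \<union> B" "v \<in> A \<union> B" "E u v" for u v
    using that assms(1,2) assms(4)[of u v] assms(4)[of v u] sym[of u v] unfolding colouring_def h_def
    by (cases "u \<in> A"; cases "v \<in> A") (auto dest: not_sym)
  then have "colouring E L (A \<union> B) h"
    using assms(1-3) unfolding colouring_def h_def by auto
  then show ?thesis unfolding colourable_def by blast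
qed

lemma colouring_inj:
  assumes "inj_on f U" "\<And>v. v \<in> U \<Longrightarrow> f v \<in> L v"
  shows "colouring E L U f"
  unfolding colouring_def using assms irrefl by (metis inj_onD)

lemma hall_subset: "hall E S L V \<Longrightarrow> W \<subseteq> V \<Longrightarrow> hall E S L W"
  unfolding hall_def by blast

text \<open>Induction by removing a leaf block \<open>B\<close> without its attaching vertex
  \<open>v\<close>. The list of \<open>v\<close> is cut down to colours that leave a system of
  distinct representatives for \<open>B\<close>; the point is that Hall's condition survives this
  restriction.\<close>

theorem hall_block_graph_colourable:
  assumes "finite U" "finite S" "block_graph U" "\<And>v. v \<in> U \<Longrightarrow> L v \<subseteq> S" "hall E S L U"
  shows "colourable E L U"
  using assms
proof (induction "card U" arbitrary: U L rule: less_induct)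
  case less
  show ?case
  proof (cases "U = {}")
    case True
    then show ?thesis unfolding colourable_def colouring_def by blast
  next
    case False
    obtain B v where B: "B \<subseteq> U" "B \<noteq> {}" "clique E B"
      and out: "\<And>b y. b \<in> B \<Longrightarrow> y \<in> U - B \<Longrightarrow> E b y \<Longrightarrow> y = v"
      and adj: "\<And>b. v \<in> U - B \<Longrightarrow> b \<in> B \<Longrightarrow> E b v"
      using block_graph_leaf[OF less.prems(1) False less.prems(3)] by metis
    have finB: "finite B" using B less.prems(1) finite_subset by blast
    have finL: "finite (L b)" if "b \<in> B" for b
      using that B less.prems(2,4) by (meson finite_subset subsetD)
    have marriage: "card X \<le> card (\<Union>(L ` X))" if "X \<subseteq> B" for X
    proof (rule hall_clique_card[OF less.prems(5,2,1)])
      show "finite (\<Union>(L ` X))" using that finB finL by (intro finite_UN_I) (auto intro: rev_finite_subset)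
      show "clique E X" using that B(3) unfolding clique_def by blast
    qed (use that B in auto)
    obtain T where T: "T \<subseteq> B" "card (\<Union>(L ` T)) = card T"
      and sdr: "\<And>c. c \<notin> \<Union>(L ` T) \<Longrightarrow> \<exists>f. inj_on f B \<and> (\<forall>v\<in>B. f v \<in> L v - {c})"
      using maximal_tight_set[OF finB finL marriage] by metis
    define A where "A = {c \<in> L v. \<exists>f. inj_on f B \<and> (\<forall>b\<in>B. f b \<in> L b - {c})}"
    define L' where "L' = L(v := A)"
    define W where "W = U - B"
    have subL: "L' u \<subseteq> L u" for u unfolding L'_def A_def by auto
    have finW: "finite W" and WU: "W \<subseteq> U" using less.prems(1) unfolding W_def by auto
    have U: "U = B \<union> W" "B \<inter> W = {}" using B unfolding W_def by auto
    have "hall E S L' W"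
    proof (rule ccontr)
      assume "\<not> ?thesis"
      then obtain X where X: "X \<subseteq> W" "(\<Sum>\<sigma>\<in>S. alpha E L' X \<sigma>) < card X" unfolding hall_def by force
      have fX: "finite X" "finite T" using X finW T finB finite_subset by auto
      \<comment> \<open>Adding the tight set \<open>T\<close> to a violating \<open>X\<close> adds
        \<open>card T\<close> vertices and, by this bound, at most \<open>card T\<close> to the sum,
        so \<open>X\<close> together with \<open>T\<close> would violate the original condition. A
        colour outside the lists of \<open>T\<close> has not been removed from the list of
        \<open>v\<close>.\<close>
      have le: "alpha E L (X \<union> T) \<sigma> \<le> alpha E L' X \<sigma> + (if \<sigma> \<in> \<Union>(L ` T) then 1 else 0)" for \<sigma>
      proof -
        obtain Y where Y: "Y \<subseteq> X \<union> T" "indep E Y" "\<And>u. u \<in> Y \<Longrightarrow> \<sigma> \<in> L u" "card Y = alpha E L (X \<union> T) \<sigma>"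
          using alpha_obtain[of "X \<union> T" E \<sigma> L] fX by (metis finite_Un)
        have fY: "finite Y" using Y(1) fX finite_subset by blast
        show ?thesis
        proof (cases "\<sigma> \<in> \<Union>(L ` T)")
          case False
          then have "Y \<subseteq> X" using Y by blast
          moreover have "\<sigma> \<in> L' u" if "u \<in> Y" for u
            using sdr[OF False] Y(3)[OF that] unfolding L'_def A_def by auto
          ultimately have "card Y \<le> alpha E L' X \<sigma>" using Y(2) fX by (intro alpha_ge) auto
          then show ?thesis using Y(4) by simp
        next
          case True
          define Z where "Z = Y - T - {v}"
          have "card Z \<le> alpha E L' X \<sigma>"
          proof (rule alpha_ge[OF fX(1)])
            show "Z \<subseteq> X" using Y(1) unfolding Z_def by auto
            show "indep E Z" using Y(2) unfolding Z_def indep_def by auto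
            show "\<sigma> \<in> L' u" if "u \<in> Z" for u using that Y(3) unfolding Z_def L'_def by auto
          qed
          \<comment> \<open>One vertex accounts for the whole loss: \<open>Y\<close> meets the
            clique \<open>B\<close> at most once, and if it does, it cannot contain
            \<open>v\<close>, which is adjacent to all of \<open>B\<close>.\<close>
          moreover have "\<exists>w. Y \<subseteq> insert w Z"
          proof (cases "Y \<inter> T = {}")
            case True
            then show ?thesis unfolding Z_def by (intro exI[of _ v]) auto
          next
            case False
            then obtain b where b: "b \<in> Y" "b \<in> T" by blast
            have "Y \<inter> T \<subseteq> {b}" using b Y(2) B(3) T(1) unfolding clique_def indep_def by blast
            moreover have "v \<notin> Y - T"
            proof
              assume "v \<in> Y - T"
              then have "v \<in> U - B" using Y(1) X(1) unfolding W_def by auto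
              then have "E b v" using adj b T(1) by blast
              then show False using Y(2) b \<open>v \<in> Y - T\<close> unfolding indep_def by blast
            qed
            ultimately show ?thesis unfolding Z_def by (intro exI[of _ b]) auto
          qed
          moreover have "card (insert w Z) \<le> Suc (card Z)" for w
            using fY unfolding Z_def by (simp add: card_insert_if)
          moreover have "finite (insert w Z)" for w using fY unfolding Z_def by simp
          ultimately have "card Y \<le> Suc (alpha E L' X \<sigma>)"
            by (meson Suc_le_mono card_mono le_trans)
          then show ?thesis using Y(4) True by simp
        qed
      qed
      have "card X + card T = card (X \<union> T)"
        using X T fX U(2) by (intro card_Un_disjoint[symmetric]) auto
      also have "\<dots> \<le> (\<Sum>\<sigma>\<in>S. alpha E L (X \<union> T) \<sigma>)"
        using less.prems(5) X(1) WU T(1) B(1) unfolding hall_def by (meson Un_least subset_trans)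
      also have "\<dots> \<le> (\<Sum>\<sigma>\<in>S. alpha E L' X \<sigma> + (if \<sigma> \<in> \<Union>(L ` T) then 1 else 0))"
        by (rule sum_mono) (rule le)
      also have "\<dots> = (\<Sum>\<sigma>\<in>S. alpha E L' X \<sigma>) + card (S \<inter> \<Union>(L ` T))"
        using less.prems(2) by (simp only: sum.distrib sum.If_cases) (simp add: Int_def)
      also have "card (S \<inter> \<Union>(L ` T)) \<le> card (\<Union>(L ` T))"
        using T(1) fX finL by (intro card_mono finite_UN_I) auto
      finally show False using X(2) T(2) by simp
    qed
    moreover have "card W < card U"
      unfolding W_def using B less.prems(1) by (intro psubset_card_mono) auto
    moreover have "block_graph W" using less.prems(3) WU by (rule block_graph_subset)
    moreover have "L' u \<subseteq> S" if "u \<in> W" for u using subL[of u] less.prems(4) that WU by blast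
    ultimately have "colourable E L' W" using less.hyps[of W L'] finW less.prems(2) by blast
    then obtain \<phi> where \<phi>: "colouring E L' W \<phi>" unfolding colourable_def by blast
    then have \<phi>L: "colouring E L W \<phi>" using subL unfolding colouring_def by blast
    obtain f where f: "inj_on f B" "\<forall>b\<in>B. f b \<in> L b" "v \<in> W \<Longrightarrow> \<forall>b\<in>B. f b \<noteq> \<phi> v"
    proof (cases "v \<in> W")
      case True
      then have "\<phi> v \<in> A" using \<phi> unfolding colouring_def L'_def by (metis fun_upd_same)
      then show ?thesis using that unfolding A_def by blast
    next
      case False
      then show ?thesis using that hall_marriage[OF finB finL marriage] by blast
    qed
    have "colouring E L B f" using f by (intro colouring_inj) auto
    moreover have "f b \<noteq> \<phi> y" if "b \<in> B" "y \<in> W" "E b y" for b y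
      using out[of b y] that f(3) unfolding W_def by auto
    ultimately show ?thesis using colouring_join[OF _ \<phi>L U(2)] U(1) by metis
  qed
qed

section \<open>Minimal uncolourable sets\<close>

definition critical :: "('a \<Rightarrow> 'c set) \<Rightarrow> 'a set \<Rightarrow> bool" where
  "critical L U \<longleftrightarrow> \<not> colourable E L U \<and> (\<forall>W. W \<subset> U \<longrightarrow> colourable E L W)"

lemma critical_subset_exists:
  assumes "finite V" "\<not> colourable E L V"
  obtains U where "U \<subseteq> V" "critical L U"
proof -
  let ?P = "\<lambda>U. U \<subseteq> V \<and> \<not> colourable E L U"
  obtain U where U: "?P U" "\<And>W. ?P W \<Longrightarrow> card U \<le> card W"
    using assms(2) ex_has_least_nat[of ?P V card] by blast
  have "colourable E L W" if "W \<subset> U" for W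
  proof (rule ccontr)
    assume "\<not> ?thesis"
    then have "card U \<le> card W" using U that by blast
    moreover have "finite U" using U assms(1) finite_subset by blast
    ultimately show False using psubset_card_mono[of U W] that by linarith
  qed
  then show thesis using that U unfolding critical_def by blast
qed

text \<open>Otherwise \<open>v\<close> could take the colour \<open>c\<close>.\<close>

lemma critical_extension:
  assumes "critical L U" "v \<in> U" "colouring E L (U - {v}) \<phi>" "c \<in> L v"
  obtains u where "u \<in> U" "E v u" "\<phi> u = c"
proof (rule ccontr)
  assume no: "\<not> thesis"
  have "colouring E L {v} (\<lambda>_. c)" using assms(4) irrefl unfolding colouring_def by simp
  then have "colourable E L ({v} \<union> (U - {v}))"
    using assms(3) by (rule colouring_join) (use no that in auto)
  then show False using assms(1,2) unfolding critical_def by (metis insert_Diff insert_is_Un)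
qed

lemma critical_colouring:
  assumes "critical L U" "W \<subset> U"
  obtains \<phi> where "colouring E L W \<phi>"
  using assms unfolding critical_def colourable_def by blast

lemma critical_card_list_le_degree:
  assumes "critical L U" "finite U" "v \<in> U"
  shows "card (L v) \<le> card {u \<in> U. E v u}"
proof -
  obtain \<phi> where \<phi>: "colouring E L (U - {v}) \<phi>"
    using critical_colouring[OF assms(1), of "U - {v}"] assms(3) by blast
  have "L v \<subseteq> \<phi> ` {u \<in> U. E v u}"
  proof
    fix c assume "c \<in> L v"
    then obtain u where "u \<in> U" "E v u" "\<phi> u = c" by (rule critical_extension[OF assms(1,3) \<phi>])
    then show "c \<in> \<phi> ` {u \<in> U. E v u}" by blast
  qed
  then show ?thesis using assms(2) by (intro surj_card_le) auto
qed

text \<open>If the vertices with \<open>\<sigma>\<close> in their list were independent, all of them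
  could take \<open>\<sigma>\<close>, and a colouring of the others, which never use
  \<open>\<sigma>\<close>, would complete it.\<close>

lemma critical_colour_edge:
  assumes "critical L U" "u \<in> U" "\<sigma> \<in> L u"
  obtains x y where "x \<in> U" "y \<in> U" "E x y" "\<sigma> \<in> L x" "\<sigma> \<in> L y"
proof (rule ccontr)
  assume no: "\<not> thesis"
  define C where "C = {x \<in> U. \<sigma> \<in> L x}"
  have "U - C \<subset> U" using assms unfolding C_def by auto
  then obtain \<phi> where \<phi>: "colouring E L (U - C) \<phi>" by (rule critical_colouring[OF assms(1)])
  have "colouring E L C (\<lambda>_. \<sigma>)" unfolding colouring_def C_def using no that by blast
  then have "colourable E L (C \<union> (U - C))"
    using \<phi> by (rule colouring_join) (use \<phi> in \<open>auto simp: colouring_def C_def\<close>)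
  moreover have "C \<union> (U - C) = U" unfolding C_def by auto
  ultimately show False using assms(1) unfolding critical_def by simp
qed

text \<open>For \<open>X\<close> of largest deficiency \<open>d X\<close>, the marriage theorem
  matches the other vertices into colours that do not occur on \<open>X\<close>. A proper
  \<open>X\<close> is colourable, so \<open>U\<close> would be too; hence \<open>X = U\<close>. If
  its deficiency were not positive, \<open>U\<close> itself could be matched injectively.\<close>

lemma critical_small_pot:
  assumes "critical L U" "finite U" and finL: "\<And>v. v \<in> U \<Longrightarrow> finite (L v)"
  shows "card (\<Union>(L ` U)) < card U"
proof -
  define d where "d X = int (card X) - int (card (\<Union>(L ` X)))" for X
  have "Max (d ` Pow U) \<in> d ` Pow U" using assms(2) by (intro Max_in) auto
  then obtain X where X: "X \<subseteq> U" "d X = Max (d ` Pow U)" by auto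
  have max: "d Y \<le> d X" if "Y \<subseteq> U" for Y unfolding X(2) using that assms(2) by (intro Max_ge) auto
  have finU: "finite (\<Union>(L ` Y))" if "Y \<subseteq> U" for Y
    by (rule finite_UN_I) (use that assms(2) finL in \<open>auto intro: rev_finite_subset\<close>)
  define M where "M v = L v - \<Union>(L ` X)" for v
  have "\<exists>f. inj_on f (U - X) \<and> (\<forall>v\<in>U - X. f v \<in> M v)"
  proof (rule hall_marriage)
    fix Y assume Y: "Y \<subseteq> U - X"
    have "\<Union>(L ` (X \<union> Y)) = \<Union>(L ` X) \<union> \<Union>(M ` Y)" unfolding M_def by auto
    moreover have "\<Union>(L ` X) \<inter> \<Union>(M ` Y) = {}" unfolding M_def by auto
    moreover have "finite (\<Union>(M ` Y))"
      by (rule finite_subset[OF _ finU[of Y]]) (use Y in \<open>auto simp: M_def\<close>)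
    ultimately have "card (\<Union>(L ` (X \<union> Y))) = card (\<Union>(L ` X)) + card (\<Union>(M ` Y))"
      using finU[OF X(1)] by (simp add: card_Un_disjoint)
    moreover have "card (X \<union> Y) = card X + card Y"
      using Y X(1) assms(2) by (intro card_Un_disjoint) (auto intro: rev_finite_subset)
    moreover have "d (X \<union> Y) \<le> d X" by (rule max) (use X Y in auto)
    ultimately show "card Y \<le> card (\<Union>(M ` Y))" unfolding d_def by simp
  qed (use assms(2) finL in \<open>auto simp: M_def\<close>)
  then obtain f where f: "inj_on f (U - X)" "\<forall>v\<in>U - X. f v \<in> M v" by blast
  have "X = U"
  proof (rule ccontr)
    assume "X \<noteq> U"
    then obtain \<phi> where \<phi>: "colouring E L X \<phi>" using critical_colouring[OF assms(1), of X] X(1) by blast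
    have "colouring E L (U - X) f" using f unfolding M_def by (intro colouring_inj) auto
    with \<phi> have "colourable E L (X \<union> (U - X))"
      by (rule colouring_join) (use \<phi> f in \<open>auto simp: colouring_def M_def\<close>)
    then show False using assms(1) X(1) unfolding critical_def by (simp add: Un_absorb1)
  qed
  show ?thesis
  proof (rule ccontr)
    assume "\<not> ?thesis"
    then have "d Y \<le> 0" if "Y \<subseteq> U" for Y using max[OF that] \<open>X = U\<close> unfolding d_def by simp
    then have "\<exists>f. inj_on f U \<and> (\<forall>v\<in>U. f v \<in> L v)"
      using assms(2) finL unfolding d_def by (intro hall_marriage) auto
    then obtain f where "inj_on f U" "\<forall>v\<in>U. f v \<in> L v" by blast
    then have "colouring E L U f" by (intro colouring_inj) auto
    then show False using assms(1) unfolding critical_def colourable_def by blast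
  qed
qed


section \<open>Holes: independent sets, two-colour lists, and an additional vertex\<close>

lemma hole_adjacent:
  assumes "hole v k" "i < k" "j < k"
  shows "E (v i) (v j) \<longleftrightarrow> j = Suc i \<or> i = Suc j \<or> (i = 0 \<and> j = k - 1) \<or> (j = 0 \<and> i = k - 1)"
proof -
  have step: "E (v s) (v (Suc s))" if "Suc s < k" for s using assms(1) that unfolding hole_def cycle_def by blast
  have close: "E (v (k - 1)) (v 0)" using assms(1) unfolding hole_def cycle_def by blast
  have chord: "t = Suc s \<or> (s = 0 \<and> t = k - 1)" if "s < t" "t < k" "E (v s) (v t)" for s t
    using assms(1) that unfolding hole_def by blast
  show ?thesis
  proof
    assume "E (v i) (v j)"
    moreover have "i \<noteq> j" using calculation irrefl by auto
    ultimately show "j = Suc i \<or> i = Suc j \<or> (i = 0 \<and> j = k - 1) \<or> (j = 0 \<and> i = k - 1)"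
      using chord[of i j] chord[of j i] sym[of "v i" "v j"] assms(2,3) by linarith
  next
    assume "j = Suc i \<or> i = Suc j \<or> (i = 0 \<and> j = k - 1) \<or> (j = 0 \<and> i = k - 1)"
    then show "E (v i) (v j)" using step[of i] step[of j] close sym assms(2,3) by auto
  qed
qed

lemma hole_inj: "hole v k \<Longrightarrow> inj_on v {..<k}"
  unfolding hole_def cycle_def by blast

lemma hole_card: "hole v k \<Longrightarrow> card (v ` {..<k}) = k"
  using hole_inj by (simp add: card_image)

lemma hole_degree_le:
  assumes "hole v k" "i < k"
  shows "card {u \<in> v ` {..<k}. E (v i) u} \<le> 2"
proof -
  have "{u \<in> v ` {..<k}. E (v i) u} \<subseteq> {v (if Suc i < k then Suc i else 0), v (if i = 0 then k - 1 else i - 1)}"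
    using hole_adjacent[OF assms] assms unfolding hole_def by auto
  then have "card {u \<in> v ` {..<k}. E (v i) u} \<le> card {v (if Suc i < k then Suc i else 0), v (if i = 0 then k - 1 else i - 1)}"
    by (intro card_mono) auto
  also have "\<dots> \<le> 2" by (simp add: card_insert_if)
  finally show ?thesis .
qed

text \<open>The successors of an independent set are disjoint from it and equally many.\<close>

lemma hole_indep_card:
  assumes "hole v k" "Y \<subseteq> v ` {..<k}" "indep E Y"
  shows "2 * card Y \<le> k"
proof -
  define s where "s i = (if Suc i < k then Suc i else 0)" for i
  define J where "J = {i. i < k \<and> v i \<in> Y}"
  have k: "k \<ge> 4" using assms(1) unfolding hole_def by blast
  have Y: "Y = v ` J" using assms(2) unfolding J_def by auto
  have "card Y = card J"
    unfolding Y by (rule card_image) (use hole_inj[OF assms(1)] in \<open>auto simp: J_def intro: inj_on_subset\<close>)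
  moreover have "card (s ` J) = card J"
    by (rule card_image) (auto simp: inj_on_def s_def J_def split: if_splits)
  moreover have "s ` J \<inter> J = {}"
  proof -
    have "False" if "i \<in> J" "s i \<in> J" for i
    proof -
      have "E (v i) (v (s i))"
        using hole_adjacent[OF assms(1), of i "s i"] that unfolding J_def s_def by auto
      then show False using assms(3) that unfolding indep_def J_def by blast
    qed
    then show ?thesis by blast
  qed
  moreover have "card (s ` J \<union> J) \<le> card {..<k}"
    by (rule card_mono) (use k in \<open>auto simp: s_def J_def\<close>)
  moreover have "finite J" unfolding J_def by simp
  ultimately show ?thesis by (simp add: card_Un_disjoint)
qed

text \<open>An odd hole has too small independent sets. In an even hole, the two ends of the path left
  by deleting a vertex get the same colour, so that vertex has a one-element list.\<close>

lemma critical_hole_two_colours: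
  assumes "hole v k" "critical L (v ` {..<k})" "\<And>u. u \<in> v ` {..<k} \<Longrightarrow> L u \<subseteq> {p, q}"
    and "k \<le> (\<Sum>\<sigma>\<in>{p, q}. alpha E L (v ` {..<k}) \<sigma>)"
  shows False
proof -
  let ?U = "v ` {..<k}"
  have k: "k \<ge> 4" using assms(1) unfolding hole_def by blast
  have inj: "v i = v j \<longleftrightarrow> i = j" if "i < k" "j < k" for i j
    using hole_inj[OF assms(1)] that by (auto dest: inj_onD)
  have "2 * alpha E L ?U \<sigma> \<le> k" for \<sigma>
  proof -
    obtain Y where "Y \<subseteq> ?U" "indep E Y" "card Y = alpha E L ?U \<sigma>"
      using alpha_obtain[of ?U E \<sigma> L] by (metis finite_imageI finite_lessThan)
    then show ?thesis using hole_indep_card[OF assms(1)] by metis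
  qed
  note a = this[of p] this[of q]
  \<comment> \<open>Each colour serves at most half of the hole, so the inequality for the whole
    hole is an equality.\<close>
  have "even k"
  proof (cases "p = q")
    case True
    then show ?thesis using a assms(4) k by simp
  next
    case False
    then have "k \<le> alpha E L ?U p + alpha E L ?U q" using assms(4) by simp
    then have "k = 2 * alpha E L ?U p" using a by linarith
    then show ?thesis by (rule dvdI)
  qed
  \<comment> \<open>With only two colours, neighbours of a common coloured vertex agree.\<close>
  have two: "\<phi> (v (Suc (Suc i))) = \<phi> (v i)"
    if "colouring E L W \<phi>" "v i \<in> W" "v (Suc i) \<in> W" "v (Suc (Suc i)) \<in> W" "Suc (Suc i) < k" "W \<subseteq> ?U" for \<phi> i W
  proof -
    have "E (v i) (v (Suc i))" "E (v (Suc i)) (v (Suc (Suc i)))"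
      using hole_adjacent[OF assms(1)] that(5) by auto
    then have "\<phi> (v i) \<noteq> \<phi> (v (Suc i))" "\<phi> (v (Suc i)) \<noteq> \<phi> (v (Suc (Suc i)))"
      using that unfolding colouring_def by blast+
    moreover have "\<phi> (v i) \<in> {p, q}" "\<phi> (v (Suc i)) \<in> {p, q}" "\<phi> (v (Suc (Suc i))) \<in> {p, q}"
      using that assms(3) unfolding colouring_def by blast+
    ultimately show ?thesis by auto
  qed
  have "v 0 \<in> ?U" "v (k - 1) \<in> ?U" using k by auto
  obtain \<phi> where \<phi>: "colouring E L (?U - {v 0}) \<phi>"
    using critical_colouring[OF assms(2), of "?U - {v 0}"] \<open>v 0 \<in> ?U\<close> by blast
  obtain \<psi> where \<psi>: "colouring E L (?U - {v (k - 1)}) \<psi>"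
    using critical_colouring[OF assms(2), of "?U - {v (k - 1)}"] \<open>v (k - 1) \<in> ?U\<close> by blast
  have odds: "\<phi> (v (Suc (2 * i))) = \<phi> (v 1)" if "Suc (2 * i) < k" for i
    using that
  proof (induction i)
    case (Suc i)
    have "\<phi> (v (Suc (Suc (Suc (2 * i))))) = \<phi> (v (Suc (2 * i)))"
      by (rule two[OF \<phi>]) (use Suc.prems inj in auto)
    then show ?case using Suc by simp
  qed simp
  have evens: "\<psi> (v (2 * i)) = \<psi> (v 0)" if "2 * i < k - 1" for i
    using that
  proof (induction i)
    case (Suc i)
    have "\<psi> (v (Suc (Suc (2 * i)))) = \<psi> (v (2 * i))"
      by (rule two[OF \<psi>]) (use Suc.prems inj in auto)
    then show ?case using Suc by simp
  qed simp
  obtain m where m: "k = 2 * m" using \<open>even k\<close> by (rule evenE)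
  then have km: "k - 1 = Suc (2 * (m - 1))" "k - 2 = 2 * (m - 1)" using k by auto
  have L0: "L (v 0) \<subseteq> {\<phi> (v 1)}"
  proof
    fix c assume "c \<in> L (v 0)"
    then obtain u where u: "u \<in> ?U" "E (v 0) u" "\<phi> u = c"
      by (rule critical_extension[OF assms(2) \<open>v 0 \<in> ?U\<close> \<phi>])
    then obtain j where j: "j < k" "u = v j" by auto
    then have "j = 1 \<or> j = k - 1" using hole_adjacent[OF assms(1), of 0 j] u k by auto
    moreover have "\<phi> (v (k - 1)) = \<phi> (v 1)" using odds[of "m - 1"] k unfolding km(1)[symmetric] by simp
    ultimately show "c \<in> {\<phi> (v 1)}" using u j by auto
  qed
  have Lk: "L (v (k - 1)) \<subseteq> {\<psi> (v 0)}"
  proof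
    fix c assume "c \<in> L (v (k - 1))"
    then obtain u where u: "u \<in> ?U" "E (v (k - 1)) u" "\<psi> u = c"
      by (rule critical_extension[OF assms(2) \<open>v (k - 1) \<in> ?U\<close> \<psi>])
    then obtain j where j: "j < k" "u = v j" by auto
    then have "j = 0 \<or> j = k - 2" using hole_adjacent[OF assms(1), of "k - 1" j] u k by auto
    moreover have "\<psi> (v (k - 2)) = \<psi> (v 0)" using evens[of "m - 1"] k unfolding km(2)[symmetric] by simp
    ultimately show "c \<in> {\<psi> (v 0)}" using u j by auto
  qed
  have "\<psi> (v 0) \<in> L (v 0)" using \<psi> \<open>v 0 \<in> ?U\<close> inj[of 0 "k - 1"] k unfolding colouring_def by auto
  \<comment> \<open>Both ends of the edge from \<open>v 0\<close> to \<open>v (k - 1)\<close> have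
    lists inside the same singleton, so already this proper subset is not colourable.\<close>
  then have Lk': "L (v (k - 1)) \<subseteq> {\<phi> (v 1)}" using L0 Lk by auto
  have "{v 0, v (k - 1)} \<subset> ?U"
  proof -
    have "v 1 \<in> ?U" "v 1 \<noteq> v 0" "v 1 \<noteq> v (k - 1)" using inj k by auto
    then show ?thesis using \<open>v 0 \<in> ?U\<close> \<open>v (k - 1) \<in> ?U\<close> by blast
  qed
  then obtain \<chi> where \<chi>: "colouring E L {v 0, v (k - 1)} \<chi>" by (rule critical_colouring[OF assms(2)])
  moreover have "E (v 0) (v (k - 1))" using hole_adjacent[OF assms(1), of 0 "k - 1"] k by auto
  ultimately show False using L0 Lk' unfolding colouring_def by (metis insertI1 insertI2 singletonD subsetD)
qed

text \<open>With \<open>x\<close>, the two arcs between \<open>v i\<close> and \<open>v j\<close>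
  form cycles whose lengths add up to \<open>k + 4\<close>. As \<open>k \<ge> 5\<close>, one of them
  is shorter than \<open>k\<close>; it is too small to contain an obstruction and therefore spans a
  clique.\<close>

lemma hole_apex_neighbours_adjacent:
  assumes "hole v k" "k \<ge> 5" "x \<notin> v ` {..<k}" "i < j" "j < k" "E x (v i)" "E x (v j)"
    and small: "\<And>F. F \<subseteq> insert x (v ` {..<k}) \<Longrightarrow> obstruction F \<Longrightarrow> k \<le> card F"
  shows "E (v i) (v j)"
proof -
  have inj: "inj_on v {..<k}" by (rule hole_inj[OF assms(1)])
  have vx: "v t \<noteq> x" if "t < k" for t using that assms(3) by auto
  have step: "E (v t) (v (Suc t))" if "Suc t < k" for t using hole_adjacent[OF assms(1)] that by auto
  have close: "E (v (k - 1)) (v 0)" using hole_adjacent[OF assms(1)] assms(2) by auto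
  have short_cycle: "E (v i) (v j)"
    if c: "cycle a m" and m: "3 \<le> m" "m < k" and a: "a ` {..<m} \<subseteq> insert x (v ` {..<k})"
      and ij: "v i \<in> a ` {..<m}" "v j \<in> a ` {..<m}" for a m
  proof -
    have "block_graph (a ` {..<m})"
      unfolding block_graph_def
    proof (intro allI impI notI)
      fix F assume F: "F \<subseteq> a ` {..<m}" "obstruction F"
      have "card F \<le> card (a ` {..<m})" by (rule card_mono) (use F in auto)
      also have "\<dots> \<le> m" using card_image_le[of "{..<m}" a] by simp
      finally show False using small[of F] F a m by force
    qed
    then have "clique E (a ` {..<m})" by (rule cycle_image_clique) (use c m in auto)
    moreover have "v i \<noteq> v j" using inj assms(4,5) by (auto dest: inj_onD)
    ultimately show ?thesis using ij unfolding clique_def by blast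
  qed
  show ?thesis
  proof (cases "j - i + 2 < k")
    case True
    define a where "a t = (if t \<le> j - i then v (i + t) else x)" for t
    have vi: "v (i + t) \<noteq> x" if "t \<le> j - i" for t using that assms(4,5) by (intro vx) linarith
    show ?thesis
    proof (rule short_cycle[of a "j - i + 2"])
      show "cycle a (j - i + 2)"
        unfolding cycle_def
      proof (intro conjI allI impI)
        show "inj_on a {..<j - i + 2}"
        proof (rule inj_onI)
          fix s t assume st: "s \<in> {..<j - i + 2}" "t \<in> {..<j - i + 2}" "a s = a t"
          show "s = t"
          proof (cases "s \<le> j - i"; cases "t \<le> j - i")
            assume "s \<le> j - i" "t \<le> j - i"
            then show ?thesis using st(3) inj_onD[OF inj, of "i + s" "i + t"] assms(4,5) unfolding a_def by auto
          qed (use st vi in \<open>auto simp: a_def\<close>)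
        qed
        show "E (a (j - i + 2 - 1)) (a 0)" using assms(6) unfolding a_def by simp
        fix t assume t: "Suc t < j - i + 2"
        show "E (a t) (a (Suc t))"
        proof (cases "Suc t \<le> j - i")
          case True then show ?thesis using step[of "i + t"] assms(4,5) unfolding a_def by simp
        next
          case False
          then have "t = j - i" using t by simp
          then show ?thesis using assms(4,7) sym unfolding a_def by simp
        qed
      qed
      show "a ` {..<j - i + 2} \<subseteq> insert x (v ` {..<k})" using assms(4,5) unfolding a_def by auto
      show "v i \<in> a ` {..<j - i + 2}" unfolding a_def by (intro image_eqI[of _ _ 0]) auto
      show "v j \<in> a ` {..<j - i + 2}" using assms(4) unfolding a_def by (intro image_eqI[of _ _ "j - i"]) auto
    qed (use True assms(4) in auto)
  next
    case False
    define b where "b t = (if t \<le> i then v t else if t = Suc i then x else v (t - (i + 2) + j))" for t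
    define n where "n = i + 2 + (k - j)"
    \<comment> \<open>If the first cycle has length at least \<open>k\<close>, the second has length
      at most 4.\<close>
    have nk: "n < k" using False assms(2,4,5) unfolding n_def by simp
    show ?thesis
    proof (rule short_cycle[of b n])
      show "cycle b n"
        unfolding cycle_def
      proof (intro conjI allI impI)
        show "inj_on b {..<n}"
        proof (rule inj_onI)
          fix s t assume st: "s \<in> {..<n}" "t \<in> {..<n}" "b s = b t"
          define \<iota> where "\<iota> t = (if t \<le> i then t else t - (i + 2) + j)" for t
          have b\<iota>: "b t = v (\<iota> t)" if "t \<noteq> Suc i" for t using that unfolding b_def \<iota>_def by auto
          have \<iota>k: "\<iota> t < k" if "t \<in> {..<n}" for t using that assms(4,5) unfolding \<iota>_def n_def by auto
          show "s = t"
          proof (cases "s = Suc i \<or> t = Suc i")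
            case True
            then show ?thesis using st vx \<iota>k b\<iota> unfolding b_def by (metis not_less_eq_eq order_refl)
          next
            case False
            then have "\<iota> s = \<iota> t" using st b\<iota> \<iota>k inj_onD[OF inj, of "\<iota> s" "\<iota> t"] by auto
            then show ?thesis using st False assms(4,5) unfolding \<iota>_def n_def by (auto split: if_splits)
          qed
        qed
        have "b (n - 1) = v (k - 1)"
        proof (cases "n - 1 = Suc i")
          case True then show ?thesis using assms(5) unfolding n_def by simp
        next
          case False then show ?thesis using assms(4,5) unfolding n_def b_def by auto
        qed
        then show "E (b (n - 1)) (b 0)" using close unfolding b_def by simp
        fix t assume t: "Suc t < n"
        consider "Suc t \<le> i" | "t = i" | "t = Suc i" | "t > Suc i" by linarith
        then show "E (b t) (b (Suc t))"
        proof cases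
          case 1 then show ?thesis using step[of t] assms(4,5) unfolding b_def by simp
        next
          case 2 then show ?thesis using assms(6) sym unfolding b_def by simp
        next
          case 3 then show ?thesis using assms(7) unfolding b_def by simp
        next
          case 4
          then have "Suc t - (i + 2) + j = Suc (t - (i + 2) + j)" by simp
          moreover have "Suc (t - (i + 2) + j) < k" using t 4 assms(4,5) unfolding n_def by simp
          ultimately show ?thesis using step[of "t - (i + 2) + j"] 4 unfolding b_def by simp
        qed
      qed
      show "b ` {..<n} \<subseteq> insert x (v ` {..<k})" using assms(4,5) unfolding b_def n_def by auto
      show "v i \<in> b ` {..<n}" unfolding b_def n_def by (intro image_eqI[of _ _ i]) auto
      show "v j \<in> b ` {..<n}" using assms(5) unfolding b_def n_def by (intro image_eqI[of _ _ "i + 2"]) auto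
    qed (use nk assms(5) in \<open>auto simp: n_def\<close>)
  qed
qed

text \<open>Three neighbours of \<open>x\<close> on the hole would be pairwise adjacent, but a hole
  of length at least 5 has no triangle.\<close>

lemma hole_apex_degree_le:
  assumes "hole v k" "k \<ge> 5" "x \<notin> v ` {..<k}"
    and small: "\<And>F. F \<subseteq> insert x (v ` {..<k}) \<Longrightarrow> obstruction F \<Longrightarrow> k \<le> card F"
  shows "card {y \<in> v ` {..<k}. E x y} \<le> 2"
proof -
  define J where "J = {i. i < k \<and> E x (v i)}"
  have finJ: "finite J" unfolding J_def by simp
  have "card J \<le> 2"
  proof (rule ccontr)
    assume c: "\<not> card J \<le> 2"
    then have ne: "J \<noteq> {}" by auto
    define i l where "i = Min J" and "l = Max J"
    have il: "i \<in> J" "l \<in> J" unfolding i_def l_def using finJ ne by auto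
    have "\<not> J \<subseteq> {i, l}"
    proof
      assume "J \<subseteq> {i, l}"
      then have "card J \<le> card {i, l}" by (intro card_mono) auto
      then show False using c by (simp add: card_insert_if split: if_splits)
    qed
    then obtain j where j: "j \<in> J" "j \<noteq> i" "j \<noteq> l" by blast
    have "i \<le> j" "j \<le> l" unfolding i_def l_def using finJ j(1) by auto
    then have lt: "i < j" "j < l" using j by auto
    have adj: "E (v s) (v t)" if "s \<in> J" "t \<in> J" "s < t" for s t
      by (rule hole_apex_neighbours_adjacent[OF assms(1-3)]) (use that small in \<open>auto simp: J_def\<close>)
    have "l < k" using il unfolding J_def by simp
    have "j = Suc i" "l = Suc j" "i = 0 \<and> l = k - 1 \<or> l = Suc i"
      using adj[OF il(1) j(1) lt(1)] adj[OF j(1) il(2) lt(2)] adj[OF il] lt \<open>l < k\<close>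
      by (auto simp: hole_adjacent[OF assms(1)])
    then show False using assms(2) lt by auto
  qed
  moreover have "{y \<in> v ` {..<k}. E x y} = v ` J" unfolding J_def by auto
  ultimately show ?thesis using card_image_le[OF finJ, of v] by simp
qed

end

section \<open>Critical sets for graphic lists\<close>

locale graphic_critical = simple_adjacency E for E :: "'a \<Rightarrow> 'a \<Rightarrow> bool" +
  fixes g :: "'a \<Rightarrow> 'a \<Rightarrow> bool" and V U :: "'a set"
  assumes finV: "finite V" and gsym: "g u v \<Longrightarrow> g v u" and girrefl: "\<not> g u u"
    and g_in: "g u v \<Longrightarrow> v \<in> V" and UV: "U \<subseteq> V"
    and crit: "critical (\<lambda>v. {u. g v u}) U" and hallV: "hall E V (\<lambda>v. {u. g v u}) V"
begin

abbreviation L :: "'a \<Rightarrow> 'a set" where "L v \<equiv> {u. g v u}"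

definition pot :: "'a set" where "pot = \<Union>(L ` U)"
text \<open>By the symmetry of \<open>g\<close> these are also the vertices of \<open>U\<close> with
  a \<open>g\<close>-neighbour in \<open>U\<close>. Thus \<open>pot\<close> splits into
  \<open>T\<close> and \<open>P\<close>, and \<open>U\<close> into \<open>T\<close> and
  \<open>Z\<close>.\<close>

definition T :: "'a set" where "T = pot \<inter> U"
definition P :: "'a set" where "P = pot - U"
definition Z :: "'a set" where "Z = U - pot"

lemma finU: "finite U"
  using UV finV finite_subset by blast

lemma L_V: "L v \<subseteq> V"
  using g_in by blast

lemma finL: "finite (L v)"
  using L_V finV finite_subset by blast

lemma pot_V: "pot \<subseteq> V"
  unfolding pot_def using L_V by blast

lemma fin_sets: "finite pot" "finite T" "finite P" "finite Z"
  using pot_V finV finU finite_subset unfolding T_def P_def Z_def by auto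

lemma clique_card:
  assumes "X \<subseteq> V" "clique E X" "finite Q" "\<And>v. v \<in> X \<Longrightarrow> L v \<subseteq> Q"
  shows "card X \<le> card Q"
  by (rule hall_clique_card[OF hallV finV finV]) (use assms in auto)

text \<open>Hall's condition for a single vertex.\<close>

lemma L_nonempty: "v \<in> V \<Longrightarrow> L v \<noteq> {}"
  using clique_card[of "{v}" "{}"] unfolding clique_def by auto

lemma critU: "W \<subset> U \<Longrightarrow> colourable E L W" "\<not> colourable E L U"
  using crit unfolding critical_def by auto

lemma card_pot: "card pot < card U"
  unfolding pot_def by (rule critical_small_pot[OF crit finU finL])

lemma L_pot: "v \<in> U \<Longrightarrow> L v \<subseteq> pot"
  unfolding pot_def by blast

lemma clique_card_pot: "X \<subseteq> U \<Longrightarrow> clique E X \<Longrightarrow> card X \<le> card pot"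
  using UV L_pot fin_sets(1) by (intro clique_card) auto

lemma in_pot: "u \<in> U \<Longrightarrow> g v u \<Longrightarrow> v \<in> pot"
  unfolding pot_def using gsym by blast

lemma Z_list: "z \<in> Z \<Longrightarrow> L z \<subseteq> P"
  using in_pot gsym unfolding Z_def P_def pot_def by blast

lemma card_P_less_Z: "card P < card Z"
proof -
  have "card pot = card P + card T"
    unfolding P_def T_def using fin_sets(1) finU by (simp add: card_Diff_subset_Int card_mono)
  moreover have "card U = card Z + card T"
    unfolding Z_def T_def using fin_sets(1) finU by (simp add: card_Diff_subset_Int card_mono Int_commute)
  ultimately show ?thesis using card_pot by simp
qed

lemma P_nonempty: "P \<noteq> {}"
proof -
  obtain z where "z \<in> Z" using card_P_less_Z by fastforce
  then show ?thesis using Z_list L_nonempty UV unfolding Z_def by blast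
qed

lemma card_P_pos: "card P \<ge> 1"
  using P_nonempty fin_sets(3) by (simp add: Suc_leI card_gt_0_iff)

lemma P_outside: "P \<subseteq> V - U"
  using pot_V unfolding P_def by blast

lemma T_sub: "T \<subseteq> U"
  unfolding T_def by blast

lemma T_closed: "t \<in> T \<Longrightarrow> u \<in> U \<Longrightarrow> g t u \<Longrightarrow> u \<in> T"
  using in_pot gsym unfolding T_def by blast

text \<open>As a colour, \<open>t\<close> occurs on both ends of some edge of \<open>E\<close>
  inside \<open>U\<close>, and these ends are \<open>g\<close>-neighbours of
  \<open>t\<close>.\<close>

lemma T_degree: assumes "t \<in> T" shows "2 \<le> card (L t \<inter> T)"
proof -
  obtain u where "u \<in> U" "t \<in> L u" using assms unfolding T_def pot_def by blast
  then obtain x y where xy: "x \<in> U" "y \<in> U" "E x y" "t \<in> L x" "t \<in> L y"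
    by (rule critical_colour_edge[OF crit])
  then have "{x, y} \<subseteq> L t \<inter> T" using T_closed[OF assms] gsym by auto
  moreover have "x \<noteq> y" using xy irrefl by auto
  ultimately show ?thesis using fin_sets(2) card_mono[of "L t \<inter> T" "{x, y}"] by simp
qed

text \<open>A colouring of \<open>T\<close> from within \<open>T\<close> cannot clash with one of
  \<open>Z\<close>, whose colours all lie outside \<open>U\<close>.\<close>

lemma T_uncolourable:
  assumes "T \<noteq> {}"
  shows "\<not> colourable E (\<lambda>v. L v \<inter> T) T"
proof
  assume "colourable E (\<lambda>v. L v \<inter> T) T"
  then obtain f where f: "colouring E (\<lambda>v. L v \<inter> T) T f" unfolding colourable_def by blast
  have "Z \<subset> U" using assms unfolding T_def Z_def by blast
  then obtain \<phi> where \<phi>: "colouring E L Z \<phi>" by (rule critical_colouring[OF crit])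
  have "colouring E L T f" using f unfolding colouring_def by auto
  moreover have "f t \<noteq> \<phi> z" if "t \<in> T" "z \<in> Z" for t z
  proof -
    have "f t \<in> U" using f that(1) unfolding colouring_def T_def by auto
    moreover have "\<phi> z \<notin> U" using \<phi> that(2) Z_list[OF that(2)] unfolding colouring_def P_def by auto
    ultimately show ?thesis by auto
  qed
  ultimately have "colourable E L (T \<union> Z)"
    using \<phi> by (intro colouring_join[of L T f Z \<phi>]) (auto simp: T_def Z_def)
  moreover have "T \<union> Z = U" unfolding T_def Z_def by blast
  ultimately show False using critU(2) by simp
qed

section \<open>Sets with too few \<open>g\<close>-neighbours in \<open>T\<close>\<close>

definition N :: "'a set \<Rightarrow> 'a set" where "N I = (\<Union>i\<in>I. L i \<inter> T)"

lemma N_T: "N I \<subseteq> T"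
  unfolding N_def by auto

lemma fin_N: "finite (N I)"
  using N_T fin_sets(2) by (rule finite_subset)

text \<open>An injective choice would colour \<open>T\<close>, so some \<open>X\<close> violates the
  marriage condition. Removing the common part of \<open>X\<close> and \<open>N X\<close> from both
  costs each side equally many elements, and by symmetry no neighbour of what is left of
  \<open>X\<close> lies in \<open>X\<close>.\<close>

lemma deficient_set:
  assumes "T \<noteq> {}"
  obtains I where "I \<subseteq> T" "card (N I) < card I" "I \<inter> N I = {}" "2 \<le> card (N I)"
proof -
  have "\<not> (\<exists>f. inj_on f T \<and> (\<forall>v\<in>T. f v \<in> L v \<inter> T))"
    using T_uncolourable[OF assms] colouring_inj[of _ T "\<lambda>v. L v \<inter> T"] unfolding colourable_def by blast
  then obtain X where X: "X \<subseteq> T" "card (N X) < card X"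
    using hall_marriage[of T "\<lambda>v. L v \<inter> T"] fin_sets(2) unfolding N_def by (metis finite_Int not_le)
  have fX: "finite X" "finite (N X)" using finite_subset[OF X(1) fin_sets(2)] fin_N by auto
  define I where "I = X - N X"
  have sub: "N I \<subseteq> N X - X"
  proof
    fix n assume "n \<in> N I"
    then obtain i where i: "i \<in> I" "g i n" "n \<in> T" unfolding N_def by auto
    then have "n \<in> N X" unfolding N_def I_def by auto
    moreover have "n \<notin> X"
    proof
      assume "n \<in> X"
      then have "i \<in> N X" using i X(1) gsym unfolding N_def I_def by auto
      then show False using i(1) unfolding I_def by simp
    qed
    ultimately show "n \<in> N X - X" by simp
  qed
  have "card (N I) \<le> card (N X - X)" by (rule card_mono) (use sub fX in auto)
  also have "\<dots> = card (N X) - card (N X \<inter> X)" using fX by (simp add: card_Diff_subset_Int)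
  also have "\<dots> < card X - card (N X \<inter> X)"
    using X(2) fX card_mono[of "N X" "N X \<inter> X"] by (intro diff_less_mono) auto
  also have "\<dots> = card I" unfolding I_def using fX by (simp add: card_Diff_subset_Int Int_commute)
  finally have less: "card (N I) < card I" .
  then obtain i where i: "i \<in> I" by fastforce
  then have "2 \<le> card (L i \<inter> T)" using T_degree X(1) unfolding I_def by auto
  also have "\<dots> \<le> card (N I)"
    by (rule card_mono[OF fin_N]) (use i in \<open>auto simp: N_def\<close>)
  finally show thesis using that[of I] less X(1) sub unfolding I_def by auto
qed

text \<open>The bound is 7 = 3 + 2 + 2, from \<open>I\<close>, \<open>N I\<close> and
  \<open>Z\<close>; the last has at least two elements because it outnumbers the nonempty
  \<open>P\<close>.\<close>

lemma deficient_sizes: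
  assumes "I \<subseteq> T" "card (N I) < card I" "I \<inter> N I = {}" "2 \<le> card (N I)"
  shows "card I + card (N I) \<le> card T" "card T + 2 \<le> card U" "7 \<le> card U"
proof -
  have "card (I \<union> N I) = card I + card (N I)"
    using assms(3) finite_subset[OF assms(1) fin_sets(2)] fin_N by (intro card_Un_disjoint)
  moreover have "card (I \<union> N I) \<le> card T" using assms(1) N_T fin_sets(2) by (intro card_mono) auto
  ultimately show *: "card I + card (N I) \<le> card T" by simp
  have "card U = card Z + card T"
    unfolding Z_def T_def using fin_sets(1) finU by (simp add: card_Diff_subset_Int card_mono Int_commute)
  then show "card T + 2 \<le> card U" using card_P_less_Z card_P_pos by simp
  then show "7 \<le> card U" using * assms by simp
qed

text \<open>Count the \<open>g\<close>-edges between \<open>I\<close> and \<open>N I\<close>: there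
  are at least \<open>2 * card I\<close>, while \<open>card I > card N I\<close>. The result says
  that the degrees on \<open>M = N I\<close> exceed 2 by at least 2 in total, to be set against the
  small degrees in a hole.\<close>

lemma excess_set:
  assumes "T \<noteq> {}"
  obtains M where "M \<subseteq> T" "2 * card M + 2 \<le> (\<Sum>n\<in>M. card (L n \<inter> T))" "7 \<le> card U"
proof -
  obtain I where I: "I \<subseteq> T" "card (N I) < card I" "I \<inter> N I = {}" "2 \<le> card (N I)"
    using deficient_set[OF assms] .
  have fI: "finite I" "finite (N I)" using finite_subset[OF I(1) fin_sets(2)] fin_N by auto
  have "2 * card (N I) + 2 \<le> (\<Sum>i\<in>I. 2)" using I(2) by simp
  also have "\<dots> \<le> (\<Sum>i\<in>I. card {n \<in> N I. g n i})"
  proof (rule sum_mono)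
    fix i assume i: "i \<in> I"
    have "L i \<inter> T = {n \<in> N I. g n i}" using i N_T gsym unfolding N_def by auto
    then show "2 \<le> card {n \<in> N I. g n i}" using T_degree[of i] I(1) i by auto
  qed
  also have "\<dots> = (\<Sum>n\<in>N I. card {i \<in> I. g n i})"
    by (rule sum_multicount_gen[symmetric]) (use fI in auto)
  also have "\<dots> \<le> (\<Sum>n\<in>N I. card (L n \<inter> T))"
    using I(1) fin_sets(2) by (intro sum_mono card_mono) auto
  finally show thesis using that[of "N I"] N_T deficient_sizes(3)[OF I] by simp
qed

section \<open>The two sufficient conditions\<close>

lemma obstruction_exists:
  obtains F where "F \<subseteq> U" "obstruction F"
proof -
  have "\<not> block_graph U"
    using hall_block_graph_colourable[OF finU finV, of L] hall_subset[OF hallV UV] critU(2) L_V by blast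
  then show thesis using that unfolding block_graph_def by blast
qed

lemma hall_pot: "card U \<le> (\<Sum>\<sigma>\<in>pot. alpha E L U \<sigma>)"
  by (rule hall_sum_pot[OF hallV finV finV UV]) (use L_pot fin_sets(1) in auto)

theorem large_obstructions_contradiction:
  assumes large: "\<And>F. F \<subseteq> V \<Longrightarrow> obstruction F \<Longrightarrow> card (V - F) \<le> 2"
  shows False
proof -
  obtain F where F: "F \<subseteq> U" "obstruction F" by (rule obstruction_exists)
  have VF: "card (V - F) \<le> 2" using large F UV by blast
  have finF: "finite F" using F(1) finU finite_subset by blast
  have VU: "V - U \<subseteq> V - F" "finite (V - F)" using F(1) finV by auto
  have PVU: "card P \<le> card (V - U)" "card (V - U) \<le> card (V - F)"
    using P_outside VU finV by (auto intro: card_mono)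
  have cardV: "card V = card F + card (V - F)"
    using F(1) UV finV finF by (metis card_Diff_subset card_mono le_add_diff_inverse subset_trans)
  have cardVU: "card V = card U + card (V - U)"
    using UV finV finU by (metis card_Diff_subset card_mono le_add_diff_inverse)
  show False
  proof (cases "T = {}")
    case True
    then have potP: "pot = P" unfolding T_def P_def by blast
    from F(2) consider (hole) v k where "hole v k" "F = v ` {..<k}"
      | (diamond) x y u v where "is_diamond x y u v" "F = {x, y, u, v}"
      unfolding obstruction_def by blast
    then show False
    proof cases
      case diamond
      \<comment> \<open>A triangle needs three colours, but at most two vertices lie outside
        \<open>F\<close>.\<close>
      have "card {x, y, u} \<le> card P"
        unfolding potP[symmetric] using diamond sym F(1)
        by (intro clique_card_pot) (auto simp: is_diamond_def clique_def)
      moreover have "x \<noteq> y" "x \<noteq> u" "y \<noteq> u" using diamond irrefl unfolding is_diamond_def by auto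
      ultimately show False using PVU VF by simp
    next
      case hole
      have k: "k \<ge> 4" using hole unfolding hole_def by blast
      have adj: "E (v 0) (v 1)" using hole_adjacent[OF hole(1), of 0 1] k by auto
      have "{v 0, v 1} \<subseteq> F" using hole k by auto
      then have "card {v 0, v 1} \<le> card P"
        unfolding potP[symmetric] using adj sym F(1)
        by (intro clique_card_pot) (auto simp: clique_def)
      moreover have "v 0 \<noteq> v 1" using adj irrefl by metis
      \<comment> \<open>An edge needs two colours, and these exhaust the vertices outside
        \<open>F\<close>; so \<open>U\<close> is the hole itself.\<close>
      ultimately have c2: "card P = 2" "card (V - U) = card (V - F)" using PVU VF by auto
      then have "V - U = V - F" using VU by (simp add: card_subset_eq)
      then have UF: "U = v ` {..<k}" using F(1) UV hole(2) by blast
      obtain p q where pq: "P = {p, q}" using c2(1) by (auto simp: card_2_iff)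
      show False
      proof (rule critical_hole_two_colours[OF hole(1), of L p q])
        show "critical L (v ` {..<k})" using crit UF by simp
        show "L u \<subseteq> {p, q}" if "u \<in> v ` {..<k}" for u using L_pot that UF potP pq by auto
        show "k \<le> (\<Sum>\<sigma>\<in>{p, q}. alpha E L (v ` {..<k}) \<sigma>)"
          using hall_pot hole_card[OF hole(1)] unfolding UF[symmetric] potP pq by simp
      qed
    qed
  next
    case False
    then obtain M where M: "M \<subseteq> T" "2 * card M + 2 \<le> (\<Sum>n\<in>M. card (L n \<inter> T))" "7 \<le> card U"
      by (rule excess_set)
    \<comment> \<open>At least 7 vertices in \<open>U\<close> and one colour outside it leave at
      least 6 vertices for \<open>F\<close>, too many for a diamond.\<close>
    have V8: "card V \<ge> 8" using M(3) cardVU PVU(1) card_P_pos by simp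
    then have F6: "card F \<ge> 6" using cardV VF by simp
    have "\<not> (\<exists>x y u v. F = {x, y, u, v})"
    proof
      assume "\<exists>x y u v. F = {x, y, u, v}"
      then obtain x y u v where "F = {x, y, u, v}" by blast
      then have "card F \<le> 4" by (simp add: card_insert_if)
      then show False using F6 by simp
    qed
    then obtain v k where hole: "hole v k" "F = v ` {..<k}" using F(2) unfolding obstruction_def by blast
    have k: "card F = k" using hole_card hole by simp
    have deg: "card (L n) \<le> card {u \<in> U. E n u}" if "n \<in> U" for n
      by (rule critical_card_list_le_degree[OF crit finU that])
    have LT: "card (L n \<inter> T) \<le> card (L n)" for n using finL by (intro card_mono) auto
    have finM: "finite M" using M(1) fin_sets(2) finite_subset by blast
    have degF: "card {u \<in> F. E n u} \<le> 2" if "n \<in> F" for n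
      using that hole_degree_le[OF hole(1)] unfolding hole(2) by auto
    show False
    proof (cases "U = F")
      case True
      \<comment> \<open>List sizes are bounded by degrees, which are at most 2 in a hole.\<close>
      have "(\<Sum>n\<in>M. card (L n \<inter> T)) \<le> (\<Sum>n\<in>M. 2)"
      proof (rule sum_mono)
        fix n assume "n \<in> M"
        then have "n \<in> U" using M(1) T_sub by blast
        then show "card (L n \<inter> T) \<le> 2" using LT[of n] deg[of n] degF[of n] True by simp
      qed
      then show False using M(2) by simp
    next
      case False
      then obtain x where x: "x \<in> U" "x \<notin> F" using F(1) by blast
      obtain p where p: "p \<in> P" using P_nonempty by blast
      have px: "{x, p} \<subseteq> V - F" "x \<noteq> p" using x p P_outside UV F(1) by auto
      then have VFe: "V - F = {x, p}" using VF VU(2) card_seteq[of "V - F" "{x, p}"] by simp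
      then have Ux: "U = insert x F" using UV F(1) x p P_outside by auto
      have "V - U \<subseteq> {p}" using VU(1) x(1) unfolding VFe by auto
      then have "P \<subseteq> {p}" using P_outside by (rule subset_trans[rotated])
      then have P1: "P = {p}" using p by blast
      \<comment> \<open>Now \<open>V\<close> consists of the hole, \<open>x\<close> and the only
        outside colour \<open>p\<close>. A list on \<open>U\<close> can have three colours only at
        the neighbours of \<open>x\<close> on the hole.\<close>
      define D where "D = {y \<in> F. E x y}"
      have D2: "card D \<le> 2"
        unfolding D_def hole(2)
      proof (rule hole_apex_degree_le[OF hole(1)])
        show "k \<ge> 5" using F6 k by simp
        show "x \<notin> v ` {..<k}" using x hole(2) by simp
        \<comment> \<open>\<open>F\<close> misses exactly two vertices and no obstruction misses
          more, so none is smaller than \<open>F\<close>.\<close>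
        fix F' assume F': "F' \<subseteq> insert x (v ` {..<k})" "obstruction F'"
        then have F'V: "F' \<subseteq> V" using Ux UV hole(2) by blast
        then have "card (V - F') \<le> 2" using large F' by blast
        moreover have "card V = card F' + card (V - F')"
          using F'V finV by (metis card_Diff_subset card_mono finite_subset le_add_diff_inverse)
        moreover have "card (V - F) = 2" using VFe px(2) by simp
        ultimately show "k \<le> card F'" using cardV k by simp
      qed
      have finD: "finite D" unfolding D_def using finF by simp
      have degU: "card (L n) \<le> (if n \<in> D then 3 else 2)" if "n \<in> U" for n
      proof (cases "n = x")
        case True
        have "{u \<in> U. E x u} = D" unfolding D_def Ux using irrefl by auto
        moreover have "x \<notin> D" using x unfolding D_def by simp
        ultimately show ?thesis using deg[OF that] D2 True by simp
      next
        case False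
        then have "n \<in> F" using that Ux by simp
        have "{u \<in> U. E n u} \<subseteq> {u \<in> F. E n u} \<union> (if n \<in> D then {x} else {})"
          using \<open>n \<in> F\<close> sym unfolding Ux D_def by auto
        then have "card {u \<in> U. E n u} \<le> card ({u \<in> F. E n u} \<union> (if n \<in> D then {x} else {}))"
          using finF by (intro card_mono) auto
        also have "\<dots> \<le> card {u \<in> F. E n u} + card (if n \<in> D then {x} else {})" by (rule card_Un_le)
        also have "\<dots> \<le> (if n \<in> D then 3 else 2)" using degF[OF \<open>n \<in> F\<close>] by simp
        finally show ?thesis using deg[OF that] by linarith
      qed
      \<comment> \<open>The excess of 2 has to come from two vertices with three colours in
        \<open>T\<close>, and \<open>D\<close> has no more than two vertices. So
        \<open>B = D\<close>, and there is no room left for \<open>p\<close> in the lists on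
        \<open>D\<close>.\<close>
      define B where "B = {n \<in> M. 3 \<le> card (L n \<inter> T)}"
      have BD: "B \<subseteq> D"
      proof
        fix n assume n: "n \<in> B"
        then have "n \<in> U" using M(1) T_sub unfolding B_def by blast
        then show "n \<in> D" using degU[of n] LT[of n] n unfolding B_def by (auto split: if_splits)
      qed
      have "(\<Sum>n\<in>M. card (L n \<inter> T)) \<le> (\<Sum>n\<in>M. 2 + (if n \<in> B then 1 else 0))"
      proof (rule sum_mono)
        fix n assume n: "n \<in> M"
        then have "n \<in> U" using M(1) T_sub by blast
        then have "card (L n \<inter> T) \<le> 3" using degU[of n] LT[of n] by (auto split: if_splits)
        then show "card (L n \<inter> T) \<le> 2 + (if n \<in> B then 1 else 0)" using n unfolding B_def by auto
      qed
      also have "\<dots> = 2 * card M + card B"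
      proof -
        have "M \<inter> {n. n \<in> B} = B" unfolding B_def by auto
        then show ?thesis using finM by (simp only: sum.distrib sum.If_cases) simp
      qed
      finally have "2 \<le> card B" using M(2) by simp
      then have "B = D" using BD D2 finD by (simp add: card_seteq)
      have LD: "L y \<subseteq> T" if "y \<in> D" for y
      proof -
        have "3 \<le> card (L y \<inter> T)" using that \<open>B = D\<close> unfolding B_def by blast
        moreover have "y \<in> U" using that F(1) unfolding D_def by blast
        then have "card (L y) \<le> 3" using degU[of y] that by simp
        ultimately have "L y \<inter> T = L y" using finL by (intro card_seteq) auto
        then show ?thesis by blast
      qed
      obtain z where z: "z \<in> Z" using card_P_less_Z by fastforce
      then have zU: "z \<in> U" unfolding Z_def by simp
      have Lz: "L z = {p}" 
        using subset_singletonD[OF Z_list[OF z, unfolded P1]] L_nonempty[OF subsetD[OF UV zU]] by metis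
      \<comment> \<open>The only colour \<open>p\<close> of \<open>z\<close> must appear on a
        neighbour \<open>y\<close>. If \<open>y\<close> is in \<open>T\<close>, its list has three
        colours, which puts \<open>y\<close> in \<open>D\<close>, where \<open>p\<close> is missing;
        if \<open>y\<close> is in \<open>Z\<close>, two adjacent vertices share the single colour
        \<open>p\<close>.\<close>
      obtain \<phi> where \<phi>: "colouring E L (U - {z}) \<phi>"
        using critical_colouring[OF crit, of "U - {z}"] zU by blast
      have "p \<in> L z" unfolding Lz by simp
      then obtain y where y: "y \<in> U" "E z y" "\<phi> y = p" by (rule critical_extension[OF crit zU \<phi>])
      have "y \<noteq> z" using y irrefl by metis
      then have "p \<in> L y" using \<phi> y unfolding colouring_def by force
      have "p \<notin> T" using p unfolding P_def T_def by blast
      show False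
      proof (cases "y \<in> T")
        case True
        have "card (insert p (L y \<inter> T)) \<le> card (L y)"
          using \<open>p \<in> L y\<close> finL by (intro card_mono) auto
        then have "3 \<le> card (L y)" using T_degree[OF True] \<open>p \<notin> T\<close> fin_sets(2) by simp
        then have "y \<in> D" using degU[OF y(1)] by (auto split: if_splits)
        then show False using LD \<open>p \<in> L y\<close> \<open>p \<notin> T\<close> by blast
      next
        case False
        then have "y \<in> Z" using y(1) unfolding T_def Z_def by blast
        then have "card {z, y} \<le> card {p}"
          using Z_list z P1 y sym UV zU by (intro clique_card) (auto simp: clique_def)
        then show False using \<open>y \<noteq> z\<close> by simp
      qed
    qed
  qed
qed

theorem two_cliques_contradiction:
  assumes V8: "card V = 8" and SQ: "S \<inter> Q = {}"
    and E_iff: "\<And>u v. u \<in> V \<Longrightarrow> v \<in> V \<Longrightarrow>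
      E u v \<longleftrightarrow> u \<noteq> v \<and> \<not> (u \<in> S \<and> v \<in> Q) \<and> \<not> (u \<in> Q \<and> v \<in> S)"
  shows False
proof -
  have cardVU: "card V = card U + card (V - U)"
    using UV finV finU by (metis card_Diff_subset card_mono le_add_diff_inverse)
  have cardP: "card P \<le> card (V - U)" using P_outside finV by (auto intro: card_mono)
  show False
  proof (cases "T = {}")
    case True
    then have potP: "pot = P" unfolding T_def P_def by blast
    obtain F where F: "F \<subseteq> U" "obstruction F" by (rule obstruction_exists)
    \<comment> \<open>Each nonadjacent pair has one vertex in \<open>S\<close> and one in
      \<open>Q\<close>, so \<open>v 1\<close> would be nonadjacent to \<open>v 0\<close> or to
      \<open>v 2\<close>.\<close>
    have "\<not> hole v k" if "v ` {..<k} \<subseteq> U" for v k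
    proof
      assume hole: "hole v k"
      then have k: "k \<ge> 4" unfolding hole_def by blast
      have "v i \<in> V" if "i < k" for i using that \<open>v ` {..<k} \<subseteq> U\<close> UV by auto
      then have inV: "v 0 \<in> V" "v 1 \<in> V" "v 2 \<in> V" "v 3 \<in> V" using k by auto
      have "v 0 \<noteq> v 2" "v 1 \<noteq> v 3" using hole_inj[OF hole] k by (auto dest: inj_onD)
      moreover have "\<not> E (v 0) (v 2)" "\<not> E (v 1) (v 3)" "E (v 0) (v 1)" "E (v 1) (v 2)"
        using hole_adjacent[OF hole] k by auto
      ultimately show False using E_iff inV by metis
    qed
    then obtain x y u v where d: "is_diamond x y u v" and Fd: "F = {x, y, u, v}"
      using F unfolding obstruction_def by metis
    have FV: "x \<in> U" "y \<in> U" "u \<in> U" "v \<in> U" "x \<in> V" "y \<in> V" "u \<in> V" "v \<in> V" using F(1) Fd UV by auto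
    have ne: "x \<noteq> y" "x \<noteq> u" "x \<noteq> v" "y \<noteq> u" "y \<noteq> v" "u \<noteq> v" using d irrefl unfolding is_diamond_def by auto
    have uv: "u \<in> S \<and> v \<in> Q \<or> u \<in> Q \<and> v \<in> S"
      using d E_iff[OF FV(7,8)] unfolding is_diamond_def by blast
    have xy: "x \<notin> S \<union> Q" "y \<notin> S \<union> Q"
      using d E_iff[OF FV(5,7)] E_iff[OF FV(5,8)] E_iff[OF FV(6,7)] E_iff[OF FV(6,8)] uv
      unfolding is_diamond_def by blast+
    have clq: "clique E {x, y, a, b}"
      if "a \<in> V" "b \<in> V" "\<not> (a \<in> S \<and> b \<in> Q)" "\<not> (a \<in> Q \<and> b \<in> S)" for a b
      unfolding clique_def using that xy FV(5,6) E_iff by auto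
    have "clique E {x, y, u, u}" using FV SQ by (intro clq) auto
    then have "card {x, y, u, u} \<le> card pot" using FV by (intro clique_card_pot) auto
    then have P3: "3 \<le> card P" using ne potP by simp
    \<comment> \<open>\<open>card P\<close> is less than \<open>card U\<close> and at most
      \<open>8 - card U\<close>, hence at most 3.\<close>
    then have cP: "card P = 3" "card (V - U) \<le> 4" using card_pot potP cardP cardVU V8 by auto
    have "card (F \<union> P) \<le> 7"
    proof -
      have "card F \<le> 4" unfolding Fd by (simp add: card_insert_if)
      then show ?thesis using card_Un_le[of F P] cP by simp
    qed
    then have "\<not> V \<subseteq> F \<union> P" using V8 Fd fin_sets(3) card_mono[of "F \<union> P" V] by auto
    then obtain w where w: "w \<in> V" "w \<notin> F" "w \<notin> P" by blast
    \<comment> \<open>If \<open>w\<close> is outside \<open>U\<close>, it is the only vertex in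
      neither \<open>U\<close> nor \<open>P\<close>; not being a colour on \<open>U\<close>, it has
      no \<open>g\<close>-neighbour in \<open>U\<close>.\<close>
    have Lw: "L w \<subseteq> P"
    proof (cases "w \<in> U")
      case True
      then show ?thesis using L_pot potP by auto
    next
      case False
      then have "w \<notin> pot" using w potP by simp
      then have "L w \<subseteq> V - U - {w}" using in_pot L_V girrefl by blast
      moreover have "P = V - U - {w}"
      proof (rule card_seteq)
        show "P \<subseteq> V - U - {w}" using P_outside w by blast
        show "card (V - U - {w}) \<le> card P" using False w(1) cP finV by (simp add: card_Diff_singleton)
      qed (use finV in simp)
      ultimately show ?thesis by simp
    qed
    \<comment> \<open>\<open>w\<close> is nonadjacent to at most one of \<open>u\<close> and
      \<open>v\<close>, so four mutually adjacent vertices have lists in the three colours of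
      \<open>P\<close>.\<close>
    obtain a where a: "a \<in> {u, v}" "clique E {x, y, a, w}"
    proof (cases "(u \<in> S \<and> w \<in> Q) \<or> (u \<in> Q \<and> w \<in> S)")
      case True
      then have "clique E {x, y, v, w}" using uv SQ FV w by (intro clq) auto
      then show ?thesis using that by blast
    next
      case False
      then have "clique E {x, y, u, w}" using FV w by (intro clq) auto
      then show ?thesis using that by blast
    qed
    have "card {x, y, a, w} \<le> card P"
      by (rule clique_card[OF _ a(2) fin_sets(3)]) (use a(1) FV w(1) Lw L_pot potP in auto)
    moreover have "card {x, y, a, w} = 4" using a(1) ne w(2) Fd by auto
    ultimately show False using cP by simp
  next
    case False
    then obtain I where I: "I \<subseteq> T" "card (N I) < card I" "I \<inter> N I = {}" "2 \<le> card (N I)"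
      by (rule deficient_set)
    note sz = deficient_sizes[OF I]
    \<comment> \<open>On eight vertices all the bounds of \<open>deficient_sizes\<close> are
      attained.\<close>
    have "card P = 1" "card (N I) = 2" "card I = 3" "card T = card I + card (N I)"
      using sz I cardVU V8 cardP card_P_pos by linarith+
    then obtain p where p: "P = {p}" by (auto simp: card_1_singleton_iff)
    obtain d e where de: "N I = {d, e}" "d \<noteq> e" using \<open>card (N I) = 2\<close> by (auto simp: card_2_iff)
    have finI: "finite I" using finite_subset[OF I(1) fin_sets(2)] .
    have TI: "T = I \<union> N I"
    proof (rule card_seteq[symmetric])
      show "card T \<le> card (I \<union> N I)"
        using \<open>card T = card I + card (N I)\<close> I(3) finI fin_N by (simp add: card_Un_disjoint)
    qed (use I(1) N_T fin_sets(2) in auto)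
    have LI: "L i \<inter> T = {d, e}" if "i \<in> I" for i
    proof (rule card_seteq)
      show "L i \<inter> T \<subseteq> {d, e}" using that de(1) unfolding N_def by auto
      show "card {d, e} \<le> card (L i \<inter> T)" using T_degree[of i] that I(1) de(2) by auto
    qed simp
    have gde: "g d i" "g e i" if "i \<in> I" for i using LI[OF that] gsym by auto
    have IV: "I \<subseteq> V" using I(1) T_sub UV by blast
    \<comment> \<open>If \<open>a\<close> and \<open>b\<close> were nonadjacent, both could take
      \<open>d\<close>, the third vertex of \<open>I\<close> could take \<open>e\<close>, and
      \<open>d\<close>, \<open>e\<close> could take \<open>a\<close>, \<open>b\<close>: a colouring
      of \<open>T\<close> from within.\<close>
    have clI: "clique E I"
      unfolding clique_def
    proof (intro ballI impI, rule ccontr)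
      fix a b assume ab: "a \<in> I" "b \<in> I" "a \<noteq> b" "\<not> E a b"
      have "\<not> E b a" using ab sym by blast
      have "card (I - {a, b}) = 1" using ab \<open>card I = 3\<close> finI by (simp add: card_Diff_subset)
      then obtain c where c: "I - {a, b} = {c}" by (auto simp: card_1_singleton_iff)
      have abc: "I = {a, b, c}" "c \<noteq> a" "c \<noteq> b" using c ab by auto
      have nde: "d \<notin> I" "e \<notin> I" using I(3) de(1) by auto
      define f where "f t = (if t = a \<or> t = b then d else if t = c then e else if t = d then a else b)" for t
      have "colouring E (\<lambda>v. L v \<inter> T) T f"
        unfolding colouring_def
      proof (intro conjI ballI impI)
        fix t assume "t \<in> T"
        then consider "t \<in> I" | "t = d" | "t = e" using TI de(1) by auto
        then show "f t \<in> L t \<inter> T"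
        proof cases
          case 1 then show ?thesis using abc(1) unfolding LI[OF 1] f_def by auto
        next
          case 2 then show ?thesis using gde(1) ab(1) I(1) nde abc unfolding f_def by auto
        next
          case 3 then show ?thesis using gde(2) ab(2) I(1) nde abc de(2) unfolding f_def by auto
        qed
      next
        fix s t assume "s \<in> T" "t \<in> T" "E s t"
        moreover have "s \<noteq> t" using \<open>E s t\<close> irrefl by auto
        moreover have "T = {a, b, c, d, e}" using TI abc(1) de(1) by auto
        ultimately show "f s \<noteq> f t"
          using ab abc nde de(2) \<open>\<not> E b a\<close> unfolding f_def by auto
      qed
      then show False using T_uncolourable[OF False] unfolding colourable_def by blast
    qed
    have "2 \<le> card Z" using card_P_less_Z \<open>card P = 1\<close> by simp
    then obtain Y where "Y \<subseteq> Z" "card Y = 2" by (meson obtain_subset_with_card_n)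
    then obtain z1 z2 where z: "z1 \<in> Z" "z2 \<in> Z" "z1 \<noteq> z2" by (auto simp: card_2_iff)
    have ZV: "Z \<subseteq> V" using UV unfolding Z_def by blast
    have "\<not> E z1 z2"
    proof
      assume "E z1 z2"
      then have "clique E {z1, z2}" using sym unfolding clique_def by auto
      then have "card {z1, z2} \<le> card P"
        using z ZV Z_list by (intro clique_card[OF _ _ fin_sets(3)]) auto
      then show False using z(3) \<open>card P = 1\<close> by simp
    qed
    then have zSQ: "z1 \<in> S \<and> z2 \<in> Q \<or> z1 \<in> Q \<and> z2 \<in> S" using E_iff[of z1 z2] z ZV by auto
    \<comment> \<open>\<open>z1\<close> and \<open>z2\<close> lie on opposite sides and the clique
      \<open>I\<close> meets at most one side, so one of them is adjacent to all of
      \<open>I\<close>. Then four mutually adjacent vertices have only the colours \<open>p\<close>,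
      \<open>d\<close>, \<open>e\<close>.\<close>
    have "I \<inter> S = {} \<or> I \<inter> Q = {}"
    proof (rule ccontr)
      assume "\<not> ?thesis"
      then obtain s q where sq: "s \<in> I" "s \<in> S" "q \<in> I" "q \<in> Q" by auto
      then have "s \<noteq> q" using SQ by auto
      then have "E s q" using clI sq unfolding clique_def by blast
      then show False using E_iff[of s q] sq IV by auto
    qed
    then obtain z where zz: "z \<in> Z" and zadj: "\<And>i. i \<in> I \<Longrightarrow> \<not> (z \<in> S \<and> i \<in> Q) \<and> \<not> (z \<in> Q \<and> i \<in> S)"
      using zSQ z SQ by blast
    have zI: "z \<notin> I" using zz I(1) unfolding Z_def T_def by auto
    have "E z i" if "i \<in> I" for i using E_iff[of z i] zadj[OF that] that zz zI ZV IV by auto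
    then have "clique E (insert z I)" using clI sym unfolding clique_def by auto
    then have "card (insert z I) \<le> card {p, d, e}"
    proof (rule clique_card[rotated])
      fix v assume "v \<in> insert z I"
      moreover have "L i \<subseteq> {p, d, e}" if "i \<in> I" for i
      proof -
        have "L i \<subseteq> pot" using that I(1) T_sub L_pot by blast
        moreover have "pot = P \<union> T" unfolding P_def T_def by auto
        ultimately show ?thesis using LI[OF that] p by auto
      qed
      ultimately show "L v \<subseteq> {p, d, e}" using Z_list[OF zz] p by auto
    qed (use zz ZV IV in auto)
    moreover have "card {p, d, e} \<le> 3" by (simp add: card_insert_if)
    ultimately show False using zI finI \<open>card I = 3\<close> by simp
  qed
qed

end

section \<open>Uncolourable graphic lists\<close>

context simple_adjacency begin

definition graphic_colourable :: "'a set \<Rightarrow> bool" where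
  "graphic_colourable V \<longleftrightarrow>
    (\<forall>g. (\<forall>u v. g u v \<longrightarrow> g v u \<and> u \<noteq> v \<and> v \<in> V) \<longrightarrow>
      hall E V (\<lambda>v. {u. g v u}) V \<longrightarrow> colourable E (\<lambda>v. {u. g v u}) V)"

text \<open>Colours outside \<open>U\<close> realise arbitrary lists on \<open>U\<close>. The vertices of \<open>C\<close> are then coloured
  injectively from \<open>U\<close>, and the remaining vertices form a clique of \<open>G\<close>, which must not be a
  single vertex with an empty list.\<close>

lemma not_graphic_colourableI:
  assumes "finite V" "U \<subseteq> V" "C \<subseteq> V" "U \<inter> C = {}" and MC: "\<And>u. u \<in> U \<Longrightarrow> M u \<subseteq> C"
    and "\<not> colourable E M U" and hall: "hall E C M U"
    and f: "inj_on f C" "\<And>c. c \<in> C \<Longrightarrow> f c \<in> U \<and> c \<in> M (f c)"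
    and "card (V - U - C) \<noteq> 1"
  shows "\<not> graphic_colourable V"
proof
  assume gc: "graphic_colourable V"
  define W where "W = V - U - C"
  define g where "g u v \<longleftrightarrow> (u \<in> U \<and> v \<in> M u) \<or> (v \<in> U \<and> u \<in> M v) \<or> (u \<in> W \<and> v \<in> W \<and> u \<noteq> v)" for u v
  define L where "L v = {u. g v u}" for v
  have MU: "c \<notin> U" "c \<in> C" "c \<in> V" if "u \<in> U" "c \<in> M u" for u c using that MC assms(3,4) by blast+
  have "g v u \<and> u \<noteq> v \<and> v \<in> V" if "g u v" for u v
    using that MU assms(2) unfolding g_def W_def by auto
  then have imp: "hall E V L V \<Longrightarrow> colourable E L V"
    using gc unfolding graphic_colourable_def L_def by blast
  have LU: "L u = M u" if "u \<in> U" for u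
    using that MU unfolding L_def g_def W_def by auto
  have LC: "f c \<in> L c" if "c \<in> C" for c using f(2)[OF that] unfolding L_def g_def by simp
  have LW: "W - {w} \<subseteq> L w" if "w \<in> W" for w using that unfolding L_def g_def by auto
  have "hall E V L V"
    unfolding hall_def
  proof (intro allI impI)
    fix X assume X: "X \<subseteq> V"
    have finX: "finite X" using X assms(1) finite_subset by blast
    have fin: "finite U" "finite C" "finite W" using assms(1-3) finite_subset unfolding W_def by auto
    have one: "1 \<le> alpha E L X \<sigma>" if "x \<in> X" "\<sigma> \<in> L x" for x \<sigma>
      using alpha_ge[of X "{x}" E \<sigma> L] that finX irrefl unfolding indep_def by simp
    \<comment> \<open>The roles cross over: colours in \<open>C\<close> pay for vertices in
      \<open>U\<close>, colours in \<open>U\<close> for vertices in \<open>C\<close>, and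
      \<open>W\<close> pays for itself.\<close>
    have C: "card (X \<inter> U) \<le> (\<Sum>\<sigma>\<in>C. alpha E L X \<sigma>)"
    proof -
      have "card (X \<inter> U) \<le> (\<Sum>\<sigma>\<in>C. alpha E M (X \<inter> U) \<sigma>)" using hall unfolding hall_def by blast
      also have "\<dots> \<le> (\<Sum>\<sigma>\<in>C. alpha E L X \<sigma>)"
        by (intro sum_mono alpha_mono[OF finX]) (auto simp: LU)
      finally show ?thesis .
    qed
    have U: "card (X \<inter> C) \<le> (\<Sum>\<sigma>\<in>U. alpha E L X \<sigma>)"
    proof -
      have "card (X \<inter> C) = card (f ` (X \<inter> C))"
        using f(1) by (intro card_image[symmetric]) (auto intro: inj_on_subset)
      also have "\<dots> = (\<Sum>\<sigma>\<in>f ` (X \<inter> C). 1)" by simp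
      also have "\<dots> \<le> (\<Sum>\<sigma>\<in>f ` (X \<inter> C). alpha E L X \<sigma>)"
      proof (rule sum_mono)
        fix \<sigma> assume "\<sigma> \<in> f ` (X \<inter> C)"
        then obtain c where "c \<in> X" "c \<in> C" "\<sigma> = f c" by auto
        then show "1 \<le> alpha E L X \<sigma>" using one LC by blast
      qed
      also have "\<dots> \<le> (\<Sum>\<sigma>\<in>U. alpha E L X \<sigma>)"
        using fin f(2) by (intro sum_mono2) auto
      finally show ?thesis .
    qed
    have W: "card (X \<inter> W) \<le> (\<Sum>\<sigma>\<in>W. alpha E L X \<sigma>)"
    proof -
      consider "X \<inter> W = {}" | w where "X \<inter> W = {w}" | "2 \<le> card (X \<inter> W)"
        using fin(3) by (metis One_nat_def Suc_1 card_1_singleton_iff card_gt_0_iff finite_Int le_less_Suc_eq not_less_eq_eq neq0_conv card_0_eq not_le less_2_cases_iff)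
      then show ?thesis
      proof cases
        case 2
        then have "w \<in> W" by blast
        then have "card W > 0" using fin(3) card_gt_0_iff by blast
        then have "card W \<ge> 2" using assms(10) unfolding W_def by simp
        then have "\<not> W \<subseteq> {w}" using card_mono[of "{w}" W] by auto
        then obtain y where "y \<in> W" "y \<noteq> w" by blast
        then have "1 \<le> alpha E L X y" using one[of w y] LW[of w] 2 by auto
        also have "\<dots> \<le> (\<Sum>\<sigma>\<in>W. alpha E L X \<sigma>)"
          using \<open>y \<in> W\<close> fin(3) by (intro member_le_sum) auto
        finally show ?thesis using 2 by simp
      next
        case 3
        have "card (X \<inter> W) \<le> (\<Sum>\<sigma>\<in>W. 1)" using fin(3) by (simp add: card_mono)
        also have "\<dots> \<le> (\<Sum>\<sigma>\<in>W. alpha E L X \<sigma>)"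
        proof (rule sum_mono)
          fix \<sigma> assume "\<sigma> \<in> W"
          have "\<not> X \<inter> W \<subseteq> {\<sigma>}" using 3 card_mono[of "{\<sigma>}" "X \<inter> W"] by auto
          then obtain w where "w \<in> X" "w \<in> W" "w \<noteq> \<sigma>" by blast
          then show "1 \<le> alpha E L X \<sigma>" using one[of w \<sigma>] LW[of w] \<open>\<sigma> \<in> W\<close> by auto
        qed
        finally show ?thesis .
      qed simp
    qed
    have "X = (X \<inter> U) \<union> (X \<inter> C) \<union> (X \<inter> W)" using X unfolding W_def by auto
    then have "card X \<le> card (X \<inter> U) + card (X \<inter> C) + card (X \<inter> W)"
      by (metis card_Un_le add_le_mono1 order_trans)
    moreover have "(\<Sum>\<sigma>\<in>V. alpha E L X \<sigma>) =
        (\<Sum>\<sigma>\<in>U. alpha E L X \<sigma>) + (\<Sum>\<sigma>\<in>C. alpha E L X \<sigma>) + (\<Sum>\<sigma>\<in>W. alpha E L X \<sigma>)"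
    proof -
      have "V = U \<union> C \<union> W" using assms(2,3) unfolding W_def by auto
      moreover have "(U \<union> C) \<inter> W = {}" unfolding W_def by auto
      ultimately have "(\<Sum>\<sigma>\<in>V. alpha E L X \<sigma>) = (\<Sum>\<sigma>\<in>U \<union> C. alpha E L X \<sigma>) + (\<Sum>\<sigma>\<in>W. alpha E L X \<sigma>)"
        using fin by (simp only: sum.union_disjoint finite_Un)
      then show ?thesis using fin assms(4) by (simp only: sum.union_disjoint)
    qed
    ultimately show "card X \<le> (\<Sum>\<sigma>\<in>V. alpha E L X \<sigma>)" using C U W by simp
  qed
  then have "colourable E L V" by (rule imp)
  then obtain \<phi> where "colouring E L V \<phi>" unfolding colourable_def by blast
  then have "colouring E M U \<phi>" using LU assms(2) unfolding colouring_def by (metis subsetD)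
  then show False using assms(6) unfolding colourable_def by blast
qed

text \<open>The pair \<open>p\<close>, \<open>r\<close> is left open, so that the 4-hole and the
  diamond are treated at once.\<close>

definition quad :: "'a \<Rightarrow> 'a \<Rightarrow> 'a \<Rightarrow> 'a \<Rightarrow> bool" where
  "quad p q r s \<longleftrightarrow> distinct [p, q, r, s] \<and> E p q \<and> E q r \<and> E r s \<and> E s p \<and> \<not> E q s"

text \<open>Going round from \<open>p\<close>, the colours \<open>a\<close>, \<open>b\<close>,
  \<open>c\<close> are forced on \<open>p\<close>, \<open>q\<close>, \<open>r\<close>, and nothing
  is left for \<open>s\<close>.\<close>

lemma quad_lists_uncolourable:
  assumes "quad p q r s" "M p = {a}" "M q = {a, b}" "M r = {b, c}" "M s = {c, a}" "{p, q, r, s} \<subseteq> U"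
  shows "\<not> colourable E M U"
proof
  assume "colourable E M U"
  then obtain \<phi> where "colouring E M U \<phi>" unfolding colourable_def by blast
  then have "\<phi> p \<in> M p" "\<phi> q \<in> M q" "\<phi> r \<in> M r" "\<phi> s \<in> M s" "\<phi> p \<noteq> \<phi> q" "\<phi> q \<noteq> \<phi> r" "\<phi> r \<noteq> \<phi> s" "\<phi> s \<noteq> \<phi> p"
    using assms(1,6) unfolding colouring_def quad_def by auto
  then show False using assms(2-5) by auto
qed

text \<open>On the whole quadruple \<open>a\<close> counts twice, at the nonadjacent
  \<open>q\<close> and \<open>s\<close>, and \<open>r\<close> supplies both \<open>b\<close> and
  \<open>c\<close>. Any three of the vertices have distinct representatives.\<close>

lemma quad_lists_hall:
  assumes "quad p q r s" "M p = {a}" "M q = {a, b}" "M r = {b, c}" "M s = {c, a}" "distinct [a, b, c]"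
  shows "hall E {a, b, c} M {p, q, r, s}"
  unfolding hall_def
proof (intro allI impI)
  fix X assume X: "X \<subseteq> {p, q, r, s}"
  have nadj: "\<not> E q s" "\<not> E s q" and d: "distinct [p, q, r, s]" using assms(1) sym unfolding quad_def by auto
  have finX: "finite X" using X finite_subset by blast
  show "card X \<le> (\<Sum>\<sigma>\<in>{a, b, c}. alpha E M X \<sigma>)"
  proof (cases "X = {p, q, r, s}")
    case True
    show ?thesis
    proof (rule card_le_sum_alpha[OF finX, where R = "{(q, a), (s, a), (r, b), (r, c)}"])
      show "card X \<le> card {(q, a), (s, a), (r, b), (r, c)}" using True d assms(6) by simp
      show "\<not> E u v" if "(u, \<sigma>) \<in> {(q, a), (s, a), (r, b), (r, c)}" "(v, \<sigma>) \<in> {(q, a), (s, a), (r, b), (r, c)}" for u v \<sigma>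
        using that nadj irrefl assms(6) by auto
    qed (use True assms(2-5) in auto)
  next
    case False
    have "colourable E M {q, r, s}"
      by (rule colourable_inj[of "(\<lambda>_. a)(q := a, r := b, s := c)"]) (use d assms(2-6) irrefl in auto)
    moreover have "colourable E M {p, r, s}"
      by (rule colourable_inj[of "(\<lambda>_. a)(p := a, r := b, s := c)"]) (use d assms(2-6) irrefl in auto)
    moreover have "colourable E M {p, q, s}"
      by (rule colourable_inj[of "(\<lambda>_. a)(p := a, q := b, s := c)"]) (use d assms(2-6) irrefl in auto)
    moreover have "colourable E M {p, q, r}"
      by (rule colourable_inj[of "(\<lambda>_. a)(p := a, q := b, r := c)"]) (use d assms(2-6) irrefl in auto)
    moreover have "X \<subseteq> {q, r, s} \<or> X \<subseteq> {p, r, s} \<or> X \<subseteq> {p, q, s} \<or> X \<subseteq> {p, q, r}"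
      using X False by auto
    ultimately have "colourable E M X" using colourable_subset by blast
    then show ?thesis
      by (rule colourable_card_le[OF finX, rotated]) (use X assms(2-5) in auto)
  qed
qed

text \<open>For all five vertices, either \<open>b\<close> and \<open>c\<close> each count twice, at
  \<open>r\<close> and \<open>w\<close>, or \<open>a\<close> counts three times, at
  \<open>q\<close>, \<open>s\<close> and \<open>w\<close>; the alternative in \<open>nadj\<close> is
  what makes one of these sets independent.\<close>

lemma quad_apex_lists_hall:
  assumes "quad p q r s" "M p = {a}" "M q = {a, b}" "M r = {b, c}" "M s = {c, a}" "M w = {a, b, c}"
    and abc: "distinct [a, b, c]" and w: "w \<notin> {p, q, r, s}" and nadj: "\<not> E w r \<or> \<not> E w q \<and> \<not> E w s"
  shows "hall E {a, b, c} M {p, q, r, s, w}"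
  unfolding hall_def
proof (intro allI impI)
  fix X assume X: "X \<subseteq> {p, q, r, s, w}"
  have qs: "\<not> E q s" "\<not> E s q" and d: "distinct [p, q, r, s, w]" using assms(1) sym w unfolding quad_def by auto
  have finX: "finite X" using X finite_subset by blast
  have col: "card X \<le> (\<Sum>\<sigma>\<in>{a, b, c}. alpha E M X \<sigma>)" if "colourable E M Y" "X \<subseteq> Y" for Y
    using colourable_subset[OF that]
    by (rule colourable_card_le[OF finX, rotated]) (use X assms(2-6) in auto)
  have col4: "card X \<le> (\<Sum>\<sigma>\<in>{a, b, c}. alpha E M X \<sigma>)"
    if "colouring E M Y \<phi>" "X \<subseteq> Y" for Y \<phi>
    using col that unfolding colourable_def by blast
  show "card X \<le> (\<Sum>\<sigma>\<in>{a, b, c}. alpha E M X \<sigma>)"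
  proof (cases "w \<in> X")
    case False
    then have "X \<subseteq> {p, q, r, s}" using X by auto
    then show ?thesis using quad_lists_hall[OF assms(1-5) abc] unfolding hall_def by blast
  next
    case wX: True
    show ?thesis
    proof (cases "E w r")
      case False
      then have wr: "\<not> E w r" "\<not> E r w" using sym by auto
      consider "p \<notin> X" | "q \<notin> X" | "s \<notin> X" | "{p, q, s, w} \<subseteq> X" "r \<in> X" | "{p, q, s, w} \<subseteq> X" "r \<notin> X"
        using wX by blast
      then show ?thesis
      proof cases
        case 1
        show ?thesis
          by (rule col4[of "{q, r, s, w}" "(\<lambda>_. a)(q := a, s := a, r := b, w := b)"])
            (use 1 X d abc qs wr irrefl assms(2-6) in \<open>auto simp: colouring_def\<close>)
      next
        case 2
        show ?thesis
          by (rule col4[of "{p, r, s, w}" "(\<lambda>_. a)(p := a, s := c, r := b, w := b)"])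
            (use 2 X d abc qs wr irrefl assms(2-6) in \<open>auto simp: colouring_def\<close>)
      next
        case 3
        show ?thesis
          by (rule col4[of "{p, q, r, w}" "(\<lambda>_. a)(p := a, q := b, r := c, w := c)"])
            (use 3 X d abc qs wr irrefl assms(2-6) in \<open>auto simp: colouring_def\<close>)
      next
        case 4
        show ?thesis
        proof (rule card_le_sum_alpha[OF finX, where R = "{(q, a), (s, a), (r, b), (w, b), (r, c), (w, c)}"])
          have "X = {p, q, r, s, w}" using 4 X by auto
          then show "card X \<le> card {(q, a), (s, a), (r, b), (w, b), (r, c), (w, c)}" using d abc by simp
          show "\<not> E u v" if "(u, \<sigma>) \<in> {(q, a), (s, a), (r, b), (w, b), (r, c), (w, c)}"
            "(v, \<sigma>) \<in> {(q, a), (s, a), (r, b), (w, b), (r, c), (w, c)}" for u v \<sigma>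
            using that qs wr irrefl abc by auto
        qed (use 4 assms(2-6) in auto)
      next
        case 5
        show ?thesis
        proof (rule card_le_sum_alpha[OF finX, where R = "{(q, a), (s, a), (w, b), (w, c)}"])
          have "X = {p, q, s, w}" using 5 X by auto
          then show "card X \<le> card {(q, a), (s, a), (w, b), (w, c)}" using d abc by simp
          show "\<not> E u v" if "(u, \<sigma>) \<in> {(q, a), (s, a), (w, b), (w, c)}"
            "(v, \<sigma>) \<in> {(q, a), (s, a), (w, b), (w, c)}" for u v \<sigma>
            using that qs wr irrefl abc by auto
        qed (use 5 assms(2-6) in auto)
      qed
    next
      case True
      then have wqs: "\<not> E w q" "\<not> E w s" "\<not> E q w" "\<not> E s w" using nadj sym by auto
      consider "p \<notin> X" | "q \<notin> X" | "r \<notin> X" | "s \<notin> X" | "X = {p, q, r, s, w}"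
        using wX X by blast
      then show ?thesis
      proof cases
        case 1
        show ?thesis
          by (rule col4[of "{q, r, s, w}" "(\<lambda>_. a)(q := a, s := a, r := c, w := b)"])
            (use 1 X d abc qs wqs irrefl assms(2-6) in \<open>auto simp: colouring_def\<close>)
      next
        case 2
        show ?thesis
          by (rule col4[of "{p, r, s, w}" "(\<lambda>_. a)(p := a, s := c, r := b, w := c)"])
            (use 2 X d abc qs wqs irrefl assms(2-6) in \<open>auto simp: colouring_def\<close>)
      next
        case 3
        show ?thesis
          by (rule col4[of "{p, q, s, w}" "(\<lambda>_. a)(p := a, q := b, s := c, w := b)"])
            (use 3 X d abc qs wqs irrefl assms(2-6) in \<open>auto simp: colouring_def\<close>)
      next
        case 4
        show ?thesis
          by (rule col4[of "{p, q, r, w}" "(\<lambda>_. a)(p := a, q := b, r := c, w := b)"])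
            (use 4 X d abc qs wqs irrefl assms(2-6) in \<open>auto simp: colouring_def\<close>)
      next
        case 5
        show ?thesis
        proof (rule card_le_sum_alpha[OF finX, where R = "{(q, a), (s, a), (w, a), (r, b), (r, c)}"])
          show "card X \<le> card {(q, a), (s, a), (w, a), (r, b), (r, c)}" using 5 d abc by simp
          show "\<not> E u v" if "(u, \<sigma>) \<in> {(q, a), (s, a), (w, a), (r, b), (r, c)}"
            "(v, \<sigma>) \<in> {(q, a), (s, a), (w, a), (r, b), (r, c)}" for u v \<sigma>
            using that qs wqs irrefl abc by auto
        qed (use 5 assms(2-6) in auto)
      qed
    qed
  qed
qed

text \<open>Three outside vertices serve as colours. Exactly four are excluded because the last one
  would be isolated in \<open>G\<close>.\<close>

lemma quad_not_graphic_colourable: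
  assumes "finite V" "quad p q r s" "{p, q, r, s} \<subseteq> V" "3 \<le> card (V - {p, q, r, s})" "card (V - {p, q, r, s}) \<noteq> 4"
  shows "\<not> graphic_colourable V"
proof -
  let ?F = "{p, q, r, s}"
  obtain C where C: "C \<subseteq> V - ?F" "card C = 3" using assms(4) obtain_subset_with_card_n by metis
  then obtain a b c where abc: "C = {a, b, c}" "distinct [a, b, c]" by (auto simp: card_3_iff)
  have d: "distinct [p, q, r, s]" using assms(2) unfolding quad_def by simp
  define M where "M = (\<lambda>_. {})(p := {a}, q := {a, b}, r := {b, c}, s := {c, a})"
  have M: "M p = {a}" "M q = {a, b}" "M r = {b, c}" "M s = {c, a}" using d unfolding M_def by auto
  show ?thesis
  proof (rule not_graphic_colourableI[OF assms(1,3), of C M "(\<lambda>_. p)(a := p, b := q, c := r)"])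
    show "\<not> colourable E M ?F" by (rule quad_lists_uncolourable[OF assms(2) M]) simp
    show "hall E C M ?F" unfolding abc(1) by (rule quad_lists_hall[OF assms(2) M abc(2)])
    have "card (V - ?F - C) = card (V - ?F) - 3" using C assms(1) by (simp add: card_Diff_subset finite_subset)
    then show "card (V - ?F - C) \<noteq> 1" using assms(4,5) by simp
  qed (use C M abc d in auto)
qed

text \<open>The leftover vertex \<open>w\<close> receives all three colours as its list and joins
  \<open>U\<close>, so that nothing remains outside.\<close>

lemma quad_apex_not_graphic_colourable:
  assumes "finite V" "quad p q r s" "{p, q, r, s} \<subseteq> V" "card (V - {p, q, r, s}) = 4"
    and w: "w \<in> V - {p, q, r, s}" and nadj: "\<not> E w r \<or> \<not> E w q \<and> \<not> E w s"
  shows "\<not> graphic_colourable V"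
proof -
  let ?U = "{p, q, r, s, w}"
  define C where "C = V - ?U"
  have "C = V - {p, q, r, s} - {w}" unfolding C_def by auto
  then have "card C = 3" using assms(1,4) w by (simp add: card_Diff_singleton)
  then obtain a b c where abc: "C = {a, b, c}" "distinct [a, b, c]" by (auto simp: card_3_iff)
  have d: "distinct [p, q, r, s, w]" using assms(2) w unfolding quad_def by auto
  define M where "M = (\<lambda>_. {})(p := {a}, q := {a, b}, r := {b, c}, s := {c, a}, w := {a, b, c})"
  have M: "M p = {a}" "M q = {a, b}" "M r = {b, c}" "M s = {c, a}" "M w = {a, b, c}" using d unfolding M_def by auto
  have abcV: "a \<in> V - ?U" "b \<in> V - ?U" "c \<in> V - ?U" using abc(1) C_def by auto
  show ?thesis
  proof (rule not_graphic_colourableI[OF assms(1), of ?U C M "(\<lambda>_. p)(a := p, b := q, c := r)"])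
    show "\<not> colourable E M ?U" by (rule quad_lists_uncolourable[OF assms(2) M(1-4)]) simp
    show "hall E C M ?U" unfolding abc(1)
      by (rule quad_apex_lists_hall[OF assms(2) M abc(2)]) (use w nadj in auto)
    show "card (V - ?U - C) \<noteq> 1" unfolding C_def Diff_cancel by simp
  qed (use assms(3) w M abc abcV d in auto)
qed

text \<open>Every colour \<open>c i\<close> lies on the consecutive vertices \<open>v i\<close>, \<open>v (Suc i)\<close>, so colouring
  \<open>v 0\<close> with its only colour forces \<open>v i\<close> to get \<open>c i\<close> all the way round.\<close>

lemma hole_lists:
  assumes hole: "hole v k" and M0: "M (v 0) = {c 0}"
    and M: "\<And>i. 0 < i \<Longrightarrow> i < k \<Longrightarrow> M (v i) = {c (i - 1), c i}"
    and c: "c (k - 1) = c 0" "\<And>i. Suc i < k \<Longrightarrow> c i \<noteq> c (Suc i)"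
    and c0: "\<And>i. 0 < i \<Longrightarrow> i < k - 1 \<Longrightarrow> c i \<noteq> c 0"
  shows "\<not> colourable E M (v ` {..<k})" "hall E (c ` {..<k}) M (v ` {..<k})"
proof -
  let ?U = "v ` {..<k}"
  have k: "k \<ge> 4" using hole unfolding hole_def by blast
  have inj: "v i = v j \<longleftrightarrow> i = j" if "i < k" "j < k" for i j
    using hole_inj[OF hole] that by (auto dest: inj_onD)
  show "\<not> colourable E M ?U"
  proof
    assume "colourable E M ?U"
    then obtain \<phi> where \<phi>: "colouring E M ?U \<phi>" unfolding colourable_def by blast
    have lst: "\<phi> (v i) \<in> M (v i)" if "i < k" for i using \<phi> that unfolding colouring_def by blast
    have ne: "\<phi> (v i) \<noteq> \<phi> (v j)" if "i < k" "j < k" "E (v i) (v j)" for i j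
      using \<phi> that unfolding colouring_def by blast
    have "\<phi> (v i) = c i" if "i < k" for i
      using that
    proof (induction i)
      case 0
      then show ?case using lst[of 0] M0 by simp
    next
      case (Suc i)
      have "E (v i) (v (Suc i))" using hole_adjacent[OF hole] Suc.prems by auto
      then show ?case using ne[of i "Suc i"] lst[of "Suc i"] M[of "Suc i"] Suc by auto
    qed
    then have "\<phi> (v 0) = \<phi> (v (k - 1))" using c(1) k by auto
    moreover have "E (v 0) (v (k - 1))" using hole_adjacent[OF hole] k by auto
    ultimately show False using ne[of 0 "k - 1"] k by auto
  qed
  have Msub: "M u \<subseteq> c ` {..<k}" if "u \<in> ?U" for u
  proof -
    obtain i where i: "i < k" "u = v i" using \<open>u \<in> ?U\<close> by auto
    then show ?thesis using M0 M[of i] by (cases "i = 0") auto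
  qed
  show "hall E (c ` {..<k}) M ?U"
    unfolding hall_def
  proof (intro allI impI)
    fix X assume X: "X \<subseteq> ?U"
    have finX: "finite X" using X finite_subset by blast
    show "card X \<le> (\<Sum>\<sigma>\<in>c ` {..<k}. alpha E M X \<sigma>)"
    proof (cases "X = ?U")
      case False
      then obtain j where j: "j < k" "v j \<notin> X" using X by auto
      define \<iota> where "\<iota> = inv_into {..<k} v"
      have \<iota>: "\<iota> (v i) = i" if "i < k" for i
        unfolding \<iota>_def using hole_inj[OF hole] that by (simp add: inv_into_f_f)
      \<comment> \<open>The missing vertex \<open>v j\<close> cuts the cycle: vertices before it
        take the later colour of their list, vertices after it the earlier one.\<close>
      define \<phi> where "\<phi> u = (if \<iota> u < j then c (\<iota> u) else c (\<iota> u - 1))" for u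
      have "\<phi> (v s) \<noteq> \<phi> (v t)" if st: "s < k" "t < k" "s \<noteq> j" "t \<noteq> j" "E (v s) (v t)" "s < t" for s t
      proof -
        have "t = Suc s \<or> (s = 0 \<and> t = k - 1)" using st hole_adjacent[OF hole st(1,2)] by auto
        then show ?thesis
        proof
          assume t: "t = Suc s"
          then have "(s < j \<and> t < j) \<or> (j < s \<and> j < t)" using st by auto
          then show ?thesis
          proof
            assume "j < s \<and> j < t"
            moreover have "c (s - 1) \<noteq> c (Suc (s - 1))" using st t by (intro c(2)) auto
            ultimately show ?thesis using \<iota> st t unfolding \<phi>_def by auto
          qed (use \<iota> st t c(2)[of s] in \<open>auto simp: \<phi>_def\<close>)
        next
          assume "s = 0 \<and> t = k - 1"
          moreover from this have "0 < j" "j < k - 1" using st j(1) by auto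
          moreover have "c (k - 2) \<noteq> c 0" using k by (intro c0) auto
          ultimately show ?thesis using \<iota> k unfolding \<phi>_def by (auto simp: numeral_2_eq_2)
        qed
      qed
      note lt = this
      have "colouring E M X \<phi>"
        unfolding colouring_def
      proof (intro conjI ballI impI)
        fix u assume "u \<in> X"
        then obtain i where i: "i < k" "u = v i" "i \<noteq> j" using X j by auto
        then show "\<phi> u \<in> M u" using M0 M[of i] \<iota> unfolding \<phi>_def by (cases "i = 0") auto
      next
        fix x y assume xy: "x \<in> X" "y \<in> X" "E x y"
        then obtain s t where st: "s < k" "x = v s" "s \<noteq> j" "t < k" "y = v t" "t \<noteq> j" using X j by blast
        have "s \<noteq> t" using st xy irrefl by auto
        then show "\<phi> x \<noteq> \<phi> y" using lt[of s t] lt[of t s] st xy sym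
          by (metis linorder_neqE_nat)
      qed
      then have "colourable E M X" unfolding colourable_def by blast
      then show ?thesis by (rule colourable_card_le[OF finX, rotated]) (use X Msub in auto)
    next
      case True
      \<comment> \<open>\<open>v 0\<close> goes without a colour and \<open>v (k - 1)\<close> gets
        two: \<open>c 0\<close> counts at both \<open>v 1\<close> and \<open>v (k - 1)\<close>,
        which are nonadjacent.\<close>
      define R where "R = insert (v (k - 1), c 0) ((\<lambda>i. (v i, c (i - 1))) ` {1..<k})"
      show ?thesis
      proof (rule card_le_sum_alpha[OF finX, where R = R])
        have "card ((\<lambda>i. (v i, c (i - 1))) ` {1..<k}) = k - 1"
          using inj by (subst card_image) (auto simp: inj_on_def)
        moreover have "(v (k - 1), c 0) \<notin> (\<lambda>i. (v i, c (i - 1))) ` {1..<k}"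
        proof
          assume "(v (k - 1), c 0) \<in> (\<lambda>i. (v i, c (i - 1))) ` {1..<k}"
          then obtain i where "i \<in> {1..<k}" "v (k - 1) = v i" "c 0 = c (i - 1)" by auto
          then have "c 0 = c (k - 2)" using inj[of "k - 1" i] k by (auto simp: numeral_2_eq_2)
          moreover have "0 < k - 2" "k - 2 < k - 1" using k by linarith+
          ultimately show False using c0[of "k - 2"] by simp
        qed
        ultimately have "card R = k" unfolding R_def using k by simp
        then show "card X \<le> card R" using True hole_card[OF hole] by simp
        show "R \<subseteq> X \<times> c ` {..<k}" unfolding R_def True using k by auto
        show "\<sigma> \<in> M u" if "(u, \<sigma>) \<in> R" for u \<sigma>
          using that M[of "k - 1"] M c(1) k unfolding R_def by auto
        have idx: "(\<exists>i. 1 \<le> i \<and> i < k \<and> u = v i \<and> \<sigma> = c (i - 1) \<and> (\<sigma> = c 0 \<longrightarrow> i = 1)) \<or> (u = v (k - 1) \<and> \<sigma> = c 0)"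
          if "(u, \<sigma>) \<in> R" for u \<sigma>
        proof -
          from that consider "u = v (k - 1)" "\<sigma> = c 0" | i where "1 \<le> i" "i < k" "u = v i" "\<sigma> = c (i - 1)"
            unfolding R_def by auto
          then show ?thesis
          proof cases
            case (2 i)
            have "i = 1" if "c (i - 1) = c 0"
            proof (rule ccontr)
              assume "i \<noteq> 1"
              then have "0 < i - 1" "i - 1 < k - 1" using 2 by auto
              then show False using c0 that by blast
            qed
            then show ?thesis using 2 by blast
          qed blast
        qed
        have far: "\<not> E (v i) (v (k - 1))" if "i = 1" for i
          using that hole_adjacent[OF hole, of i "k - 1"] k by auto
        have near: "\<not> E (v i) (v j)"
          if "1 \<le> i" "i < k" "1 \<le> j" "j < k" "c (i - 1) = c (j - 1)" for i j
          using that hole_adjacent[OF hole, of i j] c(2)[of "i - 1"] c(2)[of "j - 1"] by auto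
        show "\<not> E x y" if "(x, \<sigma>) \<in> R" "(y, \<sigma>) \<in> R" for x y \<sigma>
          using idx[OF that(1)]
        proof
          assume y: "x = v (k - 1) \<and> \<sigma> = c 0"
          show ?thesis using idx[OF that(2)] y far irrefl sym by blast
        next
          assume "\<exists>i. 1 \<le> i \<and> i < k \<and> x = v i \<and> \<sigma> = c (i - 1) \<and> (\<sigma> = c 0 \<longrightarrow> i = 1)"
          then obtain i where i: "1 \<le> i" "i < k" "x = v i" "\<sigma> = c (i - 1)" "\<sigma> = c 0 \<longrightarrow> i = 1" by blast
          show ?thesis using idx[OF that(2)]
          proof
            assume "y = v (k - 1) \<and> \<sigma> = c 0"
            then show ?thesis using i far by blast
          next
            assume "\<exists>j. 1 \<le> j \<and> j < k \<and> y = v j \<and> \<sigma> = c (j - 1) \<and> (\<sigma> = c 0 \<longrightarrow> j = 1)"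
            then obtain j where j: "1 \<le> j" "j < k" "y = v j" "\<sigma> = c (j - 1)" by blast
            show ?thesis unfolding i(3) j(3)
              by (rule near[OF i(1,2) j(1,2)]) (use i(4) j(4) in argo)
          qed
        qed
      qed simp
    qed
  qed
qed

lemma hole_not_graphic_colourable:
  assumes "finite V" "hole v k" "k \<ge> 5" "v ` {..<k} \<subseteq> V" "3 \<le> card (V - v ` {..<k})"
  shows "\<not> graphic_colourable V"
proof -
  let ?F = "v ` {..<k}"
  have inj: "v i = v j \<longleftrightarrow> i = j" if "i < k" "j < k" for i j
    using hole_inj[OF assms(2)] that by (auto dest: inj_onD)
  \<comment> \<open>\<open>d\<close> equals \<open>c\<close> unless exactly four vertices lie
    outside; then it is the fourth, which would otherwise be left alone.\<close>
  obtain a b c d where abcd: "{a, b, c, d} \<subseteq> V - ?F" "distinct [a, b, c]" "d \<noteq> a" "d \<noteq> b"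
    and rest: "card (V - ?F - {a, b, c, d}) \<noteq> 1"
  proof -
    obtain C where C: "C \<subseteq> V - ?F" "card C = 3" using assms(5) obtain_subset_with_card_n by metis
    then obtain a b c where abc: "C = {a, b, c}" "distinct [a, b, c]" by (auto simp: card_3_iff)
    have card: "card (V - ?F - C) = card (V - ?F) - 3" using C assms(1) by (simp add: card_Diff_subset finite_subset)
    show ?thesis
    proof (cases "card (V - ?F) = 4")
      case True
      then obtain d where d: "V - ?F - C = {d}" using card by (auto simp: card_1_singleton_iff)
      then have "V - ?F - {a, b, c, d} = {}" using abc(1) by auto
      then have "card (V - ?F - {a, b, c, d}) \<noteq> 1" by (simp only: card.empty)
      moreover have "{a, b, c, d} \<subseteq> V - ?F" "d \<noteq> a" "d \<noteq> b" using C(1) d abc(1) by auto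
      ultimately show ?thesis using that[of a b c d] abc(2) by blast
    next
      case False
      then show ?thesis using that[of a b c c] C(1) abc card assms(5) by auto
    qed
  qed
  \<comment> \<open>The pattern is a, d, b, c, b, c, ..., a. As \<open>k \<ge> 5\<close>, position 3
    comes before the closing \<open>a\<close>, so all four colours occur; neighbouring entries
    differ even when \<open>d = c\<close>.\<close>
  define s where "s i = (if i = 0 \<or> i = k - 1 then a else if i = 1 then d else if even i then b else c)" for i
  define M where "M u = (let i = inv_into {..<k} v u in if i = 0 then {s 0} else {s (i - 1), s i})" for u
  have M: "M (v i) = (if i = 0 then {s 0} else {s (i - 1), s i})" if "i < k" for i
    using hole_inj[OF assms(2)] that unfolding M_def by (simp add: inv_into_f_f Let_def)
  have sval: "s 0 = a" "s 1 = d" "s 2 = b" "s 3 = c"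
    using assms(3) unfolding s_def by auto
  have simg: "s ` {..<k} = {a, b, c, d}"
  proof
    show "s ` {..<k} \<subseteq> {a, b, c, d}" unfolding s_def by auto
    have "s 0 \<in> s ` {..<k}" "s 1 \<in> s ` {..<k}" "s 2 \<in> s ` {..<k}" "s 3 \<in> s ` {..<k}"
      using assms(3) by (auto intro!: imageI)
    then show "{a, b, c, d} \<subseteq> s ` {..<k}" unfolding sval by blast
  qed
  have props: "s (k - 1) = s 0" "\<And>i. Suc i < k \<Longrightarrow> s i \<noteq> s (Suc i)" "\<And>i. 0 < i \<Longrightarrow> i < k - 1 \<Longrightarrow> s i \<noteq> s 0"
    using abcd(2-4) assms(3) unfolding s_def by auto
  have lists: "\<not> colourable E M ?F" "hall E {a, b, c, d} M ?F"
    using hole_lists[OF assms(2), of M s] M props assms(3) unfolding simg by auto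
  show ?thesis
  proof (rule not_graphic_colourableI[OF assms(1,4), of "{a, b, c, d}" M
        "\<lambda>\<sigma>. if \<sigma> = a then v 0 else if \<sigma> = b then v 2 else if \<sigma> = c then v 3 else v 1"])
    let ?f = "\<lambda>\<sigma>. if \<sigma> = a then v 0 else if \<sigma> = b then v 2 else if \<sigma> = c then v 3 else v 1"
    have ne: "v 0 \<noteq> v 1" "v 0 \<noteq> v 2" "v 0 \<noteq> v 3" "v 1 \<noteq> v 2" "v 1 \<noteq> v 3" "v 2 \<noteq> v 3"
      using inj assms(3) by auto
    show "inj_on ?f {a, b, c, d}" using abcd(2-4) ne by (auto simp: inj_on_def)
    have M': "M (v 0) = {a}" "M (v 1) = {a, d}" "M (v 2) = {d, b}" "M (v 3) = {b, c}"
      using M[of 0] M[of 1] M[of 2] M[of 3] assms(3) sval by (auto simp: numeral_eq_Suc)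
    have inF: "v 0 \<in> ?F" "v 1 \<in> ?F" "v 2 \<in> ?F" "v 3 \<in> ?F" using assms(3) by auto
    show "?f \<sigma> \<in> ?F \<and> \<sigma> \<in> M (?f \<sigma>)" if "\<sigma> \<in> {a, b, c, d}" for \<sigma>
      using that M' inF by auto
    show "{a, b, c, d} \<subseteq> V" "?F \<inter> {a, b, c, d} = {}" using abcd(1) by auto
    show "M u \<subseteq> {a, b, c, d}" if "u \<in> ?F" for u
    proof -
      obtain i where i: "i < k" "u = v i" using \<open>u \<in> ?F\<close> by auto
      moreover have "s j \<in> {a, b, c, d}" for j unfolding s_def by simp
      ultimately show ?thesis using M[of i] by simp
    qed
  qed (use lists rest in auto)
qed


text \<open>Read in the complement, \<open>quads\<close> yields three facts: no triangle
  (\<open>tri\<close>), every path on four vertices closes to a cycle (\<open>path\<close>), and no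
  two disjoint edges without an edge between them (\<open>two\<close>). Hence the complement is one
  complete bipartite graph plus isolated vertices. Two of the latter are the ends of the diagonal of
  the given quadruple, whence the bound 6 = 8 - 2.\<close>

lemma quad_all_structure:
  assumes "finite V" "card V = 8" and q0: "quad p0 q0 r0 s0" "{p0, q0, r0, s0} \<subseteq> V"
    and quads: "\<And>p q r s w. quad p q r s \<Longrightarrow> {p, q, r, s} \<subseteq> V \<Longrightarrow> w \<in> V - {p, q, r, s} \<Longrightarrow>
      E w r \<and> (E w q \<or> E w s)"
  obtains S Q where "S \<subseteq> V" "Q \<subseteq> V" "S \<inter> Q = {}" "S \<noteq> {}" "Q \<noteq> {}" "card S + card Q \<le> 6"
    "\<And>u v. u \<in> V \<Longrightarrow> v \<in> V \<Longrightarrow>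
      E u v \<longleftrightarrow> u \<noteq> v \<and> \<not> (u \<in> S \<and> v \<in> Q) \<and> \<not> (u \<in> Q \<and> v \<in> S)"
proof -
  have flip: "quad r q p s" if "quad p q r s" for p q r s
    using that sym unfolding quad_def by auto
  have adj: "E w p" "E w r" "E w q \<or> E w s"
    if "quad p q r s" "{p, q, r, s} \<subseteq> V" "w \<in> V" "w \<notin> {p, q, r, s}" for p q r s w
    using quads[OF that(1,2)] quads[OF flip[OF that(1)]] that by auto
  \<comment> \<open>If \<open>p\<close> and \<open>r\<close> were nonadjacent, a fifth vertex
    \<open>w\<close> would make \<open>w\<close>, \<open>p\<close>, \<open>q\<close>,
    \<open>r\<close> a quadruple too, and applying \<open>quads\<close> to it with \<open>s\<close>
    as the outer vertex would make \<open>s\<close> and \<open>q\<close> adjacent.\<close>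
  have diag: "E p r" if q: "quad p q r s" "{p, q, r, s} \<subseteq> V" for p q r s
  proof (rule ccontr)
    assume n: "\<not> E p r"
    have rot: "quad q r s p" using q n sym unfolding quad_def by auto
    have "card {p, q, r, s} \<le> 4" by (simp add: card_insert_if)
    then have "\<not> V \<subseteq> {p, q, r, s}" using card_mono[of "{p, q, r, s}" V] assms(2) by auto
    then obtain w where w: "w \<in> V" "w \<notin> {p, q, r, s}" by blast
    have "E w p" "E w r" using adj[OF q w] by auto
    then have "quad w p q r" using q w n sym unfolding quad_def by auto
    then have "E s q" using adj[of w p q r s] q w unfolding quad_def by auto
    then show False using q sym unfolding quad_def by auto
  qed
  obtain x y u v where xyuv: "x \<in> V" "y \<in> V" "u \<in> V" "v \<in> V" "distinct [x, y, u, v]" "\<not> E u v" "E x y"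
    and univ: "\<And>w. w \<in> V \<Longrightarrow> w \<noteq> x \<Longrightarrow> E w x" "\<And>w. w \<in> V \<Longrightarrow> w \<noteq> y \<Longrightarrow> E w y"
  proof -
    have e: "E p0 q0" "E q0 r0" "E r0 s0" "E s0 p0" "\<not> E q0 s0" "distinct [p0, q0, r0, s0]"
      using q0(1) unfolding quad_def by auto
    have "E w p0" if "w \<in> V" "w \<noteq> p0" for w
      using adj(1)[OF q0 that(1)] that e sym diag[OF q0] by auto
    moreover have "E w r0" if "w \<in> V" "w \<noteq> r0" for w
      using adj(2)[OF q0 that(1)] that e sym diag[OF q0] by auto
    ultimately show thesis using that[of p0 r0 q0 s0] q0(2) e diag[OF q0] by auto
  qed
  \<comment> \<open>Since \<open>x\<close> and \<open>y\<close> are adjacent to everything, each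
    nonadjacent pair spans a quadruple with them, so \<open>quads\<close> applies to every
    non-edge.\<close>
  have mk: "quad x a y b" if "a \<in> V" "b \<in> V" "a \<noteq> b" "\<not> E a b" for a b
  proof -
    have "a \<noteq> x" "a \<noteq> y" "b \<noteq> x" "b \<noteq> y" using univ[of a] univ[of b] that sym xyuv(1,2) by (metis)+
    then show ?thesis using that univ sym xyuv unfolding quad_def by auto
  qed
  have tri: "E w a \<or> E w b" if "a \<in> V" "b \<in> V" "a \<noteq> b" "\<not> E a b" "w \<in> V" "w \<noteq> a" "w \<noteq> b" for a b w
  proof (cases "w = x \<or> w = y")
    case True
    then show ?thesis using univ that sym by blast
  next
    case False
    then show ?thesis using adj(3)[OF mk[OF that(1-4)], of w] that xyuv(1,2) by auto
  qed
  have path: "\<not> E a d"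
    if "a \<in> V" "b \<in> V" "c \<in> V" "d \<in> V" "distinct [a, b, c, d]" "\<not> E a b" "\<not> E b c" "\<not> E c d" for a b c d
  proof
    assume ad: "E a d"
    have ba: "\<not> E b a" "\<not> E c b" "\<not> E d c" using that sym by blast+
    have "E d b" using tri[of b c d] that ba by auto
    have ax: "a \<noteq> x" "b \<noteq> x" "c \<noteq> x" "d \<noteq> x" using univ that ba by auto
    have "quad x a d b" using that ax ad \<open>E d b\<close> univ sym unfolding quad_def by auto
    then have "E c d" using adj(2)[of x a d b c] that ax xyuv by auto
    then show False using that by simp
  qed
  have two: False
    if "a \<in> V" "b \<in> V" "c \<in> V" "d \<in> V" "distinct [a, b, c, d]" "\<not> E a b" "\<not> E c d"
      "E a c" "E a d" "E b c" "E b d" for a b c d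
  proof -
    have "quad a c b d" using that sym unfolding quad_def by auto
    then show False using diag[of a c b d] that by auto
  qed
  \<comment> \<open>Starting from the complement edge between \<open>u\<close> and \<open>v\<close>,
    the two sides are the complement neighbourhoods of its ends.\<close>
  define S where "S = {s \<in> V. s \<noteq> v \<and> \<not> E s v}"
  define Q where "Q = {t \<in> V. t \<noteq> u \<and> \<not> E t u}"
  have vu: "\<not> E v u" using xyuv(6) sym by blast
  have uS: "u \<in> S" "v \<in> Q" "u \<notin> Q" "v \<notin> S" unfolding S_def Q_def using xyuv vu by auto
  have disj: "S \<inter> Q = {}"
  proof -
    have False if "w \<in> S" "w \<in> Q" for w
      using tri[of u v w] that xyuv unfolding S_def Q_def by auto
    then show ?thesis by blast
  qed
  have SV: "S \<subseteq> V - {x, y}" "Q \<subseteq> V - {x, y}"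
    unfolding S_def Q_def using univ xyuv sym by auto
  have SQ: "\<not> E s t" if st: "s \<in> S" "t \<in> Q" for s t
  proof (cases "s = u \<or> t = v")
    case True
    then show ?thesis using st sym unfolding S_def Q_def by blast
  next
    case False
    have "s \<noteq> t" using st disj by auto
    then have "\<not> E t s"
      using path[of t u v s] st False xyuv sym[of v s] unfolding S_def Q_def by auto
    then show ?thesis using sym by blast
  qed
  have SS: "E s t" if "s \<in> S" "t \<in> S" "s \<noteq> t" for s t
    using tri[of s v t] that xyuv sym[of t s] unfolding S_def by auto
  have QQ: "E s t" if "s \<in> Q" "t \<in> Q" "s \<noteq> t" for s t
    using tri[of s u t] that xyuv sym[of t s] unfolding Q_def by auto
  \<comment> \<open>A complement edge at \<open>r\<close> would either continue to the edge between
    \<open>u\<close> and \<open>v\<close>, against \<open>path\<close>, or be separate from it,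
    against \<open>two\<close>.\<close>
  have R: "E r w" if r: "r \<in> V" "r \<notin> S" "r \<notin> Q" and w: "w \<in> V" "w \<noteq> r" for r w
  proof (rule ccontr)
    assume n: "\<not> E r w"
    have n': "\<not> E w r" using n sym by blast
    have ruv: "E r u" "E r v" "r \<noteq> u" "r \<noteq> v" using r uS unfolding S_def Q_def by auto
    have wuv: "w \<noteq> u" "w \<noteq> v" using n ruv by auto
    consider "w \<in> S" | "w \<in> Q" | "w \<notin> S" "w \<notin> Q" by blast
    then show False
    proof cases
      case 1
      then show False using path[of r w v u] n vu ruv wuv r w xyuv unfolding S_def by auto
    next
      case 2
      then show False using path[of r w u v] n ruv wuv r w xyuv unfolding Q_def by auto
    next
      case 3
      then have "E w u" "E w v" using w wuv unfolding S_def Q_def by auto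
      then show False using two[of r w u v] n ruv wuv r w xyuv by auto
    qed
  qed
  have iff: "E a b \<longleftrightarrow> a \<noteq> b \<and> \<not> (a \<in> S \<and> b \<in> Q) \<and> \<not> (a \<in> Q \<and> b \<in> S)" if "a \<in> V" "b \<in> V" for a b
  proof
    assume "E a b"
    then show "a \<noteq> b \<and> \<not> (a \<in> S \<and> b \<in> Q) \<and> \<not> (a \<in> Q \<and> b \<in> S)"
      using SQ[of a b] SQ[of b a] sym irrefl by blast
  next
    assume ab: "a \<noteq> b \<and> \<not> (a \<in> S \<and> b \<in> Q) \<and> \<not> (a \<in> Q \<and> b \<in> S)"
    show "E a b"
    proof (cases "a \<in> S \<union> Q \<and> b \<in> S \<union> Q")
      case True
      then show ?thesis using ab SS[of a b] QQ[of a b] by blast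
    next
      case False
      then show ?thesis using ab R[of a b] R[of b a] sym that by blast
    qed
  qed
  have "card S + card Q = card (S \<union> Q)"
    using SV assms(1) disj by (intro card_Un_disjoint[symmetric]) (auto intro: finite_subset)
  also have "\<dots> \<le> card (V - {x, y})" using SV assms(1) by (intro card_mono) auto
  also have "\<dots> = 6" using assms(1,2) xyuv by (simp add: card_Diff_subset)
  finally have "card S + card Q \<le> 6" .
  then show thesis using that[of S Q] SV disj uS iff by blast
qed

theorem graphic_colourable_necessary:
  assumes "finite V" "graphic_colourable V" "F \<subseteq> V" "obstruction F" "3 \<le> card (V - F)"
  obtains S Q where "card V = 8" "S \<subseteq> V" "Q \<subseteq> V" "S \<inter> Q = {}" "S \<noteq> {}" "Q \<noteq> {}" "card S + card Q \<le> 6"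
    "\<And>u v. u \<in> V \<Longrightarrow> v \<in> V \<Longrightarrow>
      E u v \<longleftrightarrow> u \<noteq> v \<and> \<not> (u \<in> S \<and> v \<in> Q) \<and> \<not> (u \<in> Q \<and> v \<in> S)"
proof -
  obtain p q r s where qd: "quad p q r s" "F = {p, q, r, s}"
  proof -
    from assms(4) consider (hole) v k where "hole v k" "F = v ` {..<k}"
      | (diamond) x y u v where "is_diamond x y u v" "F = {x, y, u, v}"
      unfolding obstruction_def by blast
    then show thesis
    proof cases
      case hole
      have "k \<ge> 4" using hole unfolding hole_def by blast
      moreover have "\<not> k \<ge> 5"
        using hole_not_graphic_colourable[OF assms(1) hole(1)] assms(2,3,5) hole(2) by blast
      ultimately have k: "k = 4" by simp
      have "{..<4} = {0, 1, 2, 3 :: nat}" by auto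
      then have "F = {v 0, v 1, v 2, v 3}" using hole(2) k by auto
      moreover have "quad (v 0) (v 1) (v 2) (v 3)"
        using hole_adjacent[OF hole(1)] hole_inj[OF hole(1)] k unfolding quad_def by (auto dest: inj_onD)
      ultimately show thesis using that by blast
    next
      case diamond
      then have "quad x u y v" using sym irrefl unfolding is_diamond_def quad_def by auto
      then show thesis using that diamond(2) by blast
    qed
  qed
  have FV: "{p, q, r, s} \<subseteq> V" using assms(3) qd(2) by simp
  have "card (V - F) = 4"
    using quad_not_graphic_colourable[OF assms(1) qd(1) FV] assms(2,5) qd(2) by blast
  moreover have c4: "card {p, q, r, s} = 4" if "quad p q r s" for p q r s using that unfolding quad_def by simp
  ultimately have V8: "card V = 8"
    using assms(1) FV qd card_Diff_subset[of F V] card_mono[of V F] by auto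
  \<comment> \<open>On eight vertices every quadruple leaves four vertices outside, so each of them
    can play the part of \<open>w\<close>.\<close>
  have quads: "E w r' \<and> (E w q' \<or> E w s')"
    if "quad p' q' r' s'" "{p', q', r', s'} \<subseteq> V" "w \<in> V - {p', q', r', s'}" for p' q' r' s' w
  proof -
    have "card (V - {p', q', r', s'}) = 4" using c4[OF that(1)] that(2) V8 by (simp add: card_Diff_subset)
    then show ?thesis
      using quad_apex_not_graphic_colourable[OF assms(1) that(1,2)] that(3) assms(2) by blast
  qed
  show thesis
  proof (rule quad_all_structure[OF assms(1) V8 qd(1) FV])
    fix S Q
    assume "S \<subseteq> V" "Q \<subseteq> V" "S \<inter> Q = {}" "S \<noteq> {}" "Q \<noteq> {}" "card S + card Q \<le> 6"
      "\<And>u v. u \<in> V \<Longrightarrow> v \<in> V \<Longrightarrow>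
        E u v \<longleftrightarrow> u \<noteq> v \<and> \<not> (u \<in> S \<and> v \<in> Q) \<and> \<not> (u \<in> Q \<and> v \<in> S)"
    then show thesis by (rule that[OF V8])
  qed (use quads in blast)
qed


section \<open>Translation to labelled graphs\<close>

lemma graphic_colourableI:
  assumes "finite V" "\<And>g U. graphic_critical E g V U \<Longrightarrow> False"
  shows "graphic_colourable V"
  unfolding graphic_colourable_def
proof (intro allI impI, rule ccontr)
  fix g assume g: "\<forall>u v. g u v \<longrightarrow> g v u \<and> u \<noteq> v \<and> v \<in> V"
    and hall: "hall E V (\<lambda>v. {u. g v u}) V" and "\<not> colourable E (\<lambda>v. {u. g v u}) V"
  then obtain U where "U \<subseteq> V" "critical (\<lambda>v. {u. g v u}) U"
    using critical_subset_exists[OF assms(1)] by metis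
  then have "graphic_critical E g V U"
    using assms(1) g hall by unfold_locales blast+
  then show False by (rule assms(2))
qed

lemma cycle_graph_edges_iff:
  assumes "i < k" "j < k"
  shows "{i, j} \<in> edges (cycle_graph k) \<longleftrightarrow> j = (i + 1) mod k \<or> i = (j + 1) mod k"
  unfolding cycle_graph_def using assms by (auto simp: doubleton_eq_iff)

lemma hole_iff:
  assumes "k \<ge> 4"
  shows "hole v k \<longleftrightarrow> inj_on v {..<k} \<and>
    (\<forall>i<k. \<forall>j<k. E (v i) (v j) \<longleftrightarrow> {i, j} \<in> edges (cycle_graph k))"
proof -
  have e: "{i, j} \<in> edges (cycle_graph k) \<longleftrightarrow>
      j = Suc i \<or> i = Suc j \<or> (i = 0 \<and> j = k - 1) \<or> (j = 0 \<and> i = k - 1)" if "i < k" "j < k" for i j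
    unfolding cycle_graph_edges_iff[OF that] using that assms by (auto simp: mod_Suc)
  show ?thesis
  proof
    assume "hole v k"
    then show "inj_on v {..<k} \<and> (\<forall>i<k. \<forall>j<k. E (v i) (v j) \<longleftrightarrow> {i, j} \<in> edges (cycle_graph k))"
      using hole_inj hole_adjacent e by auto
  next
    assume "inj_on v {..<k} \<and> (\<forall>i<k. \<forall>j<k. E (v i) (v j) \<longleftrightarrow> {i, j} \<in> edges (cycle_graph k))"
    then show "hole v k" unfolding hole_def cycle_def using assms e by auto
  qed
qed

lemma diamond_edges_iff:
  "i < 4 \<Longrightarrow> j < 4 \<Longrightarrow> {i, j} \<in> edges diamond \<longleftrightarrow> i \<noteq> j \<and> {i, j} \<noteq> {0, 1}"
  unfolding diamond_def delete_edges_def complete_graph_def by (auto simp: doubleton_eq_iff)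

lemma is_diamond_iff:
  fixes v :: "nat \<Rightarrow> 'a"
  shows "inj_on v {..<4} \<and> (\<forall>i<4. \<forall>j<4. E (v i) (v j) \<longleftrightarrow> {i, j} \<in> edges diamond) \<longleftrightarrow>
    is_diamond (v 2) (v 3) (v 0) (v 1)"
proof -
  have four: "i < 4 \<longleftrightarrow> i = 0 \<or> i = 1 \<or> i = 2 \<or> i = (3 :: nat)" for i by auto
  have set4: "{..<4} = {0, 1, 2, 3 :: nat}" by auto
  show ?thesis
  proof
    assume *: "inj_on v {..<4} \<and> (\<forall>i<4. \<forall>j<4. E (v i) (v j) \<longleftrightarrow> {i, j} \<in> edges diamond)"
    then have E: "E (v i) (v j) \<longleftrightarrow> i \<noteq> j \<and> {i, j} \<noteq> {0, 1}" if "i < 4" "j < 4" for i j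
      using * diamond_edges_iff[OF that] that by simp
    have "v 0 \<noteq> v 1" using * by (auto dest: inj_onD)
    then show "is_diamond (v 2) (v 3) (v 0) (v 1)" unfolding is_diamond_def by (simp add: E doubleton_eq_iff)
  next
    assume d: "is_diamond (v 2) (v 3) (v 0) (v 1)"
    then have "E (v i) (v j) \<longleftrightarrow> i \<noteq> j \<and> {i, j} \<noteq> {0, 1}" if "i < 4" "j < 4" for i j
      using that[unfolded four] sym irrefl unfolding is_diamond_def by (auto simp: doubleton_eq_iff)
    then have "E (v i) (v j) \<longleftrightarrow> {i, j} \<in> edges diamond" if "i < 4" "j < 4" for i j
      using diamond_edges_iff[OF that] that by simp
    moreover have "inj_on v {..<4}"
      unfolding set4 using d irrefl unfolding is_diamond_def by auto
    ultimately show "inj_on v {..<4} \<and> (\<forall>i<4. \<forall>j<4. E (v i) (v j) \<longleftrightarrow> {i, j} \<in> edges diamond)"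
      by blast
  qed
qed

lemma obstruction_iff:
  "obstruction X \<longleftrightarrow> (\<exists>M\<in>cycles_and_diamond. \<exists>v. bij_betw v (verts M) X \<and>
    (\<forall>i\<in>verts M. \<forall>j\<in>verts M. {i, j} \<in> edges M \<longleftrightarrow> E (v i) (v j)))"
proof
  assume "obstruction X"
  then consider (hole) v k where "hole v k" "X = v ` {..<k}"
    | (diamond) x y u w where "is_diamond x y u w" "X = {x, y, u, w}"
    unfolding obstruction_def by blast
  then show "\<exists>M\<in>cycles_and_diamond. \<exists>v. bij_betw v (verts M) X \<and>
    (\<forall>i\<in>verts M. \<forall>j\<in>verts M. {i, j} \<in> edges M \<longleftrightarrow> E (v i) (v j))"
  proof cases
    case hole
    then have k: "k \<ge> 4" unfolding hole_def by blast
    have "bij_betw v (verts (cycle_graph k)) X"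
      using hole hole_inj unfolding bij_betw_def cycle_graph_def by simp
    moreover have "\<forall>i<k. \<forall>j<k. {i, j} \<in> edges (cycle_graph k) \<longleftrightarrow> E (v i) (v j)"
      using hole(1) unfolding hole_iff[OF k] by simp
    moreover have "verts (cycle_graph k) = {..<k}" unfolding cycle_graph_def by simp
    ultimately have "bij_betw v (verts (cycle_graph k)) X \<and>
        (\<forall>i\<in>verts (cycle_graph k). \<forall>j\<in>verts (cycle_graph k). {i, j} \<in> edges (cycle_graph k) \<longleftrightarrow> E (v i) (v j))"
      by simp
    moreover have "cycle_graph k \<in> cycles_and_diamond" using k unfolding cycles_and_diamond_def by blast
    ultimately show ?thesis by blast
  next
    case diamond
    \<comment> \<open>In \<open>diamond\<close> the missing edge joins 0 and 1, so the nonadjacent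
      pair takes these places.\<close>
    define v where "v = (\<lambda>i :: nat. if i = 0 then u else if i = 1 then w else if i = 2 then x else y)"
    have "is_diamond (v 2) (v 3) (v 0) (v 1)" using diamond(1) unfolding v_def by simp
    then have *: "inj_on v {..<4}" "\<forall>i<4. \<forall>j<4. E (v i) (v j) \<longleftrightarrow> {i, j} \<in> edges diamond"
      unfolding is_diamond_iff[symmetric] by auto
    have "{..<4} = {0, 1, 2, 3 :: nat}" by auto
    then have "v ` {..<4} = X" using diamond(2) unfolding v_def by auto
    moreover have vd: "verts diamond = {..<4}" unfolding diamond_def delete_edges_def complete_graph_def by simp
    ultimately have "bij_betw v (verts diamond) X" using *(1) unfolding bij_betw_def by simp
    then show ?thesis using *(2) vd unfolding cycles_and_diamond_def by auto
  qed
next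
  assume "\<exists>M\<in>cycles_and_diamond. \<exists>v. bij_betw v (verts M) X \<and>
    (\<forall>i\<in>verts M. \<forall>j\<in>verts M. {i, j} \<in> edges M \<longleftrightarrow> E (v i) (v j))"
  then obtain M v where M: "M \<in> cycles_and_diamond" "bij_betw v (verts M) X"
    "\<forall>i\<in>verts M. \<forall>j\<in>verts M. {i, j} \<in> edges M \<longleftrightarrow> E (v i) (v j)" by blast
  from M(1) consider k where "k \<ge> 4" "M = cycle_graph k" | "M = diamond"
    unfolding cycles_and_diamond_def by auto
  then show "obstruction X"
  proof cases
    case (1 k)
    have "verts M = {..<k}" using 1 unfolding cycle_graph_def by simp
    then have "hole v k" "X = v ` {..<k}" unfolding hole_iff[OF 1(1)] using M 1 by (auto simp: bij_betw_def)
    then show ?thesis unfolding obstruction_def by blast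
  next
    case 2
    have v4: "verts M = {..<4}" using 2 unfolding diamond_def delete_edges_def complete_graph_def by simp
    then have "is_diamond (v 2) (v 3) (v 0) (v 1)"
      unfolding is_diamond_iff[symmetric] using M 2 by (auto simp: bij_betw_def)
    moreover have "{..<4} = {2, 3, 0, 1 :: nat}" by auto
    then have "X = {v 2, v 3, v 0, v 1}" using M(2) v4 unfolding bij_betw_def by auto
    ultimately show ?thesis unfolding obstruction_def by blast
  qed
qed

end

section \<open>Isomorphism with the graphs \<open>K8_minus_K\<close>\<close>

lemma isomorphic_sym:
  assumes "isomorphic G H"
  shows "isomorphic H G"
proof -
  obtain f where f: "bij_betw f (verts G) (verts H)"
    "\<And>u v. u \<in> verts G \<Longrightarrow> v \<in> verts G \<Longrightarrow> {u, v} \<in> edges G \<longleftrightarrow> {f u, f v} \<in> edges H"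
    using assms unfolding isomorphic_def by blast
  define h where "h = inv_into (verts G) f"
  have h: "bij_betw h (verts H) (verts G)" unfolding h_def using f(1) by (rule bij_betw_inv_into)
  have fh: "f (h x) = x" if "x \<in> verts H" for x
    unfolding h_def using bij_betw_inv_into_right[OF f(1) that] .
  have "{x, y} \<in> edges H \<longleftrightarrow> {h x, h y} \<in> edges G" if "x \<in> verts H" "y \<in> verts H" for x y
    using f(2)[of "h x" "h y"] fh that bij_betwE[OF h] by simp
  then show ?thesis using h unfolding isomorphic_def by blast
qed

lemma isomorphic_sym_iff: "isomorphic G H \<longleftrightarrow> isomorphic H G"
  by (rule iffI) (erule isomorphic_sym)+

lemma K8_minus_K_edges_iff:
  assumes "i < 8" "j < 8"
  shows "{i, j} \<in> edges (K8_minus_K s t) \<longleftrightarrow> i \<noteq> j \<and>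
    \<not> (i < s \<and> j \<in> {s..<s + t}) \<and> \<not> (i \<in> {s..<s + t} \<and> j < s)"
  unfolding K8_minus_K_def delete_edges_def complete_graph_def complete_bipartite_def
  using assms by (auto simp: doubleton_eq_iff)

lemma verts_K8_minus_K: "verts (K8_minus_K s t) = {..<8}"
  unfolding K8_minus_K_def delete_edges_def complete_graph_def by simp

lemma isomorphic_K8_minus_K_I:
  assumes "finite (verts H)" "card (verts H) = 8" "S \<subseteq> verts H" "Q \<subseteq> verts H" "S \<inter> Q = {}"
    and E: "\<And>u v. u \<in> verts H \<Longrightarrow> v \<in> verts H \<Longrightarrow> {u, v} \<in> edges H \<longleftrightarrow>
      u \<noteq> v \<and> \<not> (u \<in> S \<and> v \<in> Q) \<and> \<not> (u \<in> Q \<and> v \<in> S)"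
  shows "isomorphic H (K8_minus_K (card S) (card Q))"
proof -
  let ?V = "verts H" and ?s = "card S" and ?t = "card Q"
  have fin: "finite S" "finite Q" using assms finite_subset by auto
  have SQ: "card (S \<union> Q) = ?s + ?t" using fin assms(5) by (rule card_Un_disjoint)
  then have le: "?s + ?t \<le> 8" using card_mono[OF assms(1), of "S \<union> Q"] assms(2-4) by simp
  have "card (?V - (S \<union> Q)) = 8 - (?s + ?t)"
    using SQ assms(2-4) fin by (simp add: card_Diff_subset)
  then obtain f1 f2 f3 where f: "bij_betw f1 S {..<?s}" "bij_betw f2 Q {?s..<?s + ?t}"
    "bij_betw f3 (?V - (S \<union> Q)) {?s + ?t..<8}"
    using finite_same_card_bij[of S "{..<?s}"] finite_same_card_bij[of Q "{?s..<?s + ?t}"]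
      finite_same_card_bij[of "?V - (S \<union> Q)" "{?s + ?t..<8}"] fin assms(1) by auto
  \<comment> \<open>\<open>S\<close>, \<open>Q\<close> and the rest go to consecutive intervals, the
    first two being the sides of the deleted bipartite graph.\<close>
  define f where "f x = (if x \<in> S then f1 x else if x \<in> Q then f2 x else f3 x)" for x
  have "bij_betw (\<lambda>x. if x \<in> Q then f2 x else f3 x) (Q \<union> (?V - (S \<union> Q))) ({?s..<?s + ?t} \<union> {?s + ?t..<8})"
    by (rule bij_betw_disjoint_Un[OF f(2,3)]) auto
  then have "bij_betw f (S \<union> (Q \<union> (?V - (S \<union> Q)))) ({..<?s} \<union> ({?s..<?s + ?t} \<union> {?s + ?t..<8}))"
    unfolding f_def by (rule bij_betw_disjoint_Un[OF f(1)]) (use assms(5) in auto)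
  moreover have "S \<union> (Q \<union> (?V - (S \<union> Q))) = ?V" using assms(3,4) by auto
  moreover have "{..<?s} \<union> ({?s..<?s + ?t} \<union> {?s + ?t..<8}) = {..<8}" using le by auto
  ultimately have bij: "bij_betw f ?V {..<8}" by simp
  have fSQ: "(f x < ?s \<longleftrightarrow> x \<in> S) \<and> (f x \<in> {?s..<?s + ?t} \<longleftrightarrow> x \<in> Q)" if "x \<in> ?V" for x
  proof -
    consider "x \<in> S" "x \<notin> Q" | "x \<notin> S" "x \<in> Q" | "x \<notin> S" "x \<notin> Q" using assms(5) by blast
    then show ?thesis
    proof cases
      case 1
      then have "f x \<in> {..<?s}" using bij_betwE[OF f(1)] unfolding f_def by simp
      then show ?thesis using 1 by simp
    next
      case 2
      then have "f x \<in> {?s..<?s + ?t}" using bij_betwE[OF f(2)] unfolding f_def by simp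
      then show ?thesis using 2 by simp
    next
      case 3
      then have "f x \<in> {?s + ?t..<8}" using bij_betwE[OF f(3)] that unfolding f_def by simp
      then show ?thesis using 3 by simp
    qed
  qed
  have "{u, v} \<in> edges H \<longleftrightarrow> {f u, f v} \<in> edges (K8_minus_K ?s ?t)" if "u \<in> ?V" "v \<in> ?V" for u v
  proof -
    have "f u < 8" "f v < 8" using bij_betwE[OF bij] that by auto
    moreover have "f u = f v \<longleftrightarrow> u = v" using bij that unfolding bij_betw_def by (auto dest: inj_onD)
    ultimately show ?thesis unfolding E[OF that] using fSQ that by (simp only: K8_minus_K_edges_iff)
  qed
  then show ?thesis using bij unfolding isomorphic_def verts_K8_minus_K by blast
qed

lemma isomorphic_K8_minus_K_D:
  assumes "isomorphic H (K8_minus_K s t)"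
  obtains S Q where "card (verts H) = 8" "S \<inter> Q = {}"
    "\<And>u v. u \<in> verts H \<Longrightarrow> v \<in> verts H \<Longrightarrow> {u, v} \<in> edges H \<longleftrightarrow>
      u \<noteq> v \<and> \<not> (u \<in> S \<and> v \<in> Q) \<and> \<not> (u \<in> Q \<and> v \<in> S)"
proof -
  obtain f where bij: "bij_betw f (verts H) {..<8}"
    and e: "\<And>u v. u \<in> verts H \<Longrightarrow> v \<in> verts H \<Longrightarrow> {u, v} \<in> edges H \<longleftrightarrow> {f u, f v} \<in> edges (K8_minus_K s t)"
    using assms unfolding isomorphic_def verts_K8_minus_K by blast
  show thesis
  proof (rule that[of "{x. f x < s}" "{x. f x \<in> {s..<s + t}}"])
    show "card (verts H) = 8" using bij_betw_same_card[OF bij] by simp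
    fix u v assume uv: "u \<in> verts H" "v \<in> verts H"
    have "f u < 8" "f v < 8" using bij_betwE[OF bij] uv by auto
    moreover have "f u = f v \<longleftrightarrow> u = v" using bij uv unfolding bij_betw_def by (auto dest: inj_onD)
    ultimately show "{u, v} \<in> edges H \<longleftrightarrow> u \<noteq> v \<and> \<not> (u \<in> {x. f x < s} \<and> v \<in> {x. f x \<in> {s..<s + t}})
        \<and> \<not> (u \<in> {x. f x \<in> {s..<s + t}} \<and> v \<in> {x. f x < s})"
      using e[OF uv] K8_minus_K_edges_iff[of "f u" "f v"] by simp
  qed auto
qed

section \<open>From graph records to adjacency relations\<close>

lemma color_alpha_eq: "color_alpha F L \<sigma> = alpha (\<lambda>u v. {u, v} \<in> edges F) L (verts F) \<sigma>"
  unfolding color_alpha_def alpha_def independent_in_def indep_def by (simp add: conj_assoc)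

lemma alpha_antimono:
  assumes "finite X" "\<And>u v. u \<in> X \<Longrightarrow> v \<in> X \<Longrightarrow> E' u v \<Longrightarrow> E u v"
  shows "alpha E L X \<sigma> \<le> alpha E' L X \<sigma>"
proof -
  obtain Y where Y: "Y \<subseteq> X" "indep E Y" "\<And>v. v \<in> Y \<Longrightarrow> \<sigma> \<in> L v" "card Y = alpha E L X \<sigma>"
    using alpha_obtain[OF assms(1)] by metis
  have "indep E' Y" using Y(1,2) assms(2) unfolding indep_def by blast
  then show ?thesis using alpha_ge[of X Y E' \<sigma> L] Y assms(1) by metis
qed

lemma hall_condition_iff:
  assumes "simple_graph H"
  shows "hall_condition S H L \<longleftrightarrow> hall (\<lambda>u v. {u, v} \<in> edges H) S L (verts H)"
proof
  have finH: "finite (verts H)" using assms unfolding simple_graph_def by blast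
  show "hall (\<lambda>u v. {u, v} \<in> edges H) S L (verts H)" if hc: "hall_condition S H L"
    unfolding hall_def
  proof (intro allI impI)
    fix X assume X: "X \<subseteq> verts H"
    define F where "F = \<lparr>verts = X, edges = {e \<in> edges H. e \<subseteq> X}\<rparr>"
    have finX: "finite X" using X finH finite_subset by blast
    have "subgraph F H"
      using assms X finX unfolding subgraph_def simple_graph_def F_def by auto
    then have "card X \<le> (\<Sum>\<sigma>\<in>S. color_alpha F L \<sigma>)"
      using hc unfolding hall_condition_def F_def by fastforce
    also have "\<dots> \<le> (\<Sum>\<sigma>\<in>S. alpha (\<lambda>u v. {u, v} \<in> edges H) L X \<sigma>)"
      unfolding color_alpha_eq using finX by (intro sum_mono) (auto simp: F_def intro!: alpha_antimono)
    finally show "card X \<le> (\<Sum>\<sigma>\<in>S. alpha (\<lambda>u v. {u, v} \<in> edges H) L X \<sigma>)" .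
  qed
  show "hall_condition S H L" if h: "hall (\<lambda>u v. {u, v} \<in> edges H) S L (verts H)"
    unfolding hall_condition_def
  proof (intro allI impI)
    fix F assume F: "subgraph F H"
    have "card (verts F) \<le> (\<Sum>\<sigma>\<in>S. alpha (\<lambda>u v. {u, v} \<in> edges H) L (verts F) \<sigma>)"
      using h F unfolding hall_def subgraph_def by blast
    also have "\<dots> \<le> (\<Sum>\<sigma>\<in>S. color_alpha F L \<sigma>)"
      unfolding color_alpha_eq using F
      by (intro sum_mono alpha_antimono) (auto simp: subgraph_def simple_graph_def)
    finally show "card (verts F) \<le> (\<Sum>\<sigma>\<in>S. color_alpha F L \<sigma>)" .
  qed
qed

lemma list_colorable_iff:
  assumes "\<And>v. v \<in> verts H \<Longrightarrow> L v \<subseteq> S"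
  shows "list_colorable S H L \<longleftrightarrow> colourable (\<lambda>u v. {u, v} \<in> edges H) L (verts H)"
  unfolding list_colorable_def colourable_def colouring_def using assms by blast

lemma simple_adjacency_graph:
  assumes "simple_graph H"
  shows "simple_adjacency (\<lambda>u v. {u, v} \<in> edges H)"
proof
  show "{v, u} \<in> edges H" if "{u, v} \<in> edges H" for u v using that by (simp add: insert_commute)
  show "{u, u} \<notin> edges H" for u using assms unfolding simple_graph_def by fastforce
qed

lemma graphic_hall_colorable_iff:
  assumes "simple_graph H"
  shows "graphic_hall_colorable H \<longleftrightarrow>
    simple_adjacency.graphic_colourable (\<lambda>u v. {u, v} \<in> edges H) (verts H)"
proof -
  interpret simple_adjacency "\<lambda>u v. {u, v} \<in> edges H" by (rule simple_adjacency_graph[OF assms])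
  let ?V = "verts H" and ?E = "\<lambda>u v. {u, v} \<in> edges H"
  have finV: "finite ?V" using assms unfolding simple_graph_def by blast
  have tr: "(graph_hall_condition H G \<longrightarrow> graph_colorable H G) \<longleftrightarrow>
      (hall ?E ?V (\<lambda>v. {u. g v u}) ?V \<longrightarrow> colourable ?E (\<lambda>v. {u. g v u}) ?V)"
    if "verts G = ?V" "\<And>v. neighborhood G v = {u. g v u}" "\<And>u v. g u v \<Longrightarrow> v \<in> ?V" for G g
  proof -
    have n: "neighborhood G = (\<lambda>v. {u. g v u})" using that(2) by auto
    show ?thesis
      unfolding graph_hall_condition_def graph_colorable_def n that(1) hall_condition_iff[OF assms]
      by (subst list_colorable_iff) (use that(3) in auto)
  qed
  show ?thesis
  proof
    assume gh: "graphic_hall_colorable H"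
    show "graphic_colourable ?V"
      unfolding graphic_colourable_def
    proof (intro allI impI)
      fix g assume g: "\<forall>u v. g u v \<longrightarrow> g v u \<and> u \<noteq> v \<and> v \<in> ?V"
        and h: "hall ?E ?V (\<lambda>v. {u. g v u}) ?V"
      define G where "G = \<lparr>verts = ?V, edges = {{u, v} | u v. g u v}\<rparr>"
      have "e \<subseteq> ?V \<and> card e = 2" if "e \<in> edges G" for e
      proof -
        obtain u v where "e = {u, v}" "g u v" using \<open>e \<in> edges G\<close> unfolding G_def by auto
        moreover have "u \<in> ?V" "v \<in> ?V" "u \<noteq> v" using g \<open>g u v\<close> by blast+
        ultimately show ?thesis by simp
      qed
      then have "G \<in> graphs_on ?V"
        using finV unfolding graphs_on_def simple_graph_def G_def by simp
      then have "graph_hall_condition H G \<longrightarrow> graph_colorable H G"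
        using gh unfolding graphic_hall_colorable_def by blast
      moreover have "neighborhood G v = {u. g v u}" for v
        using g unfolding neighborhood_def G_def by (auto simp: doubleton_eq_iff)
      ultimately show "colourable ?E (\<lambda>v. {u. g v u}) ?V"
        using tr[of G g] g h unfolding G_def by auto
    qed
  next
    assume gc: "graphic_colourable ?V"
    show "graphic_hall_colorable H"
      unfolding graphic_hall_colorable_def
    proof (intro ballI)
      fix G assume "G \<in> graphs_on ?V"
      then have G: "simple_graph G" "verts G = ?V" unfolding graphs_on_def by auto
      interpret G: simple_adjacency "\<lambda>u v. {u, v} \<in> edges G" by (rule simple_adjacency_graph[OF G(1)])
      have in_V: "v \<in> ?V" if "{u, v} \<in> edges G" for u v
        using G that unfolding simple_graph_def by auto
      have "\<forall>u v. {u, v} \<in> edges G \<longrightarrow> {v, u} \<in> edges G \<and> u \<noteq> v \<and> v \<in> ?V"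
        using G.irrefl in_V by (auto simp: insert_commute)
      then have "hall ?E ?V (\<lambda>v. {u. {v, u} \<in> edges G}) ?V \<longrightarrow> colourable ?E (\<lambda>v. {u. {v, u} \<in> edges G}) ?V"
        by (rule mp[OF spec[OF gc[unfolded graphic_colourable_def], of "\<lambda>u v. {u, v} \<in> edges G"]])
      then show "graph_hall_condition H G \<longrightarrow> graph_colorable H G"
        by (subst tr[of G "\<lambda>u v. {u, v} \<in> edges G"]) (use G(2) in_V in \<open>auto simp: neighborhood_def insert_commute\<close>)
    qed
  qed
qed

text \<open>An induced subgraph is determined by its vertex set, so quantifying over such subgraphs
  amounts to quantifying over \<open>X\<close>.\<close>

lemma induced_obstruction_iff:
  assumes "simple_graph H" "X \<subseteq> verts H"
  shows "simple_adjacency.obstruction (\<lambda>u v. {u, v} \<in> edges H) X \<longleftrightarrow>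
    (\<exists>F. verts F = X \<and> induced_subgraph F H \<and> (\<exists>M\<in>cycles_and_diamond. isomorphic F M))"
proof -
  interpret simple_adjacency "\<lambda>u v. {u, v} \<in> edges H" by (rule simple_adjacency_graph[OF assms(1)])
  define F0 where "F0 = \<lparr>verts = X, edges = {e \<in> edges H. e \<subseteq> X}\<rparr>"
  have F0: "verts F0 = X" "induced_subgraph F0 H"
    using assms finite_subset[OF assms(2)]
    unfolding F0_def induced_subgraph_def subgraph_def simple_graph_def by auto
  have iso: "isomorphic F M \<longleftrightarrow> (\<exists>v. bij_betw v (verts M) X \<and>
      (\<forall>i\<in>verts M. \<forall>j\<in>verts M. {i, j} \<in> edges M \<longleftrightarrow> {v i, v j} \<in> edges H))"
    if F: "verts F = X" "induced_subgraph F H" for F and M :: "nat ugraph"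
  proof -
    have e: "{v i, v j} \<in> edges F \<longleftrightarrow> {v i, v j} \<in> edges H"
      if "bij_betw v (verts M) X" "i \<in> verts M" "j \<in> verts M" for v i j
      using F bij_betwE[OF that(1)] that(2,3) unfolding induced_subgraph_def by auto
    show ?thesis
      unfolding isomorphic_sym_iff[of F M] unfolding isomorphic_def F(1) using e by blast
  qed
  show ?thesis unfolding obstruction_iff using iso F0 by blast
qed

theorem corollary3p10:
  fixes H :: "'a ugraph"
  assumes "simple_graph H"
  shows "graphic_hall_colorable H \<longleftrightarrow>
    (\<forall>F. induced_subgraph F H \<and> (\<exists>M\<in>cycles_and_diamond. isomorphic F M) \<longrightarrow>
        card (verts H - verts F) \<le> 2) \<or>
    (\<exists>s t. s \<ge> 1 \<and> t \<ge> 1 \<and> s + t \<le> 6 \<and> isomorphic H (K8_minus_K s t))"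
proof -
  interpret simple_adjacency "\<lambda>u v. {u, v} \<in> edges H" by (rule simple_adjacency_graph[OF assms])
  let ?V = "verts H"
  have finV: "finite ?V" using assms unfolding simple_graph_def by blast
  have small: "(\<forall>F. induced_subgraph F H \<and> (\<exists>M\<in>cycles_and_diamond. isomorphic F M) \<longrightarrow>
        card (?V - verts F) \<le> 2) \<longleftrightarrow> (\<forall>X\<subseteq>?V. obstruction X \<longrightarrow> card (?V - X) \<le> 2)"
    (is "?A \<longleftrightarrow> ?B")
  proof
    assume ?A
    then show ?B using induced_obstruction_iff[OF assms] by blast
  next
    assume B: ?B
    show ?A
    proof (intro allI impI)
      fix F assume F: "induced_subgraph F H \<and> (\<exists>M\<in>cycles_and_diamond. isomorphic F M)"
      then have "verts F \<subseteq> ?V" unfolding induced_subgraph_def subgraph_def by blast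
      then show "card (?V - verts F) \<le> 2" using B induced_obstruction_iff[OF assms, of "verts F"] F by blast
    qed
  qed
  show ?thesis
    unfolding graphic_hall_colorable_iff[OF assms] small
  proof
    assume gc: "graphic_colourable ?V"
    show "(\<forall>X\<subseteq>?V. obstruction X \<longrightarrow> card (?V - X) \<le> 2) \<or>
      (\<exists>s t. s \<ge> 1 \<and> t \<ge> 1 \<and> s + t \<le> 6 \<and> isomorphic H (K8_minus_K s t))"
    proof (rule disjCI)
      assume "\<not> (\<exists>s t. s \<ge> 1 \<and> t \<ge> 1 \<and> s + t \<le> 6 \<and> isomorphic H (K8_minus_K s t))"
      note notK8 = this
      show "\<forall>X\<subseteq>?V. obstruction X \<longrightarrow> card (?V - X) \<le> 2"
      proof (intro allI impI, rule ccontr)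
        fix X assume X: "X \<subseteq> ?V" "obstruction X" "\<not> card (?V - X) \<le> 2"
        then have "3 \<le> card (?V - X)" by simp
        then obtain S Q where SQ: "card ?V = 8" "S \<subseteq> ?V" "Q \<subseteq> ?V" "S \<inter> Q = {}" "S \<noteq> {}" "Q \<noteq> {}"
          "card S + card Q \<le> 6" and E: "\<And>u v. u \<in> ?V \<Longrightarrow> v \<in> ?V \<Longrightarrow>
            {u, v} \<in> edges H \<longleftrightarrow> u \<noteq> v \<and> \<not> (u \<in> S \<and> v \<in> Q) \<and> \<not> (u \<in> Q \<and> v \<in> S)"
          by (rule graphic_colourable_necessary[OF finV gc X(1,2)]) (rule that)
        have "isomorphic H (K8_minus_K (card S) (card Q))"
          by (rule isomorphic_K8_minus_K_I[OF finV SQ(1-4) E])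
        moreover have "card S \<ge> 1" "card Q \<ge> 1"
          using SQ(5,6) finite_subset[OF SQ(2) finV] finite_subset[OF SQ(3) finV]
          by (simp_all add: Suc_le_eq card_gt_0_iff)
        ultimately show False using notK8 SQ(7) by blast
      qed
    qed
  next
    assume *: "(\<forall>X\<subseteq>?V. obstruction X \<longrightarrow> card (?V - X) \<le> 2) \<or>
      (\<exists>s t. s \<ge> 1 \<and> t \<ge> 1 \<and> s + t \<le> 6 \<and> isomorphic H (K8_minus_K s t))"
    show "graphic_colourable ?V"
    proof (rule graphic_colourableI[OF finV])
      fix g U assume "graphic_critical (\<lambda>u v. {u, v} \<in> edges H) g ?V U"
      then interpret graphic_critical "\<lambda>u v. {u, v} \<in> edges H" g ?V U .
      from * show False
      proof
        assume "\<forall>X\<subseteq>?V. obstruction X \<longrightarrow> card (?V - X) \<le> 2"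
        then show False using large_obstructions_contradiction by blast
      next
        assume "\<exists>s t. s \<ge> 1 \<and> t \<ge> 1 \<and> s + t \<le> 6 \<and> isomorphic H (K8_minus_K s t)"
        then obtain s t where "isomorphic H (K8_minus_K s t)" by blast
        then obtain S Q where "card ?V = 8" "S \<inter> Q = {}"
          and "\<And>u v. u \<in> ?V \<Longrightarrow> v \<in> ?V \<Longrightarrow> {u, v} \<in> edges H \<longleftrightarrow>
            u \<noteq> v \<and> \<not> (u \<in> S \<and> v \<in> Q) \<and> \<not> (u \<in> Q \<and> v \<in> S)"
          by (rule isomorphic_K8_minus_K_D) (rule that)
        then show False by (rule two_cliques_contradiction)
      qed
    qed
  qed
qed

end
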